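(* Each of the two categories $\mathbf{Ope}$ (non-symmetric operads) and $\mathbf{Ope}_\Sigma$ (symmetric operads) admits a Quillen model structure in which: (1) the weak equivalences are the operadic equivalences, i.e. the functors $F:\mathcal{P}\to\mathcal{Q}$ which are essentially surjective (that is, the functor of categories $j^*(F):j^*(\mathcal{P})\to j^*(\mathcal{Q})$ is essentially surjective) and fully faithful (that is, for all $n\ge 0$ and all objects $p_0,\ldots,p_n$ of $\mathcal{P}$ the function $F:\mathcal{P}(p_1,\ldots,p_n;p_0)\to\mathcal{Q}(Fp_1,\ldots,Fp_n;Fp_0)$ is a bijection); (2) the cofibrations are the functors $F:\mathcal{P}\to\mathcal{Q}$ that are injective on objects; (3) the fibrations are the functors $F:\mathcal{P}\to\mathcal{Q}$ such that for every $p\in\mathrm{ob}(\mathcal{P})$ and every isomorphism $\psi:Fp\to q$ in $\mathcal{Q}$ there exists an isomorphism $\phi:p\to p'$ in $\mathcal{P}$ with $F\phi=\psi$.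
   Context: Operads. A (non-symmetric) operad $\mathcal{P}$ (also called a multicategory, or coloured operad in sets) consists of a set $\mathrm{ob}(\mathcal{P})$ of objects; for all $n\ge 0$ and objects $p_0,\ldots,p_n$ a set $\mathcal{P}(p_1,\ldots,p_n;p_0)$ of morphisms $\psi:p_1,\ldots,p_n\to p_0$; for each object $p$ an identity $\mathrm{id}_p\in\mathcal{P}(p;p)$; and a composition assigning to $\psi:p_1,\ldots,p_n\to p_0$ and $\psi_i:q^i_1,\ldots,q^i_{k_i}\to p_i$ ($1\le i\le n$) a morphism $\psi\circ(\psi_1,\ldots,\psi_n):q^1_1,\ldots,q^1_{k_1},\ldots,q^n_1,\ldots,q^n_{k_n}\to p_0$. Composition is associative and unital. A symmetric operad is an operad equipped, for every $\sigma\in\Sigma_n$ and objects $p_0,\ldots,p_n$, with functions $\sigma^*:\mathcal{P}(p_1,\ldots,p_n;p_0)\to\mathcal{P}(p_{\sigma(1)},\ldots,p_{\sigma(n)};p_0)$ forming an action of the symmetric groups and compatible with composition (the usual equivariance axioms). A functor $F:\mathcal{P}\to\mathcal{Q}$ of operads is a function on objects together with functions $\mathcal{P}(p_1,\ldots,p_n;p_0)\to\mathcal{Q}(Fp_1,\ldots,Fp_n;Fp_0)$ respecting composition and identities (and, in the symmetric case, the symmetric group actions). $\mathbf{Ope}$ and $\mathbf{Ope}_\Sigma$ are the categories of non-symmetric, respectively symmetric, operads and functors. For an operad $\mathcal{P}$, $j^*(\mathcal{P})$ is its underlying category, obtained by keeping the objects and only the unary morphisms. An isomorphism in $\mathcal{P}$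 is a unary morphism that is an isomorphism in $j^*(\mathcal{P})$. A Quillen model structure on a category $\mathcal{C}$ is a choice of three classes of morphisms (weak equivalences, fibrations, cofibrations) such that: $\mathcal{C}$ has all small limits and colimits; if $h=g\circ f$ and two of $f,g,h$ are weak equivalences, then so is the third; each of the three classes is closed under retracts; in every commutative square whose left vertical arrow is a cofibration and whose right vertical arrow is a fibration, a diagonal lift exists whenever at least one of these two arrows is a weak equivalence; every morphism factors as a cofibration followed by a trivial fibration (a fibration that is a weak equivalence), and also as a trivial cofibration (a cofibration that is a weak equivalence) followed by a fibration. *)

theory Defs
  imports
    "HOL-Library.FuncSet"
    "HOL-Library.Equipollence"
    "HOL-Combinatorics.Permutations"
begin

section \<open>Smallness\<close>

text \<open>
  HOL has no type of all sets, so small and large are told apart by means of a universe type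
  \<open>'u\<close>: a set is small when it has fewer elements than \<open>'u\<close>, and the cardinality of \<open>'u\<close> is
  assumed to be (uncountable and strongly) inaccessible, as is the case for any Grothendieck
  universe containing the natural numbers, and for the type of all ZFC sets.
\<close>

definition inaccessible :: "'u set \<Rightarrow> bool" where
  "inaccessible U \<longleftrightarrow>
     (UNIV :: nat set) \<prec> U \<and>
     (\<forall>A \<subseteq> U. A \<prec> U \<longrightarrow> Pow A \<prec> U) \<and>
     (\<forall>I \<subseteq> U. \<forall>A. I \<prec> U \<and> (\<forall>i\<in>I. A i \<subseteq> U \<and> A i \<prec> U) \<longrightarrow> (\<Union>i\<in>I. A i) \<prec> U)"

abbreviation small :: "'u set \<Rightarrow> bool" where
  "small A \<equiv> A \<prec> (UNIV :: 'u set)"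


section \<open>Categories\<close>

record ('o, 'a) category =
  Ob :: "'o set"
  Arr :: "'a set"
  Dom :: "'a \<Rightarrow> 'o"
  Cod :: "'a \<Rightarrow> 'o"
  Id :: "'o \<Rightarrow> 'a"
  Comp :: "'a \<Rightarrow> 'a \<Rightarrow> 'a"  \<comment> \<open>\<open>Comp C g f\<close> is \<open>g\<close> after \<open>f\<close>\<close>

definition Hom :: "('o, 'a) category \<Rightarrow> 'o \<Rightarrow> 'o \<Rightarrow> 'a set" where
  "Hom C x y = {f \<in> Arr C. Dom C f = x \<and> Cod C f = y}"

locale category =
  fixes C :: "('o, 'a) category"
  assumes Dom_Ob: "f \<in> Arr C \<Longrightarrow> Dom C f \<in> Ob C"
    and Cod_Ob: "f \<in> Arr C \<Longrightarrow> Cod C f \<in> Ob C"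
    and Id_Hom: "x \<in> Ob C \<Longrightarrow> Id C x \<in> Hom C x x"
    and Comp_Hom: "f \<in> Hom C x y \<Longrightarrow> g \<in> Hom C y z \<Longrightarrow> Comp C g f \<in> Hom C x z"
    and Comp_Id: "f \<in> Hom C x y \<Longrightarrow> Comp C f (Id C x) = f"
    and Id_Comp: "f \<in> Hom C x y \<Longrightarrow> Comp C (Id C y) f = f"
    and Comp_assoc: "f \<in> Hom C w x \<Longrightarrow> g \<in> Hom C x y \<Longrightarrow> h \<in> Hom C y z \<Longrightarrow>
      Comp C h (Comp C g f) = Comp C (Comp C h g) f"

definition iso_in :: "('o, 'a) category \<Rightarrow> 'a \<Rightarrow> bool" where
  "iso_in C f \<longleftrightarrow> f \<in> Arr C \<and>
     (\<exists>g \<in> Hom C (Cod C f) (Dom C f).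
        Comp C g f = Id C (Dom C f) \<and> Comp C f g = Id C (Cod C f))"

definition cat_functor ::
  "('j, 'b) category \<Rightarrow> ('o, 'a) category \<Rightarrow> ('j \<Rightarrow> 'o) \<Rightarrow> ('b \<Rightarrow> 'a) \<Rightarrow> bool" where
  "cat_functor J C Do Da \<longleftrightarrow>
     (\<forall>x \<in> Ob J. Do x \<in> Ob C \<and> Da (Id J x) = Id C (Do x)) \<and>
     (\<forall>f \<in> Arr J. Da f \<in> Hom C (Do (Dom J f)) (Do (Cod J f))) \<and>
     (\<forall>f \<in> Arr J. \<forall>g \<in> Arr J. Dom J g = Cod J f \<longrightarrow> Da (Comp J g f) = Comp C (Da g) (Da f))"

text \<open>Essential surjectivity of a functor depends only on its object map \<open>h\<close>.\<close>

definition essentially_surjective ::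
  "('j, 'b) category \<Rightarrow> ('o, 'a) category \<Rightarrow> ('j \<Rightarrow> 'o) \<Rightarrow> bool" where
  "essentially_surjective D C h \<longleftrightarrow>
     (\<forall>y \<in> Ob C. \<exists>x \<in> Ob D. \<exists>f \<in> Hom C (h x) y. iso_in C f)"

definition cone ::
  "('j, 'b) category \<Rightarrow> ('o, 'a) category \<Rightarrow> ('j \<Rightarrow> 'o) \<Rightarrow> ('b \<Rightarrow> 'a) \<Rightarrow> 'o \<Rightarrow> ('j \<Rightarrow> 'a) \<Rightarrow> bool" where
  "cone J C Do Da x p \<longleftrightarrow> x \<in> Ob C \<and> (\<forall>j \<in> Ob J. p j \<in> Hom C x (Do j)) \<and>
     (\<forall>u \<in> Arr J. Comp C (Da u) (p (Dom J u)) = p (Cod J u))"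

definition cocone ::
  "('j, 'b) category \<Rightarrow> ('o, 'a) category \<Rightarrow> ('j \<Rightarrow> 'o) \<Rightarrow> ('b \<Rightarrow> 'a) \<Rightarrow> 'o \<Rightarrow> ('j \<Rightarrow> 'a) \<Rightarrow> bool" where
  "cocone J C Do Da x p \<longleftrightarrow> x \<in> Ob C \<and> (\<forall>j \<in> Ob J. p j \<in> Hom C (Do j) x) \<and>
     (\<forall>u \<in> Arr J. Comp C (p (Cod J u)) (Da u) = p (Dom J u))"

definition limit_cone ::
  "('j, 'b) category \<Rightarrow> ('o, 'a) category \<Rightarrow> ('j \<Rightarrow> 'o) \<Rightarrow> ('b \<Rightarrow> 'a) \<Rightarrow> 'o \<Rightarrow> ('j \<Rightarrow> 'a) \<Rightarrow> bool" where
  "limit_cone J C Do Da x p \<longleftrightarrow> cone J C Do Da x p \<and>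
     (\<forall>y q. cone J C Do Da y q \<longrightarrow> (\<exists>!h. h \<in> Hom C y x \<and> (\<forall>j \<in> Ob J. Comp C (p j) h = q j)))"

definition colimit_cocone ::
  "('j, 'b) category \<Rightarrow> ('o, 'a) category \<Rightarrow> ('j \<Rightarrow> 'o) \<Rightarrow> ('b \<Rightarrow> 'a) \<Rightarrow> 'o \<Rightarrow> ('j \<Rightarrow> 'a) \<Rightarrow> bool" where
  "colimit_cocone J C Do Da x p \<longleftrightarrow> cocone J C Do Da x p \<and>
     (\<forall>y q. cocone J C Do Da y q \<longrightarrow> (\<exists>!h. h \<in> Hom C x y \<and> (\<forall>j \<in> Ob J. Comp C h (p j) = q j)))"

text \<open>
  Every category with a small set of objects and a small set of arrows is isomorphic to one whose
  objects and arrows are elements of \<open>'u\<close>.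
\<close>

definition has_small_limits :: "'u itself \<Rightarrow> ('o, 'a) category \<Rightarrow> bool" where
  "has_small_limits U C \<longleftrightarrow>
     (\<forall>(J :: ('u, 'u) category) Do Da.
        category J \<and> small (Ob J) \<and> small (Arr J) \<and> cat_functor J C Do Da \<longrightarrow>
        (\<exists>x p. limit_cone J C Do Da x p))"

definition has_small_colimits :: "'u itself \<Rightarrow> ('o, 'a) category \<Rightarrow> bool" where
  "has_small_colimits U C \<longleftrightarrow>
     (\<forall>(J :: ('u, 'u) category) Do Da.
        category J \<and> small (Ob J) \<and> small (Arr J) \<and> cat_functor J C Do Da \<longrightarrow>
        (\<exists>x p. colimit_cocone J C Do Da x p))"


section \<open>Quillen model structures\<close>

definition two_out_of_three :: "('o, 'a) category \<Rightarrow> 'a set \<Rightarrow> bool" where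
  "two_out_of_three C W \<longleftrightarrow>
     (\<forall>f \<in> Arr C. \<forall>g \<in> Arr C. Cod C f = Dom C g \<longrightarrow>
        (f \<in> W \<and> g \<in> W \<longrightarrow> Comp C g f \<in> W) \<and>
        (f \<in> W \<and> Comp C g f \<in> W \<longrightarrow> g \<in> W) \<and>
        (g \<in> W \<and> Comp C g f \<in> W \<longrightarrow> f \<in> W))"

definition retract_of :: "('o, 'a) category \<Rightarrow> 'a \<Rightarrow> 'a \<Rightarrow> bool" where
  "retract_of C f g \<longleftrightarrow> f \<in> Arr C \<and> g \<in> Arr C \<and>
     (\<exists>i \<in> Hom C (Dom C f) (Dom C g). \<exists>r \<in> Hom C (Dom C g) (Dom C f).
      \<exists>j \<in> Hom C (Cod C f) (Cod C g). \<exists>s \<in> Hom C (Cod C g) (Cod C f).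
        Comp C r i = Id C (Dom C f) \<and> Comp C s j = Id C (Cod C f) \<and>
        Comp C g i = Comp C j f \<and> Comp C f r = Comp C s g)"

definition closed_under_retracts :: "('o, 'a) category \<Rightarrow> 'a set \<Rightarrow> bool" where
  "closed_under_retracts C S \<longleftrightarrow> (\<forall>f g. g \<in> S \<and> retract_of C f g \<longrightarrow> f \<in> S)"

definition has_lift :: "('o, 'a) category \<Rightarrow> 'a \<Rightarrow> 'a \<Rightarrow> bool" where
  "has_lift C i p \<longleftrightarrow>
     (\<forall>u \<in> Hom C (Dom C i) (Dom C p). \<forall>v \<in> Hom C (Cod C i) (Cod C p).
        Comp C p u = Comp C v i \<longrightarrow>
        (\<exists>h \<in> Hom C (Cod C i) (Dom C p). Comp C h i = u \<and> Comp C p h = v))"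

definition has_factorizations :: "('o, 'a) category \<Rightarrow> 'a set \<Rightarrow> 'a set \<Rightarrow> bool" where
  "has_factorizations C L R \<longleftrightarrow>
     (\<forall>f \<in> Arr C. \<exists>l \<in> L. \<exists>r \<in> R.
        Dom C l = Dom C f \<and> Cod C l = Dom C r \<and> Cod C r = Cod C f \<and> Comp C r l = f)"

definition quillen_model_structure ::
  "'u itself \<Rightarrow> ('o, 'a) category \<Rightarrow> 'a set \<Rightarrow> 'a set \<Rightarrow> 'a set \<Rightarrow> bool" where
  "quillen_model_structure U C W Fib Cof \<longleftrightarrow>
     category C \<and> W \<subseteq> Arr C \<and> Fib \<subseteq> Arr C \<and> Cof \<subseteq> Arr C \<and>
     has_small_limits U C \<and> has_small_colimits U C \<and>
     two_out_of_three C W \<and>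
     closed_under_retracts C W \<and> closed_under_retracts C Fib \<and> closed_under_retracts C Cof \<and>
     (\<forall>i \<in> Cof. \<forall>p \<in> Fib. i \<in> W \<or> p \<in> W \<longrightarrow> has_lift C i p) \<and>
     has_factorizations C Cof (Fib \<inter> W) \<and>
     has_factorizations C (Cof \<inter> W) Fib"


section \<open>Operads\<close>

text \<open>
  The sets of morphisms are given as the fibres of the input and output maps on a single set of
  morphisms, i.e. as a disjoint family. As usual for algebraic records, \<open>opid\<close>, \<open>opcomp\<close>, etc. are
  only meaningful on composable arguments from the carriers.
\<close>

record ('o, 'm) operad =
  ob :: "'o set"
  mor :: "'m set"
  ins :: "'m \<Rightarrow> 'o list"
  out :: "'m \<Rightarrow> 'o"
  opid :: "'o \<Rightarrow> 'm"
  opcomp :: "'m \<Rightarrow> 'm list \<Rightarrow> 'm"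

definition ophom :: "('o, 'm, 'z) operad_scheme \<Rightarrow> 'o list \<Rightarrow> 'o \<Rightarrow> 'm set" where
  "ophom P ps p = {f \<in> mor P. ins P f = ps \<and> out P f = p}"

definition composable :: "('o, 'm, 'z) operad_scheme \<Rightarrow> 'm \<Rightarrow> 'm list \<Rightarrow> bool" where
  "composable P f gs \<longleftrightarrow> f \<in> mor P \<and> set gs \<subseteq> mor P \<and> map (out P) gs = ins P f"

locale operad =
  fixes P :: "('o, 'm, 'z) operad_scheme"
  assumes ins_ob: "f \<in> mor P \<Longrightarrow> set (ins P f) \<subseteq> ob P"
    and out_ob: "f \<in> mor P \<Longrightarrow> out P f \<in> ob P"
    and opid_hom: "p \<in> ob P \<Longrightarrow> opid P p \<in> ophom P [p] p"
    and opcomp_hom: "composable P f gs \<Longrightarrow>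
      opcomp P f gs \<in> ophom P (concat (map (ins P) gs)) (out P f)"
    and opcomp_opid: "f \<in> mor P \<Longrightarrow> opcomp P f (map (opid P) (ins P f)) = f"
    and opid_opcomp: "f \<in> mor P \<Longrightarrow> opcomp P (opid P (out P f)) [f] = f"
    and opcomp_assoc: "composable P f gs \<Longrightarrow> list_all2 (composable P) gs hss \<Longrightarrow>
      opcomp P (opcomp P f gs) (concat hss) = opcomp P f (map2 (opcomp P) gs hss)"

text \<open>
  A permutation in \<open>\<Sigma>\<^sub>n\<close> is a function that \<open>permutes {..<n}\<close>. A rearrangement of the list
  \<open>[0..<n]\<close> is turned into such a permutation by \<open>list_perm\<close>, so that
  \<open>permute_list (list_perm L) [0..<n] = L\<close>. Thus \<open>block_perm \<sigma> ks\<close> rearranges consecutive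
  blocks of lengths \<open>ks\<close> in the way \<open>\<sigma>\<close> rearranges single entries, and \<open>sum_perm \<sigma>s ks\<close> applies
  the i-th entry of \<open>\<sigma>s\<close> within the i-th block.
\<close>

definition list_perm :: "nat list \<Rightarrow> nat \<Rightarrow> nat" where
  "list_perm L x = (if x < length L then L ! x else x)"

definition index_blocks :: "nat list \<Rightarrow> nat list list" where
  "index_blocks ks =
     map (\<lambda>i. [sum_list (take i ks) ..< sum_list (take (Suc i) ks)]) [0..<length ks]"

definition block_perm :: "(nat \<Rightarrow> nat) \<Rightarrow> nat list \<Rightarrow> nat \<Rightarrow> nat" where
  "block_perm \<sigma> ks = list_perm (concat (permute_list \<sigma> (index_blocks ks)))"

definition sum_perm :: "(nat \<Rightarrow> nat) list \<Rightarrow> nat list \<Rightarrow> nat \<Rightarrow> nat" where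
  "sum_perm \<sigma>s ks = list_perm (concat (map2 permute_list \<sigma>s (index_blocks ks)))"

record ('o, 'm) sym_operad = "('o, 'm) operad" +
  act :: "(nat \<Rightarrow> nat) \<Rightarrow> 'm \<Rightarrow> 'm"  \<comment> \<open>\<open>act P \<sigma> f\<close> is \<open>\<sigma>\<^sup>*f\<close>\<close>

definition arity :: "('o, 'm, 'z) operad_scheme \<Rightarrow> 'm \<Rightarrow> nat" where
  "arity P f = length (ins P f)"

locale sym_operad = operad P
  for P :: "('o, 'm, 'z) sym_operad_scheme" +
  assumes act_hom: "f \<in> mor P \<Longrightarrow> \<sigma> permutes {..<arity P f} \<Longrightarrow>
      act P \<sigma> f \<in> ophom P (permute_list \<sigma> (ins P f)) (out P f)"
    and act_id: "f \<in> mor P \<Longrightarrow> act P id f = f"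
    and act_comp: "f \<in> mor P \<Longrightarrow> \<sigma> permutes {..<arity P f} \<Longrightarrow> \<tau> permutes {..<arity P f} \<Longrightarrow>
      act P (\<sigma> \<circ> \<tau>) f = act P \<tau> (act P \<sigma> f)"
    and equivariance_outer: "composable P f gs \<Longrightarrow> \<sigma> permutes {..<arity P f} \<Longrightarrow>
      opcomp P (act P \<sigma> f) (permute_list \<sigma> gs) =
      act P (block_perm \<sigma> (map (arity P) gs)) (opcomp P f gs)"
    and equivariance_inner: "composable P f gs \<Longrightarrow>
      list_all2 (\<lambda>\<sigma> g. \<sigma> permutes {..<arity P g}) \<sigma>s gs \<Longrightarrow>
      opcomp P f (map2 (act P) \<sigma>s gs) =
      act P (sum_perm \<sigma>s (map (arity P) gs)) (opcomp P f gs)"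

definition underlying_category :: "('o, 'm, 'z) operad_scheme \<Rightarrow> ('o, 'm) category" where
  "underlying_category P =
     \<lparr>Ob = ob P, Arr = {f \<in> mor P. arity P f = 1},
      Dom = (\<lambda>f. hd (ins P f)), Cod = out P, Id = opid P,
      Comp = (\<lambda>g f. opcomp P g [f])\<rparr>"

abbreviation operad_iso :: "('o, 'm, 'z) operad_scheme \<Rightarrow> 'm \<Rightarrow> 'o \<Rightarrow> 'o \<Rightarrow> bool" where
  "operad_iso P f p q \<equiv>
     f \<in> Hom (underlying_category P) p q \<and> iso_in (underlying_category P) f"


section \<open>Functors of operads\<close>

text \<open>
  Functors carry their domain and codomain; their maps on objects and morphisms are undefined
  outside the carriers of the domain, so that equality of records is equality of functors.
\<close>

record ('p, 'o1, 'm1, 'o2, 'm2, 'q) operad_map =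
  source :: 'p
  target :: 'q
  on_ob :: "'o1 \<Rightarrow> 'o2"
  on_mor :: "'m1 \<Rightarrow> 'm2"

definition operad_functor ::
  "(('o1, 'm1, 'z) operad_scheme, 'o1, 'm1, 'o2, 'm2, ('o2, 'm2, 'w) operad_scheme) operad_map
     \<Rightarrow> bool" where
  "operad_functor F \<longleftrightarrow>
     (let P = source F; Q = target F in
        operad P \<and> operad Q \<and>
        on_ob F \<in> ob P \<rightarrow>\<^sub>E ob Q \<and>
        on_mor F \<in> mor P \<rightarrow>\<^sub>E mor Q \<and>
        (\<forall>f \<in> mor P. on_mor F f \<in> ophom Q (map (on_ob F) (ins P f)) (on_ob F (out P f))) \<and>
        (\<forall>p \<in> ob P. on_mor F (opid P p) = opid Q (on_ob F p)) \<and>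
        (\<forall>f gs. composable P f gs \<longrightarrow>
           on_mor F (opcomp P f gs) = opcomp Q (on_mor F f) (map (on_mor F) gs)))"

definition sym_operad_functor ::
  "(('o1, 'm1, 'z) sym_operad_scheme, 'o1, 'm1, 'o2, 'm2, ('o2, 'm2, 'w) sym_operad_scheme) operad_map
     \<Rightarrow> bool" where
  "sym_operad_functor F \<longleftrightarrow>
     sym_operad (source F) \<and> sym_operad (target F) \<and> operad_functor F \<and>
     (\<forall>f \<in> mor (source F). \<forall>\<sigma>. \<sigma> permutes {..<arity (source F) f} \<longrightarrow>
        on_mor F (act (source F) \<sigma> f) = act (target F) \<sigma> (on_mor F f))"

definition fully_faithful ::
  "(('o1, 'm1, 'z) operad_scheme, 'o1, 'm1, 'o2, 'm2, ('o2, 'm2, 'w) operad_scheme) operad_map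
     \<Rightarrow> bool" where
  "fully_faithful F \<longleftrightarrow>
     (\<forall>ps p. set ps \<subseteq> ob (source F) \<and> p \<in> ob (source F) \<longrightarrow>
        bij_betw (on_mor F) (ophom (source F) ps p)
          (ophom (target F) (map (on_ob F) ps) (on_ob F p)))"

definition operadic_equivalence ::
  "(('o1, 'm1, 'z) operad_scheme, 'o1, 'm1, 'o2, 'm2, ('o2, 'm2, 'w) operad_scheme) operad_map
     \<Rightarrow> bool" where
  "operadic_equivalence F \<longleftrightarrow>
     essentially_surjective
       (underlying_category (source F)) (underlying_category (target F)) (on_ob F) \<and>
     fully_faithful F"

definition injective_on_objects ::
  "(('o1, 'm1, 'z) operad_scheme, 'o1, 'm1, 'o2, 'm2, ('o2, 'm2, 'w) operad_scheme) operad_map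
     \<Rightarrow> bool" where
  "injective_on_objects F \<longleftrightarrow> inj_on (on_ob F) (ob (source F))"

definition lifts_isomorphisms ::
  "(('o1, 'm1, 'z) operad_scheme, 'o1, 'm1, 'o2, 'm2, ('o2, 'm2, 'w) operad_scheme) operad_map
     \<Rightarrow> bool" where
  "lifts_isomorphisms F \<longleftrightarrow>
     (\<forall>p \<in> ob (source F). \<forall>q \<psi>. operad_iso (target F) \<psi> (on_ob F p) q \<longrightarrow>
        (\<exists>p' \<phi>. operad_iso (source F) \<phi> p p' \<and> on_mor F \<phi> = \<psi>))"


section \<open>The categories of small operads\<close>

type_synonym ('p, 'u) umap = "('p, 'u, 'u, 'u, 'u, 'p) operad_map"

definition operad_map_category ::
  "('u, 'u, 'z) operad_scheme set \<Rightarrow> (('u, 'u, 'z) operad_scheme, 'u) umap set \<Rightarrow>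
     (('u, 'u, 'z) operad_scheme, (('u, 'u, 'z) operad_scheme, 'u) umap) category" where
  "operad_map_category Os Fs =
     \<lparr>Ob = Os, Arr = {F \<in> Fs. source F \<in> Os \<and> target F \<in> Os},
      Dom = source, Cod = target,
      Id = (\<lambda>P. \<lparr>source = P, target = P, on_ob = (\<lambda>p\<in>ob P. p), on_mor = (\<lambda>f\<in>mor P. f)\<rparr>),
      Comp = (\<lambda>G F. \<lparr>source = source F, target = target G,
        on_ob = compose (ob (source F)) (on_ob G) (on_ob F),
        on_mor = compose (mor (source F)) (on_mor G) (on_mor F)\<rparr>)\<rparr>"

definition Ope ::
  "(('u, 'u) operad, (('u, 'u) operad, 'u) umap) category" where
  "Ope = operad_map_category
     {P. operad P \<and> small (ob P) \<and> small (mor P)} {F. operad_functor F}"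

definition Ope_Sigma ::
  "(('u, 'u) sym_operad, (('u, 'u) sym_operad, 'u) umap) category" where
  "Ope_Sigma = operad_map_category
     {P. sym_operad P \<and> small (ob P) \<and> small (mor P)} {F. sym_operad_functor F}"

end

theory Submission
  imports Defs
begin

text \<open>
  The model structure is the operadic version of the folk model structure on the category of
  categories: all its lifting and factorisation properties come from moving morphisms along
  isomorphisms between objects.

  \<^item> \<^emph>\<open>One proof for two categories.\<close> Plain and symmetric operads are both instances of operads
    on which, in each arity \<open>n\<close>, a set \<open>G n\<close> of permutations acts: only the identity in the first
    case, all permutations in the second. The locale \<open>operad_kind\<close> collects what is used about the
    passage between such pairs of an operad and an action and the records that are the objects of
    the two categories. Everything up to \<open>model_structure\<close> is proved there.

  \<^item> \<^emph>\<open>One construction for all objects that are needed.\<close> Given operads \<open>D i\<close>, a set \<open>X\<close> and a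
    function from \<open>X\<close> to the objects of each \<open>D i\<close>, there is an operad with objects \<open>X\<close> in which a
    morphism \<open>x\<^sub>1, \<dots>, x\<^sub>n \<rightarrow> x\<close> is a family of morphisms of the \<open>D i\<close> between the respective images
    (\<open>joint_pullback\<close>). Limits are suboperads of it. For colimits, take for \<open>i\<close> \<^emph>\<open>all\<close> cocones under
    the diagram: the suboperad generated by the images of the diagram maps to every cocone by
    projection, and uniquely so because it is generated. The family of all cocones is large, but the
    generated suboperad is small since its generators form a small set (\<open>small_generated\<close>); this
    avoids free operads and quotients. With a single \<open>D i\<close>, the construction yields the middle
    objects of both factorisations, together with a fully faithful functor to \<open>D i\<close>.

  \<^item> \<^emph>\<open>Factorisations.\<close> Given \<open>F : P \<rightarrow> Q\<close>, pull \<open>Q\<close> back to the disjoint union of \<open>ob P\<close> and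
    \<open>ob Q\<close>; this gives a cofibration followed by a trivial fibration. Pulling \<open>P\<close> back to the set of
    isomorphisms \<open>F p \<cong> q\<close> gives a trivial cofibration followed by a fibration.

  \<^item> \<^emph>\<open>Lifts.\<close> A trivial fibration is surjective on objects and fully faithful, so a lift is
    determined by choosing objects outside the image of the cofibration
    (\<open>lift_against_trivial_fibration\<close>). For a trivial cofibration \<open>i : A \<rightarrow> B\<close>, choose isomorphisms
    from objects \<open>i a\<close> to all objects of \<open>B\<close>, identities on the image of \<open>i\<close>. Conjugating with them
    retracts \<open>B\<close> onto \<open>A\<close>, and conjugating with lifts of their images along the fibration corrects
    the resulting functor to a lift (\<open>lift_trivial_cofibration\<close>). The fact behind this is that
    conjugation with isomorphisms respects composition and actions (\<open>perm_functor_transport\<close>).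

  The axioms of equivariance enter through the block permutations in them, which
  \<open>permute_list_block_perm\<close> and \<open>permute_list_sum_perm\<close> describe by their effect on concatenations.
\<close>


section \<open>Block permutations\<close>

lemma permute_list_list_perm:
  assumes "length L = length xs" "set L \<subseteq> {..<length xs}"
  shows "permute_list (list_perm L) xs = map ((!) xs) L"
  using assms by (intro nth_equalityI) (auto simp: permute_list_def list_perm_def)

lemma list_perm_permutes:
  assumes "mset L = mset [0..<n]"
  shows "list_perm L permutes {..<n}"
proof -
  have len: "length L = n" using assms by (metis length_upt diff_zero mset_eq_length)
  have st: "set L = {..<n}" using assms by (metis mset_eq_setD set_upt atLeast0LessThan)
  have d: "distinct L" using assms by (metis distinct_upt mset_eq_imp_distinct_iff)
  have "bij_betw (list_perm L) {..<n} {..<n}"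
    unfolding bij_betw_def
  proof
    show "inj_on (list_perm L) {..<n}"
      using d len by (auto simp: inj_on_def list_perm_def nth_eq_iff_index_eq)
    have "list_perm L ` {..<n} = (!) L ` {..<length L}" using len by (auto simp: list_perm_def)
    also have "\<dots> = set L" by (auto simp: set_conv_nth)
    finally show "list_perm L ` {..<n} = {..<n}" using st by simp
  qed
  then show ?thesis
    by (rule bij_imp_permutes) (auto simp: list_perm_def len)
qed

lemma length_index_blocks [simp]: "length (index_blocks ks) = length ks"
  by (simp add: index_blocks_def)

lemma concat_index_blocks: "concat (index_blocks ks) = [0..<sum_list ks]"
proof (induction ks rule: rev_induct)
  case Nil then show ?case by (simp add: index_blocks_def)
next
  case (snoc k ks)
  have "index_blocks (ks @ [k]) = index_blocks ks @ [[sum_list ks..<sum_list ks + k]]"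
    by (auto simp: index_blocks_def)
  with snoc show ?case
    by (simp add: upt_add_eq_append[of 0 "sum_list ks" k, simplified])
qed

lemma length_nth_index_blocks: "i < length ks \<Longrightarrow> length (index_blocks ks ! i) = ks ! i"
  by (simp add: index_blocks_def take_Suc_conv_app_nth)

lemma length_index_blocks_entries: "map length (index_blocks ks) = ks"
  by (rule nth_equalityI) (auto simp: index_blocks_def take_Suc_conv_app_nth)

text \<open>
  The blocks of indices locate the lists \<open>xss\<close> inside their concatenation. Reading off entries
  therefore turns any rearrangement of blocks of indices into the same rearrangement of \<open>xss\<close>.
\<close>

lemma map_nth_index_blocks:
  assumes "ks = map length xss"
  shows "map (map ((!) (concat xss))) (index_blocks ks) = xss"
proof -
  have "map ((!) (concat xss)) (concat (index_blocks ks)) = concat xss"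
    using assms by (simp add: concat_index_blocks map_nth length_concat del: map_concat flip: length_concat)
  then have "concat (map (map ((!) (concat xss))) (index_blocks ks)) = concat xss"
    by (simp add: map_concat)
  then show ?thesis
  proof (rule concat_injective)
    show "length (map (map ((!) (concat xss))) (index_blocks ks)) = length xss"
      using assms by simp
    show "\<forall>(x, y)\<in>set (zip (map (map ((!) (concat xss))) (index_blocks ks)) xss). length x = length y"
      using length_index_blocks_entries[of ks] assms
      by (auto simp: in_set_zip map_equality_iff)
  qed
qed

lemma mset_concat_permute_list:
  assumes "\<sigma> permutes {..<length xss}"
  shows "mset (concat (permute_list \<sigma> xss)) = mset (concat xss)"
proof -
  have "mset (concat yss) = sum_mset (image_mset mset (mset yss))" for yss :: "'a list list"
    by (induction yss) auto
  then show ?thesis using assms by simp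
qed

lemma block_perm_permutes:
  assumes "\<sigma> permutes {..<length ks}"
  shows "block_perm \<sigma> ks permutes {..<sum_list ks}"
proof -
  have "mset (concat (permute_list \<sigma> (index_blocks ks))) = mset (concat (index_blocks ks))"
    using assms by (simp add: mset_concat_permute_list)
  then show ?thesis
    unfolding block_perm_def concat_index_blocks by (rule list_perm_permutes)
qed

text \<open>
  This characterises the block permutation without indices. In an operad it says that both sides
  of the outer equivariance axiom have the same inputs.
\<close>

lemma permute_list_block_perm:
  assumes "\<sigma> permutes {..<length xss}"
  shows "permute_list (block_perm \<sigma> (map length xss)) (concat xss) = concat (permute_list \<sigma> xss)"
proof -
  let ?B = "index_blocks (map length xss)"
  have m: "mset (concat (permute_list \<sigma> ?B)) = mset [0..<length (concat xss)]"
    using assms by (simp add: mset_concat_permute_list concat_index_blocks length_concat)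
  have "permute_list (block_perm \<sigma> (map length xss)) (concat xss)
      = map ((!) (concat xss)) (concat (permute_list \<sigma> ?B))"
    unfolding block_perm_def
  proof (rule permute_list_list_perm)
    show "length (concat (permute_list \<sigma> ?B)) = length (concat xss)"
      using m by (metis length_upt diff_zero mset_eq_length)
    show "set (concat (permute_list \<sigma> ?B)) \<subseteq> {..<length (concat xss)}"
      using mset_eq_setD[OF m] by auto
  qed
  also have "\<dots> = concat (permute_list \<sigma> (map (map ((!) (concat xss))) ?B))"
    using assms by (simp add: map_concat permute_list_map)
  also have "\<dots> = concat (permute_list \<sigma> xss)" by (simp add: map_nth_index_blocks)
  finally show ?thesis .
qed

lemma mset_concat_map2_permute:
  assumes "list_all2 (\<lambda>\<sigma> xs. \<sigma> permutes {..<length xs}) \<sigma>s xss"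
  shows "mset (concat (map2 permute_list \<sigma>s xss)) = mset (concat xss)"
  using assms by (induction rule: list_all2_induct) auto

lemma list_all2_index_blocks:
  assumes "list_all2 (\<lambda>\<sigma> k. \<sigma> permutes {..<k}) \<sigma>s ks"
  shows "list_all2 (\<lambda>\<sigma> xs. \<sigma> permutes {..<length xs}) \<sigma>s (index_blocks ks)"
  using assms by (auto simp: list_all2_conv_all_nth length_nth_index_blocks)

lemma permute_list_sum_perm:
  assumes "list_all2 (\<lambda>\<sigma> xs. \<sigma> permutes {..<length xs}) \<sigma>s xss"
  shows "permute_list (sum_perm \<sigma>s (map length xss)) (concat xss) = concat (map2 permute_list \<sigma>s xss)"
proof -
  let ?B = "index_blocks (map length xss)"
  have a: "list_all2 (\<lambda>\<sigma> xs. \<sigma> permutes {..<length xs}) \<sigma>s ?B"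
    using assms by (intro list_all2_index_blocks) (simp add: list_all2_conv_all_nth)
  have m: "mset (concat (map2 permute_list \<sigma>s ?B)) = mset [0..<length (concat xss)]"
    by (simp add: mset_concat_map2_permute[OF a] concat_index_blocks length_concat)
  have "permute_list (sum_perm \<sigma>s (map length xss)) (concat xss)
      = map ((!) (concat xss)) (concat (map2 permute_list \<sigma>s ?B))"
    unfolding sum_perm_def
  proof (rule permute_list_list_perm)
    show "length (concat (map2 permute_list \<sigma>s ?B)) = length (concat xss)"
      using m by (metis length_upt diff_zero mset_eq_length)
    show "set (concat (map2 permute_list \<sigma>s ?B)) \<subseteq> {..<length (concat xss)}"
      using mset_eq_setD[OF m] by auto
  qed
  also have "\<dots> = concat (map2 permute_list \<sigma>s (map (map ((!) (concat xss))) ?B))"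
    using a unfolding map_concat
    by (intro arg_cong[where f = concat] nth_equalityI)
      (auto simp: list_all2_conv_all_nth permute_list_map)
  also have "\<dots> = concat (map2 permute_list \<sigma>s xss)" by (simp add: map_nth_index_blocks)
  finally show ?thesis .
qed

text \<open>
  A permutation can be recovered from its effect on one list without repetitions.
\<close>

lemma permutes_eq_if_permute_list:
  assumes "\<sigma> permutes {..<n}" "\<tau> permutes {..<n}"
    and "permute_list \<sigma> [0..<n] = permute_list \<tau> [0..<n]"
  shows "\<sigma> = \<tau>"
proof
  fix x show "\<sigma> x = \<tau> x"
  proof (cases "x < n")
    case True
    then show ?thesis
      using arg_cong[OF assms(3), of "\<lambda>l. l ! x"]
        permutes_in_image[OF assms(1), of x] permutes_in_image[OF assms(2), of x]
      by (simp add: permute_list_def)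
  next
    case False
    then show ?thesis using assms(1,2) by (simp add: permutes_def)
  qed
qed

text \<open>
  Composing with unary operations leaves the permutation of the inputs unchanged. Together with
  the next lemma, this makes conjugation with isomorphisms equivariant.
\<close>

lemma block_perm_unary:
  assumes "\<sigma> permutes {..<n}"
  shows "block_perm \<sigma> (replicate n 1) = \<sigma>"
proof (rule permutes_eq_if_permute_list[OF _ assms])
  let ?xss = "map (\<lambda>i. [i]) [0..<n]"
  show "block_perm \<sigma> (replicate n 1) permutes {..<n}"
    using block_perm_permutes[of \<sigma> "replicate n 1"] assms by (simp add: sum_list_replicate)
  have e: "map length ?xss = replicate n 1" by (intro nth_equalityI) auto
  show "permute_list (block_perm \<sigma> (replicate n 1)) [0..<n] = permute_list \<sigma> [0..<n]"
    using permute_list_block_perm[of \<sigma> ?xss] assms unfolding e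
    by (simp add: permute_list_map comp_def)
qed

lemma sum_perm_singleton:
  assumes "\<sigma> permutes {..<n}"
  shows "sum_perm [\<sigma>] [n] = \<sigma>"
proof -
  have "sum_perm [\<sigma>] [n] = list_perm (permute_list \<sigma> [0..<n])"
    by (simp add: sum_perm_def index_blocks_def)
  also have "\<dots> = \<sigma>"
  proof
    fix x show "list_perm (permute_list \<sigma> [0..<n]) x = \<sigma> x"
      using permutes_in_image[OF assms, of x] assms
      by (auto simp: list_perm_def permute_list_def permutes_def)
  qed
  finally show ?thesis .
qed


section \<open>Closure properties of smallness\<close>

text \<open>
  The type argument keeps the universe visible in statements about sets of other types.
\<close>

definition small_in :: "'u itself \<Rightarrow> 'a set \<Rightarrow> bool" where
  "small_in U A \<longleftrightarrow> A \<prec> (UNIV :: 'u set)"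

locale universe =
  fixes U :: "'u itself"
  assumes inaccessible_UNIV: "inaccessible (UNIV :: 'u set)"
begin

abbreviation is_small :: "'a set \<Rightarrow> bool" where
  "is_small \<equiv> small_in U"

lemma small_lepoll: "is_small B \<Longrightarrow> A \<lesssim> B \<Longrightarrow> is_small A"
  unfolding small_in_def by (rule lesspoll_trans1)

lemma small_subset: "is_small B \<Longrightarrow> A \<subseteq> B \<Longrightarrow> is_small A"
  by (rule small_lepoll[OF _ subset_imp_lepoll])

lemma small_image: "is_small A \<Longrightarrow> is_small (f ` A)"
  by (rule small_lepoll[OF _ image_lepoll])

lemma small_nat: "is_small (UNIV :: nat set)"
  using inaccessible_UNIV by (simp add: inaccessible_def small_in_def)

lemma small_finite: "finite A \<Longrightarrow> is_small A"
  by (rule small_lepoll[OF small_nat]) (simp add: finite_lepoll_infinite)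

lemma small_inj: "is_small A \<Longrightarrow> \<exists>e :: 'a \<Rightarrow> 'u. inj_on e A"
  unfolding small_in_def by (drule lesspoll_imp_lepoll) (auto simp: lepoll_def)

lemma ex_pairing: "\<exists>p :: 'u \<times> 'u \<Rightarrow> 'u. inj p"
proof -
  have "infinite (UNIV :: 'u set)"
    using small_nat lesspoll_imp_lepoll infinite_le_lepoll unfolding small_in_def by blast
  then have "ordIso2 (card_of ((UNIV :: 'u set) \<times> (UNIV :: 'u set))) (card_of (UNIV :: 'u set))"
    by (rule card_of_Times_same_infinite)
  then obtain p where "bij_betw p ((UNIV :: 'u set) \<times> (UNIV :: 'u set)) (UNIV :: 'u set)"
    using card_of_ordIso by blast
  then show ?thesis by (auto simp: bij_betw_def)
qed

text \<open>
  Inaccessibility speaks only of unions of subsets of the universe itself. The sets \<open>A i\<close> are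
  therefore copied into the universe, disjointly, by pairing each element with its index; the union
  is an image of the union of the copies.
\<close>

lemma small_UN:
  fixes A :: "'i \<Rightarrow> 'a set"
  assumes I: "is_small I" and A: "\<And>i. i \<in> I \<Longrightarrow> is_small (A i)"
  shows "is_small (\<Union>i\<in>I. A i)"
proof -
  obtain e :: "'i \<Rightarrow> 'u" where e: "inj_on e I" using small_inj[OF I] by blast
  obtain p :: "'u \<times> 'u \<Rightarrow> 'u" where p: "inj p" using ex_pairing by blast
  have "\<forall>i\<in>I. \<exists>a :: 'a \<Rightarrow> 'u. inj_on a (A i)" using small_inj[OF A] by blast
  then obtain a :: "'i \<Rightarrow> 'a \<Rightarrow> 'u" where a: "\<And>i. i \<in> I \<Longrightarrow> inj_on (a i) (A i)" by metis
  define B where "B u = (\<lambda>x. p (u, a (inv_into I e u) x)) ` A (inv_into I e u)" for u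
  have "is_small (\<Union>u\<in>e ` I. B u)"
  proof -
    have "\<forall>u\<in>e ` I. B u \<subseteq> UNIV \<and> is_small (B u)"
      unfolding B_def using e by (auto intro!: small_image A)
    then show ?thesis
      using inaccessible_UNIV small_image[OF I, of e] unfolding inaccessible_def small_in_def by blast
  qed
  moreover have "(\<Union>i\<in>I. A i) \<subseteq>
      (\<lambda>v. case inv p v of (u, w) \<Rightarrow> inv_into (A (inv_into I e u)) (a (inv_into I e u)) w) ` (\<Union>u\<in>e ` I. B u)"
  proof
    fix x assume "x \<in> (\<Union>i\<in>I. A i)"
    then obtain i where i: "i \<in> I" "x \<in> A i" by blast
    have "p (e i, a i x) \<in> (\<Union>u\<in>e ` I. B u)"
      using i e by (auto simp: B_def)
    moreover have "x = (case inv p (p (e i, a i x)) of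
        (u, w) \<Rightarrow> inv_into (A (inv_into I e u)) (a (inv_into I e u)) w)"
      using i e a p by simp
    ultimately show "x \<in> (\<lambda>v. case inv p v of (u, w) \<Rightarrow>
        inv_into (A (inv_into I e u)) (a (inv_into I e u)) w) ` (\<Union>u\<in>e ` I. B u)"
      by (rule rev_image_eqI)
  qed
  ultimately show ?thesis
    by (meson small_subset small_image)
qed

lemma small_Pow:
  assumes "is_small A"
  shows "is_small (Pow A)"
proof -
  obtain e :: "'a \<Rightarrow> 'u" where e: "inj_on e A" using small_inj[OF assms] by blast
  have "is_small (Pow (e ` A))"
    using inaccessible_UNIV small_image[OF assms, of e] unfolding inaccessible_def small_in_def by blast
  moreover have "Pow A \<lesssim> Pow (e ` A)"
    using inj_on_image_Pow[OF e] unfolding lepoll_def by (intro exI[of _ "image e"]) auto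
  ultimately show ?thesis by (rule small_lepoll)
qed

lemma small_Sigma:
  assumes "is_small A" "\<And>x. x \<in> A \<Longrightarrow> is_small (B x)"
  shows "is_small (Sigma A B)"
proof -
  have "Sigma A B = (\<Union>x\<in>A. Pair x ` B x)" by auto
  then show ?thesis using assms by (auto intro!: small_UN small_image)
qed

lemma small_Times: "is_small A \<Longrightarrow> is_small B \<Longrightarrow> is_small (A \<times> B)"
  by (rule small_Sigma)

lemma small_Plus: "is_small A \<Longrightarrow> is_small B \<Longrightarrow> is_small (A <+> B)"
proof -
  assume "is_small A" "is_small B"
  then have "is_small (\<Union>b\<in>UNIV. if b then Inl ` A else Inr ` B)"
    by (intro small_UN small_finite[OF finite]) (auto intro: small_image)
  also have "(\<Union>b\<in>UNIV. if b then Inl ` A else Inr ` B) = A <+> B" by auto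
  finally show ?thesis .
qed

lemma small_Un: "is_small A \<Longrightarrow> is_small B \<Longrightarrow> is_small (A \<union> B)"
  using small_image[OF small_Plus, of A B "case_sum id id"]
  by (simp add: Plus_def image_Un image_image)

text \<open>
  A function is determined by its graph, so this follows from the closure under power sets.
\<close>

lemma small_PiE:
  assumes "is_small I" "\<And>i. i \<in> I \<Longrightarrow> is_small (A i)"
  shows "is_small (PiE I A)"
proof (rule small_lepoll[OF small_Pow[OF small_Sigma[OF assms]]])
  have "inj_on (\<lambda>f. (\<lambda>i. (i, f i)) ` I) (PiE I A)"
  proof (rule inj_onI)
    fix f g assume fg: "f \<in> PiE I A" "g \<in> PiE I A" "(\<lambda>i. (i, f i)) ` I = (\<lambda>i. (i, g i)) ` I"
    show "f = g"
    proof (rule PiE_ext[OF fg(1,2)])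
      fix i assume "i \<in> I"
      then have "(i, f i) \<in> (\<lambda>i. (i, g i)) ` I" using fg(3) by blast
      then show "f i = g i" by auto
    qed
  qed
  then show "PiE I A \<lesssim> Pow (Sigma I A)"
    unfolding lepoll_def
    by (intro exI[of _ "\<lambda>f. (\<lambda>i. (i, f i)) ` I"] conjI) (auto simp: PiE_mem)
qed

lemma small_lists:
  assumes "is_small A"
  shows "is_small (lists A)"
proof -
  have "lists A \<subseteq> (\<Union>n. (\<lambda>f. map f [0..<n]) ` ({..<n} \<rightarrow>\<^sub>E A))"
  proof
    fix xs assume "xs \<in> lists A"
    then have "xs = map (\<lambda>i\<in>{..<length xs}. xs ! i) [0..<length xs]"
        "(\<lambda>i\<in>{..<length xs}. xs ! i) \<in> {..<length xs} \<rightarrow>\<^sub>E A"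
      by (auto intro!: nth_equalityI)
    then show "xs \<in> (\<Union>n. (\<lambda>f. map f [0..<n]) ` ({..<n} \<rightarrow>\<^sub>E A))" by blast
  qed
  then show ?thesis
    by (rule small_subset[rotated])
      (intro small_UN small_nat small_image small_PiE small_finite assms finite_lessThan)
qed

lemma small_nat_fun: "is_small (UNIV :: (nat \<Rightarrow> nat) set)"
  using small_PiE[OF small_nat, of "\<lambda>_. UNIV :: nat set"] small_nat by simp

end


section \<open>Operads with an action of prescribed permutations\<close>

text \<open>
  There are two intended instances of \<open>G n\<close>: the singleton of the identity, for which the axioms
  amount to those of an operad, and the symmetric group. The action is a separate argument so that
  the operad may be of any record type.
\<close>

locale perm_operad = operad P
  for G :: "nat \<Rightarrow> (nat \<Rightarrow> nat) set"
    and P :: "('o, 'm, 'z) operad_scheme"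
    and a :: "(nat \<Rightarrow> nat) \<Rightarrow> 'm \<Rightarrow> 'm" +
  assumes G_permutes: "\<sigma> \<in> G n \<Longrightarrow> \<sigma> permutes {..<n}"
    and pact_hom: "f \<in> mor P \<Longrightarrow> \<sigma> \<in> G (arity P f) \<Longrightarrow>
      a \<sigma> f \<in> ophom P (permute_list \<sigma> (ins P f)) (out P f)"
    and pact_id: "f \<in> mor P \<Longrightarrow> a id f = f"
    and pact_comp: "f \<in> mor P \<Longrightarrow> \<sigma> \<in> G (arity P f) \<Longrightarrow> \<tau> \<in> G (arity P f) \<Longrightarrow>
      a (\<sigma> \<circ> \<tau>) f = a \<tau> (a \<sigma> f)"
    and pequivariance_outer: "composable P f gs \<Longrightarrow> \<sigma> \<in> G (arity P f) \<Longrightarrow>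
      opcomp P (a \<sigma> f) (permute_list \<sigma> gs) =
      a (block_perm \<sigma> (map (arity P) gs)) (opcomp P f gs)"
    and pequivariance_inner: "composable P f gs \<Longrightarrow>
      list_all2 (\<lambda>\<sigma> g. \<sigma> \<in> G (arity P g)) \<sigma>s gs \<Longrightarrow>
      opcomp P f (map2 a \<sigma>s gs) =
      a (sum_perm \<sigma>s (map (arity P) gs)) (opcomp P f gs)"

text \<open>
  Functors are treated as pairs of maps that are arbitrary outside the carriers. This allows
  composing them without restricting; only arrows of the category of operads are restricted.
\<close>

definition perm_functor ::
  "(nat \<Rightarrow> (nat \<Rightarrow> nat) set) \<Rightarrow> ('o1, 'm1, 'z) operad_scheme \<Rightarrow> ((nat \<Rightarrow> nat) \<Rightarrow> 'm1 \<Rightarrow> 'm1) \<Rightarrow>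
     ('o2, 'm2, 'w) operad_scheme \<Rightarrow> ((nat \<Rightarrow> nat) \<Rightarrow> 'm2 \<Rightarrow> 'm2) \<Rightarrow>
     ('o1 \<Rightarrow> 'o2) \<Rightarrow> ('m1 \<Rightarrow> 'm2) \<Rightarrow> bool" where
  "perm_functor G P a Q b fo fm \<longleftrightarrow>
     (\<forall>p \<in> ob P. fo p \<in> ob Q) \<and>
     (\<forall>f \<in> mor P. fm f \<in> ophom Q (map fo (ins P f)) (fo (out P f))) \<and>
     (\<forall>p \<in> ob P. fm (opid P p) = opid Q (fo p)) \<and>
     (\<forall>f gs. composable P f gs \<longrightarrow> fm (opcomp P f gs) = opcomp Q (fm f) (map fm gs)) \<and>
     (\<forall>f \<in> mor P. \<forall>\<sigma> \<in> G (arity P f). fm (a \<sigma> f) = b \<sigma> (fm f))"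

lemma ophom_iff: "f \<in> ophom P ps p \<longleftrightarrow> f \<in> mor P \<and> ins P f = ps \<and> out P f = p"
  by (simp add: ophom_def)

lemma perm_functorI:
  assumes "\<And>p. p \<in> ob P \<Longrightarrow> fo p \<in> ob Q"
    and "\<And>f. f \<in> mor P \<Longrightarrow> fm f \<in> ophom Q (map fo (ins P f)) (fo (out P f))"
    and "\<And>p. p \<in> ob P \<Longrightarrow> fm (opid P p) = opid Q (fo p)"
    and "\<And>f gs. composable P f gs \<Longrightarrow> fm (opcomp P f gs) = opcomp Q (fm f) (map fm gs)"
    and "\<And>f \<sigma>. f \<in> mor P \<Longrightarrow> \<sigma> \<in> G (arity P f) \<Longrightarrow> fm (a \<sigma> f) = b \<sigma> (fm f)"
  shows "perm_functor G P a Q b fo fm"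
  using assms by (auto simp: perm_functor_def)

lemma perm_functorD:
  assumes "perm_functor G P a Q b fo fm"
  shows pf_ob: "p \<in> ob P \<Longrightarrow> fo p \<in> ob Q"
    and pf_hom: "f \<in> mor P \<Longrightarrow> fm f \<in> ophom Q (map fo (ins P f)) (fo (out P f))"
    and pf_mor: "f \<in> mor P \<Longrightarrow> fm f \<in> mor Q"
    and pf_ins: "f \<in> mor P \<Longrightarrow> ins Q (fm f) = map fo (ins P f)"
    and pf_out: "f \<in> mor P \<Longrightarrow> out Q (fm f) = fo (out P f)"
    and pf_opid: "p \<in> ob P \<Longrightarrow> fm (opid P p) = opid Q (fo p)"
    and pf_opcomp: "composable P f gs \<Longrightarrow> fm (opcomp P f gs) = opcomp Q (fm f) (map fm gs)"
    and pf_act: "f \<in> mor P \<Longrightarrow> \<sigma> \<in> G (arity P f) \<Longrightarrow> fm (a \<sigma> f) = b \<sigma> (fm f)"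
    and pf_arity: "f \<in> mor P \<Longrightarrow> arity Q (fm f) = arity P f"
  using assms by (auto simp: perm_functor_def ophom_iff arity_def)

lemma pf_composable:
  assumes "perm_functor G P a Q b fo fm" "composable P f gs"
  shows "composable Q (fm f) (map fm gs)"
proof -
  have m: "f \<in> mor P" "set gs \<subseteq> mor P" "map (out P) gs = ins P f"
    using assms(2) by (auto simp: composable_def)
  have "map (out Q) (map fm gs) = map fo (map (out P) gs)"
    using m(2) pf_out[OF assms(1)] by auto
  then show ?thesis
    using m pf_mor[OF assms(1)] pf_ins[OF assms(1)] by (auto simp: composable_def)
qed

lemma perm_functor_compose:
  assumes F: "perm_functor G P a Q b fo fm" and H: "perm_functor G Q b R c ho hm"
  shows "perm_functor G P a R c (ho \<circ> fo) (hm \<circ> fm)"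
proof (rule perm_functorI)
  fix f gs assume "composable P f gs"
  then show "(hm \<circ> fm) (opcomp P f gs) = opcomp R ((hm \<circ> fm) f) (map (hm \<circ> fm) gs)"
    using pf_opcomp[OF F] pf_opcomp[OF H] pf_composable[OF F] by simp
qed (use F H in \<open>auto simp: pf_ob pf_opid pf_act ophom_iff pf_mor pf_ins pf_out pf_arity\<close>)

lemma (in operad) composable_hom:
  "composable P f gs \<Longrightarrow> opcomp P f gs \<in> mor P"
  "composable P f gs \<Longrightarrow> ins P (opcomp P f gs) = concat (map (ins P) gs)"
  "composable P f gs \<Longrightarrow> out P (opcomp P f gs) = out P f"
  using opcomp_hom by (auto simp: ophom_iff)

lemma (in operad) opid_hom':
  "p \<in> ob P \<Longrightarrow> opid P p \<in> mor P"
  "p \<in> ob P \<Longrightarrow> ins P (opid P p) = [p]"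
  "p \<in> ob P \<Longrightarrow> out P (opid P p) = p"
  using opid_hom by (auto simp: ophom_iff)

lemma (in perm_operad) pact_hom':
  assumes "f \<in> mor P" "\<sigma> \<in> G (arity P f)"
  shows "a \<sigma> f \<in> mor P" "ins P (a \<sigma> f) = permute_list \<sigma> (ins P f)" "out P (a \<sigma> f) = out P f"
    "arity P (a \<sigma> f) = arity P f"
  using pact_hom[OF assms] by (auto simp: ophom_iff arity_def)


section \<open>Suboperads\<close>

lemma perm_operad_sub:
  fixes P :: "('o, 'm, 'z) operad_scheme"
  assumes "perm_operad G P a" and M: "M \<subseteq> mor P"
    and cid: "\<And>p. p \<in> ob P \<Longrightarrow> opid P p \<in> M"
    and ccomp: "\<And>f gs. composable P f gs \<Longrightarrow> f \<in> M \<Longrightarrow> set gs \<subseteq> M \<Longrightarrow> opcomp P f gs \<in> M"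
    and cact: "\<And>f \<sigma>. f \<in> M \<Longrightarrow> \<sigma> \<in> G (arity P f) \<Longrightarrow> a \<sigma> f \<in> M"
  shows "perm_operad G (P\<lparr>mor := M\<rparr>) a"
proof -
  interpret perm_operad G P a by fact
  let ?S = "P\<lparr>mor := M\<rparr>"
  have c: "composable ?S f gs \<longleftrightarrow> composable P f gs \<and> f \<in> M \<and> set gs \<subseteq> M" for f gs
    using M by (auto simp: composable_def)
  have ar: "arity ?S = arity P" by (simp add: arity_def fun_eq_iff)
  show ?thesis
  proof
    fix f gs hss assume 1: "composable ?S f gs" and 2: "list_all2 (composable ?S) gs hss"
    have "list_all2 (composable P) gs hss"
      using 2 by (rule list_all2_mono) (simp add: c)
    then show "opcomp ?S (opcomp ?S f gs) (concat hss) = opcomp ?S f (map2 (opcomp ?S) gs hss)"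
      using 1 opcomp_assoc by (simp add: c)
  qed (use M cid ccomp cact in \<open>auto simp: c ar ophom_iff subset_iff composable_hom opid_hom'
      pact_hom' opcomp_opid opid_opcomp pact_id pact_comp
      pequivariance_outer pequivariance_inner dest: ins_ob out_ob G_permutes\<close>)
qed

inductive_set generated :: "(nat \<Rightarrow> (nat \<Rightarrow> nat) set) \<Rightarrow> ('o, 'm, 'z) operad_scheme \<Rightarrow>
    ((nat \<Rightarrow> nat) \<Rightarrow> 'm \<Rightarrow> 'm) \<Rightarrow> 'm set \<Rightarrow> 'm set"
  for G :: "nat \<Rightarrow> (nat \<Rightarrow> nat) set" and P :: "('o, 'm, 'z) operad_scheme"
    and a :: "(nat \<Rightarrow> nat) \<Rightarrow> 'm \<Rightarrow> 'm" and B :: "'m set" where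
  generated_base: "f \<in> B \<Longrightarrow> f \<in> generated G P a B"
| generated_opid: "p \<in> ob P \<Longrightarrow> opid P p \<in> generated G P a B"
| generated_opcomp: "composable P f gs \<Longrightarrow> f \<in> generated G P a B \<Longrightarrow>
    (\<And>g. g \<in> set gs \<Longrightarrow> g \<in> generated G P a B) \<Longrightarrow> opcomp P f gs \<in> generated G P a B"
| generated_act: "f \<in> generated G P a B \<Longrightarrow> \<sigma> \<in> G (arity P f) \<Longrightarrow> a \<sigma> f \<in> generated G P a B"

lemma (in perm_operad) generated_subset:
  assumes "B \<subseteq> mor P" shows "generated G P a B \<subseteq> mor P"
proof
  fix f assume "f \<in> generated G P a B"
  then show "f \<in> mor P"
    by induction (use assms in \<open>auto simp: composable_hom opid_hom' pact_hom'\<close>)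
qed

lemma (in perm_operad) perm_operad_generated:
  assumes "B \<subseteq> mor P" shows "perm_operad G (P\<lparr>mor := generated G P a B\<rparr>) a"
  by (rule perm_operad_sub)
    (use generated_subset[OF assms] in \<open>auto simp: perm_operad_axioms intro: generated.intros\<close>)

text \<open>
  The generated set is exhausted by countably many stages, each of which adds to the previous one
  the results of all operations. The stages remain small because the finite lists over a small set,
  and all functions on the natural numbers, form small sets.
\<close>

lemma (in universe) small_generated:
  assumes "is_small (ob P)" "is_small B"
  shows "is_small (generated G P a B)"
proof -
  define step where "step S = S \<union> (\<lambda>(f, gs). opcomp P f gs) ` (S \<times> lists S) \<union>
      (\<lambda>(\<sigma>, f). a \<sigma> f) ` (UNIV \<times> S)" for S
  \<comment> \<open>The stages: the generators and identities, then repeatedly all composites and actions.\<close>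
  define T where "T n = (step ^^ n) (B \<union> opid P ` ob P)" for n
  have sm: "is_small (T n)" for n
    unfolding T_def
    by (induction n)
      (auto simp: step_def intro!: small_Un small_image small_Times small_lists small_nat_fun assms)
  have mono: "T m \<subseteq> T n" if "m \<le> n" for m n
    using that by (rule lift_Suc_mono_le[rotated]) (auto simp: T_def step_def)
  have "generated G P a B \<subseteq> (\<Union>n. T n)"
  proof
    fix f assume "f \<in> generated G P a B"
    then show "f \<in> (\<Union>n. T n)"
    proof induction
      case (generated_base f)
      then have "f \<in> T 0" by (simp add: T_def)
      then show ?case by blast
    next
      case (generated_opid p)
      then have "opid P p \<in> T 0" by (simp add: T_def)
      then show ?case by blast
    next
      case (generated_opcomp f gs)
      then obtain k where k: "f \<in> T k" by blast
      have "\<forall>g\<in>set gs. \<exists>n. g \<in> T n" using generated_opcomp by blast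
      then obtain N where N: "\<And>g. g \<in> set gs \<Longrightarrow> g \<in> T (N g)" by metis
      \<comment> \<open>A composite has finitely many constituents, which all lie in a common stage.\<close>
      define n where "n = Max (insert k (N ` set gs))"
      have "f \<in> T n" using k mono[of k n] by (auto simp: n_def)
      moreover have "g \<in> T n" if "g \<in> set gs" for g
        using N[OF that] mono[of "N g" n] that by (auto simp: n_def)
      ultimately have "opcomp P f gs \<in> T (Suc n)"
        by (force simp: T_def step_def)
      then show ?case by blast
    next
      case (generated_act f \<sigma>)
      then obtain k where k: "f \<in> T k" by blast
      then have "a \<sigma> f \<in> T (Suc k)" by (force simp: T_def step_def)
      then show ?case by blast
    qed
  qed
  then show ?thesis
    by (rule small_subset[rotated]) (intro small_UN small_nat sm)
qed


section \<open>Transport of structure along injections\<close>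

text \<open>
  The operad \<open>P\<close> with its objects and morphisms renamed by injections \<open>eo\<close> and \<open>em\<close>. It serves to
  replace a small operad on an auxiliary type by one whose carriers consist of elements of the
  universe.
\<close>

definition encode :: "('o \<Rightarrow> 'o2) \<Rightarrow> ('m \<Rightarrow> 'm2) \<Rightarrow> ('o, 'm, 'z) operad_scheme \<Rightarrow> ('o2, 'm2) operad" where
  "encode eo em P =
     \<lparr>ob = eo ` ob P, mor = em ` mor P,
      ins = (\<lambda>f. map eo (ins P (inv_into (mor P) em f))),
      out = (\<lambda>f. eo (out P (inv_into (mor P) em f))),
      opid = (\<lambda>p. em (opid P (inv_into (ob P) eo p))),
      opcomp = (\<lambda>f gs. em (opcomp P (inv_into (mor P) em f) (map (inv_into (mor P) em) gs)))\<rparr>"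

definition encode_act :: "('m \<Rightarrow> 'm2) \<Rightarrow> ('o, 'm, 'z) operad_scheme \<Rightarrow>
    ((nat \<Rightarrow> nat) \<Rightarrow> 'm \<Rightarrow> 'm) \<Rightarrow> (nat \<Rightarrow> nat) \<Rightarrow> 'm2 \<Rightarrow> 'm2" where
  "encode_act em P a \<sigma> f = em (a \<sigma> (inv_into (mor P) em f))"

context
  fixes G P a eo em
  assumes gop: "perm_operad G P a" and eo: "inj_on eo (ob P)" and em: "inj_on em (mor P)"
begin

interpretation perm_operad G P a by (rule gop)

lemma encode_simps [simp]:
  "ob (encode eo em P) = eo ` ob P" "mor (encode eo em P) = em ` mor P"
  "f \<in> mor P \<Longrightarrow> ins (encode eo em P) (em f) = map eo (ins P f)"
  "f \<in> mor P \<Longrightarrow> out (encode eo em P) (em f) = eo (out P f)"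
  "p \<in> ob P \<Longrightarrow> opid (encode eo em P) (eo p) = em (opid P p)"
  "f \<in> mor P \<Longrightarrow> arity (encode eo em P) (em f) = arity P f"
  "f \<in> mor P \<Longrightarrow> encode_act em P a \<sigma> (em f) = em (a \<sigma> f)"
  using eo em by (auto simp: encode_def encode_act_def arity_def)

lemma encode_opcomp [simp]:
  assumes "f \<in> mor P" "set gs \<subseteq> mor P"
  shows "opcomp (encode eo em P) (em f) (map em gs) = em (opcomp P f gs)"
proof -
  have "map (inv_into (mor P) em \<circ> em) gs = gs"
    using assms em by (intro map_idI) auto
  then show ?thesis using assms em by (simp add: encode_def)
qed

lemma composable_encode:
  assumes "f \<in> mor P" "set gs \<subseteq> mor P"
  shows "composable (encode eo em P) (em f) (map em gs) \<longleftrightarrow> composable P f gs"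
proof -
  have e: "map (out (encode eo em P)) (map em gs) = map eo (map (out P) gs)"
    using assms by auto
  have s: "set (map (out P) gs) \<union> set (ins P f) \<subseteq> ob P"
    using assms ins_ob[of f] out_ob by auto
  show ?thesis
    unfolding composable_def e using assms inj_on_map_eq_map[OF inj_on_subset[OF eo s]]
    by auto
qed

lemma composable_encodeE:
  assumes "composable (encode eo em P) f' gs'"
  obtains f gs where "f' = em f" "gs' = map em gs" "composable P f gs"
proof -
  obtain f where f: "f' = em f" "f \<in> mor P" using assms by (auto simp: composable_def)
  have "gs' \<in> lists (em ` mor P)" using assms by (auto simp: composable_def)
  then obtain gs where gs: "gs' = map em gs" "set gs \<subseteq> mor P"
    by (metis in_lists_conv_set lists_image image_iff subsetI)
  show ?thesis using that[OF f(1) gs(1)] composable_encode[OF f(2) gs(2)] assms f gs by simp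
qed

lemma perm_operad_encode: "perm_operad G (encode eo em P) (encode_act em P a)"
proof
  let ?E = "encode eo em P"
  show "set (ins ?E f) \<subseteq> ob ?E" if "f \<in> mor ?E" for f using that ins_ob by fastforce
  show "out ?E f \<in> ob ?E" if "f \<in> mor ?E" for f using that out_ob by fastforce
  show "opid ?E p \<in> ophom ?E [p] p" if "p \<in> ob ?E" for p
    using that by (auto simp: ophom_iff opid_hom')
  show "opcomp ?E f gs \<in> ophom ?E (concat (map (ins ?E) gs)) (out ?E f)" if "composable ?E f gs" for f gs
  proof -
    from that obtain f0 gs0 where [simp]: "f = em f0" "gs = map em gs0" and c: "composable P f0 gs0"
      by (rule composable_encodeE)
    then have m: "f0 \<in> mor P" "set gs0 \<subseteq> mor P" by (auto simp: composable_def)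
    have "map (ins ?E) gs = map (map eo) (map (ins P) gs0)" using m by auto
    then have "concat (map (ins ?E) gs) = map eo (concat (map (ins P) gs0))" by (simp only: map_concat)
    then show ?thesis using m c by (simp add: ophom_iff composable_hom)
  qed
  show "opcomp ?E f (map (opid ?E) (ins ?E f)) = f" if "f \<in> mor ?E" for f
  proof -
    from that obtain f0 where [simp]: "f = em f0" "f0 \<in> mor P" by auto
    have e: "map (opid ?E) (ins ?E f) = map em (map (opid P) (ins P f0))"
      using ins_ob[of f0] by auto
    have "set (map (opid P) (ins P f0)) \<subseteq> mor P" using ins_ob[of f0] opid_hom' by auto
    then show ?thesis unfolding e by (simp add: opcomp_opid del: map_map)
  qed
  show "opcomp ?E (opid ?E (out ?E f)) [f] = f" if "f \<in> mor ?E" for f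
  proof -
    from that obtain f0 where f: "f = em f0" "f0 \<in> mor P" by auto
    then show ?thesis
      using encode_opcomp[of "opid P (out P f0)" "[f0]"] by (simp add: opid_opcomp out_ob opid_hom')
  qed
  show "opcomp ?E (opcomp ?E f gs) (concat hss) = opcomp ?E f (map2 (opcomp ?E) gs hss)"
    if c: "composable ?E f gs" "list_all2 (composable ?E) gs hss" for f gs hss
  proof -
    from c obtain f0 gs0 where [simp]: "f = em f0" "gs = map em gs0" and c0: "composable P f0 gs0"
      by (auto elim: composable_encodeE)
    then have m: "f0 \<in> mor P" "set gs0 \<subseteq> mor P" by (auto simp: composable_def)
    have "\<exists>hs0. hss ! i = map em hs0 \<and> composable P (gs0 ! i) hs0" if "i < length gs0" for i
    proof -
      have "composable ?E (em (gs0 ! i)) (hss ! i)"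
        using c(2) that by (auto simp: list_all2_conv_all_nth)
      then obtain g hs0 where "em (gs0 ! i) = em g" "hss ! i = map em hs0" "composable P g hs0"
        by (auto elim: composable_encodeE)
      moreover from this have "g = gs0 ! i"
        using em m that by (metis composable_def inj_onD nth_mem subsetD)
      ultimately show ?thesis by blast
    qed
    then obtain H where H: "\<And>i. i < length gs0 \<Longrightarrow> hss ! i = map em (H i) \<and> composable P (gs0 ! i) (H i)"
      by metis
    define hss0 where "hss0 = map H [0..<length gs0]"
    have l: "length hss = length gs0" using c(2) by (auto dest: list_all2_lengthD)
    have hss: "hss = map (map em) hss0"
      using H l by (auto simp: hss0_def intro!: nth_equalityI)
    have c1: "list_all2 (composable P) gs0 hss0"
      using H by (auto simp: hss0_def list_all2_conv_all_nth)
    have m1: "set (concat hss0) \<subseteq> mor P"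
      using H by (fastforce simp: hss0_def composable_def)
    have e: "map2 (opcomp ?E) gs hss = map em (map2 (opcomp P) gs0 hss0)"
      using c1 m m1 unfolding hss
      by (auto simp: list_all2_conv_all_nth composable_def intro!: nth_equalityI encode_opcomp)
    have m2: "set (map2 (opcomp P) gs0 hss0) \<subseteq> mor P"
      using c1 by (auto simp: in_set_zip list_all2_conv_all_nth composable_hom)
    have "opcomp ?E (opcomp ?E f gs) (concat hss) = em (opcomp P (opcomp P f0 gs0) (concat hss0))"
      using m m1 c0 by (simp add: hss composable_hom flip: map_concat)
    also have "\<dots> = opcomp ?E f (map2 (opcomp ?E) gs hss)"
      unfolding opcomp_assoc[OF c0 c1] e using m m2 by (simp del: map_map)
    finally show ?thesis .
  qed
  show "\<sigma> permutes {..<n}" if "\<sigma> \<in> G n" for \<sigma> n using that by (rule G_permutes)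
  show "encode_act em P a \<sigma> f \<in> ophom ?E (permute_list \<sigma> (ins ?E f)) (out ?E f)"
    if "f \<in> mor ?E" "\<sigma> \<in> G (arity ?E f)" for f \<sigma>
  proof -
    from that obtain f0 where [simp]: "f = em f0" and m: "f0 \<in> mor P" and s: "\<sigma> \<in> G (arity P f0)" by auto
    then show ?thesis using G_permutes[OF s]
      by (simp add: ophom_iff pact_hom' permute_list_map arity_def)
  qed
  show "encode_act em P a id f = f" if "f \<in> mor ?E" for f
    using that by (auto simp: pact_id)
  show "encode_act em P a (\<sigma> \<circ> \<tau>) f = encode_act em P a \<tau> (encode_act em P a \<sigma> f)"
    if "f \<in> mor ?E" "\<sigma> \<in> G (arity ?E f)" "\<tau> \<in> G (arity ?E f)" for f \<sigma> \<tau>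
    using that by (auto simp: pact_comp pact_hom')
  show "opcomp ?E (encode_act em P a \<sigma> f) (permute_list \<sigma> gs) =
      encode_act em P a (block_perm \<sigma> (map (arity ?E) gs)) (opcomp ?E f gs)"
    if "composable ?E f gs" "\<sigma> \<in> G (arity ?E f)" for f gs \<sigma>
  proof -
    from that obtain f0 gs0 where [simp]: "f = em f0" "gs = map em gs0" and c: "composable P f0 gs0"
      by (auto elim: composable_encodeE)
    then have m: "f0 \<in> mor P" "set gs0 \<subseteq> mor P" by (auto simp: composable_def)
    have s: "\<sigma> \<in> G (arity P f0)" using that m by simp
    have "length gs0 = arity P f0" using c by (metis arity_def composable_def length_map)
    then have p: "\<sigma> permutes {..<length gs0}" using G_permutes[OF s] by simp
    have ar: "map (arity ?E) gs = map (arity P) gs0" using m by auto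
    have "opcomp ?E (encode_act em P a \<sigma> f) (permute_list \<sigma> gs) =
        em (opcomp P (a \<sigma> f0) (permute_list \<sigma> gs0))"
      using m s p by (simp add: permute_list_map pact_hom')
    then show ?thesis
      unfolding ar using m c s by (simp add: composable_hom pequivariance_outer)
  qed
  show "opcomp ?E f (map2 (encode_act em P a) \<sigma>s gs) =
      encode_act em P a (sum_perm \<sigma>s (map (arity ?E) gs)) (opcomp ?E f gs)"
    if "composable ?E f gs" "list_all2 (\<lambda>\<sigma> g. \<sigma> \<in> G (arity ?E g)) \<sigma>s gs" for f gs \<sigma>s
  proof -
    from that obtain f0 gs0 where [simp]: "f = em f0" "gs = map em gs0" and c: "composable P f0 gs0"
      by (auto elim: composable_encodeE)
    then have m: "f0 \<in> mor P" "set gs0 \<subseteq> mor P" by (auto simp: composable_def)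
    have n: "gs0 ! i \<in> mor P" if "i < length gs0" for i using m that by auto
    have s: "list_all2 (\<lambda>\<sigma> g. \<sigma> \<in> G (arity P g)) \<sigma>s gs0"
      using that n by (auto simp: list_all2_conv_all_nth)
    have e: "map2 (encode_act em P a) \<sigma>s gs = map em (map2 a \<sigma>s gs0)"
      using n s by (auto simp: list_all2_conv_all_nth intro!: nth_equalityI)
    have m2: "set (map2 a \<sigma>s gs0) \<subseteq> mor P"
      using n s by (auto simp: in_set_zip list_all2_conv_all_nth pact_hom')
    have ar: "map (arity ?E) gs = map (arity P) gs0" using m by auto
    have "opcomp ?E f (map em (map2 a \<sigma>s gs0)) = em (opcomp P f0 (map2 a \<sigma>s gs0))"
      using m m2 by (simp del: map_map)
    then show ?thesis
      unfolding e ar using m c s by (simp add: composable_hom pequivariance_inner)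
  qed
qed

lemma perm_functor_encode: "perm_functor G P a (encode eo em P) (encode_act em P a) eo em"
  by (rule perm_functorI) (auto simp: ophom_iff composable_def)

lemma perm_functor_decode:
  "perm_functor G (encode eo em P) (encode_act em P a) P a (inv_into (ob P) eo) (inv_into (mor P) em)"
proof (rule perm_functorI)
  let ?E = "encode eo em P"
  have i: "inv_into (ob P) eo (eo p) = p" if "p \<in> ob P" for p using that eo by simp
  show "inv_into (mor P) em f \<in> ophom P (map (inv_into (ob P) eo) (ins ?E f)) (inv_into (ob P) eo (out ?E f))"
    if "f \<in> mor ?E" for f
  proof -
    from that obtain f0 where [simp]: "f = em f0" "f0 \<in> mor P" by auto
    have "map (inv_into (ob P) eo \<circ> eo) (ins P f0) = ins P f0"
      using ins_ob[of f0] i by (intro map_idI) auto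
    then show ?thesis using em by (simp add: ophom_iff i out_ob)
  qed
  show "inv_into (mor P) em (opcomp ?E f gs) =
      opcomp P (inv_into (mor P) em f) (map (inv_into (mor P) em) gs)" if "composable ?E f gs" for f gs
  proof -
    from that obtain f0 gs0 where [simp]: "f = em f0" "gs = map em gs0" and c: "composable P f0 gs0"
      by (auto elim: composable_encodeE)
    then have m: "f0 \<in> mor P" "set gs0 \<subseteq> mor P" by (auto simp: composable_def)
    have "map (inv_into (mor P) em \<circ> em) gs0 = gs0" using m em by (intro map_idI) auto
    then show ?thesis using m c em by (simp add: composable_hom)
  qed
qed (use eo em in \<open>auto simp: opid_hom' pact_hom'\<close>)

end


section \<open>Joint pullbacks of operads along object maps\<close>

text \<open>
  A morphism carries its inputs and its output besides the family of components. They cannot be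
  read off the components: the index set may be empty (the terminal operad has one morphism of each
  arity), and the maps \<open>x \<mapsto> ev x i\<close> need not separate the elements of \<open>X\<close>.
\<close>

definition joint_pullback :: "'x set \<Rightarrow> ('x \<Rightarrow> 'i \<Rightarrow> 'o) \<Rightarrow> 'i set \<Rightarrow> ('i \<Rightarrow> ('o, 'm, 'z) operad_scheme) \<Rightarrow>
    ('x, 'x list \<times> 'x \<times> ('i \<Rightarrow> 'm)) operad" where
  "joint_pullback X ev I D =
     \<lparr>ob = X,
      mor = {(xs, x, \<phi>). set xs \<subseteq> X \<and> x \<in> X \<and>
        \<phi> \<in> (\<Pi>\<^sub>E i\<in>I. ophom (D i) (map (\<lambda>y. ev y i) xs) (ev x i))},
      ins = fst, out = (\<lambda>f. fst (snd f)),
      opid = (\<lambda>x. ([x], x, \<lambda>i\<in>I. opid (D i) (ev x i))),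
      opcomp = (\<lambda>f gs. (concat (map fst gs), fst (snd f),
        \<lambda>i\<in>I. opcomp (D i) (snd (snd f) i) (map (\<lambda>g. snd (snd g) i) gs)))\<rparr>"

definition joint_act :: "'i set \<Rightarrow> ('i \<Rightarrow> (nat \<Rightarrow> nat) \<Rightarrow> 'm \<Rightarrow> 'm) \<Rightarrow> (nat \<Rightarrow> nat) \<Rightarrow>
    'x list \<times> 'x \<times> ('i \<Rightarrow> 'm) \<Rightarrow> 'x list \<times> 'x \<times> ('i \<Rightarrow> 'm)" where
  "joint_act I a \<sigma> f = (permute_list \<sigma> (fst f), fst (snd f), \<lambda>i\<in>I. a i \<sigma> (snd (snd f) i))"

lemma joint_mor_iff:
  "f \<in> mor (joint_pullback X ev I D) \<longleftrightarrow> set (fst f) \<subseteq> X \<and> fst (snd f) \<in> X \<and>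
    snd (snd f) \<in> extensional I \<and>
    (\<forall>i\<in>I. snd (snd f) i \<in> mor (D i) \<and> ins (D i) (snd (snd f) i) = map (\<lambda>y. ev y i) (fst f) \<and>
      out (D i) (snd (snd f) i) = ev (fst (snd f)) i)"
  by (auto simp: joint_pullback_def PiE_iff ophom_iff split: prod.splits)

lemma joint_simps [simp]:
  "ob (joint_pullback X ev I D) = X" "ins (joint_pullback X ev I D) = fst"
  "out (joint_pullback X ev I D) = (\<lambda>f. fst (snd f))"
  "arity (joint_pullback X ev I D) = (\<lambda>f. length (fst f))"
  by (simp_all add: joint_pullback_def arity_def[abs_def])

lemma joint_comp [simp]:
  "fst (opcomp (joint_pullback X ev I D) f gs) = concat (map fst gs)"
  "fst (snd (opcomp (joint_pullback X ev I D) f gs)) = fst (snd f)"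
  "snd (snd (opcomp (joint_pullback X ev I D) f gs)) \<in> extensional I"
  "i \<in> I \<Longrightarrow> snd (snd (opcomp (joint_pullback X ev I D) f gs)) i =
     opcomp (D i) (snd (snd f) i) (map (\<lambda>g. snd (snd g) i) gs)"
  by (simp_all add: joint_pullback_def)

lemma joint_opid [simp]:
  "fst (opid (joint_pullback X ev I D) x) = [x]"
  "fst (snd (opid (joint_pullback X ev I D) x)) = x"
  "snd (snd (opid (joint_pullback X ev I D) x)) \<in> extensional I"
  "i \<in> I \<Longrightarrow> snd (snd (opid (joint_pullback X ev I D) x)) i = opid (D i) (ev x i)"
  by (simp_all add: joint_pullback_def)

lemma joint_act [simp]:
  "fst (joint_act I a \<sigma> f) = permute_list \<sigma> (fst f)"
  "fst (snd (joint_act I a \<sigma> f)) = fst (snd f)"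
  "snd (snd (joint_act I a \<sigma> f)) \<in> extensional I"
  "i \<in> I \<Longrightarrow> snd (snd (joint_act I a \<sigma> f)) i = a i \<sigma> (snd (snd f) i)"
  by (simp_all add: joint_act_def)

lemma triple_eqI:
  assumes "fst f = fst g" "fst (snd f) = fst (snd g)" "snd (snd f) \<in> extensional I"
    "snd (snd g) \<in> extensional I" "\<And>i. i \<in> I \<Longrightarrow> snd (snd f) i = snd (snd g) i"
  shows "f = g"
  using assms by (auto simp: prod_eq_iff intro: extensionalityI)

context
  fixes G X ev I D a
  assumes comps: "\<And>i. i \<in> I \<Longrightarrow> perm_operad G (D i) (a i)"
    and G_perm: "\<And>\<sigma> n. \<sigma> \<in> G n \<Longrightarrow> \<sigma> permutes {..<n}"
    and ev_ob: "\<And>i x. i \<in> I \<Longrightarrow> x \<in> X \<Longrightarrow> ev x i \<in> ob (D i)"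
begin

lemma joint_composable_component:
  assumes "composable (joint_pullback X ev I D) f gs" "i \<in> I"
  shows "composable (D i) (snd (snd f) i) (map (\<lambda>g. snd (snd g) i) gs)"
proof -
  have f: "f \<in> mor (joint_pullback X ev I D)" and gs: "\<And>g. g \<in> set gs \<Longrightarrow> g \<in> mor (joint_pullback X ev I D)"
    and e: "map (\<lambda>g. fst (snd g)) gs = fst f"
    using assms by (auto simp: composable_def)
  have "map (out (D i)) (map (\<lambda>g. snd (snd g) i) gs) = map (\<lambda>y. ev y i) (map (\<lambda>g. fst (snd g)) gs)"
    using gs assms(2) by (auto simp: joint_mor_iff)
  then show ?thesis
    using f gs assms(2) unfolding e by (auto simp: composable_def joint_mor_iff)
qed

lemma arity_component:
  assumes "f \<in> mor (joint_pullback X ev I D)" "i \<in> I"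
  shows "arity (D i) (snd (snd f) i) = length (fst f)"
  using assms by (auto simp: joint_mor_iff arity_def)

lemma perm_operad_joint: "perm_operad G (joint_pullback X ev I D) (joint_act I a)"
proof
  let ?J = "joint_pullback X ev I D"
  have ext: "snd (snd f) \<in> extensional I" if "f \<in> mor ?J" for f using that by (simp add: joint_mor_iff)
  show "set (ins ?J f) \<subseteq> ob ?J" if "f \<in> mor ?J" for f using that by (simp add: joint_mor_iff)
  show "out ?J f \<in> ob ?J" if "f \<in> mor ?J" for f using that by (simp add: joint_mor_iff)
  show "opid ?J x \<in> ophom ?J [x] x" if "x \<in> ob ?J" for x
  proof -
    have "opid (D i) (ev x i) \<in> ophom (D i) [ev x i] (ev x i)" if "i \<in> I" for i
      using comps[OF that] ev_ob[OF that] \<open>x \<in> ob ?J\<close>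
      by (simp add: perm_operad_def operad.opid_hom)
    then show ?thesis using that by (simp add: joint_mor_iff ophom_iff)
  qed
  show "opcomp ?J f gs \<in> ophom ?J (concat (map (ins ?J) gs)) (out ?J f)" if c: "composable ?J f gs" for f gs
  proof -
    have m: "f \<in> mor ?J" "\<And>g. g \<in> set gs \<Longrightarrow> g \<in> mor ?J" using c by (auto simp: composable_def)
    have i: "map (ins (D i)) (map (\<lambda>g. snd (snd g) i) gs) = map (map (\<lambda>y. ev y i)) (map fst gs)"
      if "i \<in> I" for i
      using m that by (auto simp: joint_mor_iff)
    have "opcomp (D i) (snd (snd f) i) (map (\<lambda>g. snd (snd g) i) gs) \<in>
       ophom (D i) (map (\<lambda>y. ev y i) (concat (map fst gs))) (ev (fst (snd f)) i)" if "i \<in> I" for i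
      using operad.opcomp_hom[OF _ joint_composable_component[OF c that]] comps[OF that] i[OF that] m that
      by (simp add: perm_operad_def map_concat joint_mor_iff del: map_map)
    moreover have "set (concat (map fst gs)) \<subseteq> X"
    proof
      fix x assume "x \<in> set (concat (map fst gs))"
      then obtain g where "g \<in> set gs" "x \<in> set (fst g)" by auto
      then show "x \<in> X" using m(2)[of g] by (auto simp: joint_mor_iff)
    qed
    ultimately show ?thesis
      using m(1) by (simp add: joint_mor_iff ophom_iff)
  qed
  show "opcomp ?J f (map (opid ?J) (ins ?J f)) = f" if m: "f \<in> mor ?J" for f
  proof (rule triple_eqI[where I = I])
    show "fst (opcomp ?J f (map (opid ?J) (ins ?J f))) = fst f"
      by (simp add: comp_def)
    fix i assume i: "i \<in> I"
    have "map (\<lambda>g. snd (snd g) i) (map (opid ?J) (fst f)) = map (opid (D i)) (ins (D i) (snd (snd f) i))"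
      using i m by (simp add: joint_mor_iff comp_def)
    then show "snd (snd (opcomp ?J f (map (opid ?J) (ins ?J f)))) i = snd (snd f) i"
      using operad.opcomp_opid[of "D i" "snd (snd f) i"] i m comps[OF i]
      by (simp add: joint_mor_iff perm_operad_def del: map_map)
  qed (use ext m in auto)
  show "opcomp ?J (opid ?J (out ?J f)) [f] = f" if m: "f \<in> mor ?J" for f
  proof (rule triple_eqI[where I = I])
    fix i assume i: "i \<in> I"
    show "snd (snd (opcomp ?J (opid ?J (out ?J f)) [f])) i = snd (snd f) i"
      using operad.opid_opcomp[of "D i" "snd (snd f) i"] i m comps[OF i]
      by (simp add: joint_mor_iff perm_operad_def)
  qed (use ext m in auto)
  show "opcomp ?J (opcomp ?J f gs) (concat hss) = opcomp ?J f (map2 (opcomp ?J) gs hss)"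
    if c: "composable ?J f gs" and cs: "list_all2 (composable ?J) gs hss" for f gs hss
  proof (rule triple_eqI[where I = I])
    have l: "length gs = length hss" using cs by (rule list_all2_lengthD)
    have "map fst (map2 (opcomp ?J) gs hss) = map (\<lambda>hs. concat (map fst hs)) hss"
      using l by (auto intro!: nth_equalityI)
    moreover have "concat (map fst (concat hss)) = concat (map (\<lambda>hs. concat (map fst hs)) hss)"
      by (induction hss) auto
    ultimately show "fst (opcomp ?J (opcomp ?J f gs) (concat hss)) = fst (opcomp ?J f (map2 (opcomp ?J) gs hss))"
      by simp
    fix i assume i: "i \<in> I"
    let ?c = "\<lambda>g. snd (snd g) i"
    have "list_all2 (composable (D i)) (map ?c gs) (map (map ?c) hss)"
      using cs joint_composable_component[OF _ i] by (auto simp: list_all2_conv_all_nth)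
    from operad.opcomp_assoc[OF _ joint_composable_component[OF c i] this] comps[OF i]
    have "opcomp (D i) (opcomp (D i) (?c f) (map ?c gs)) (concat (map (map ?c) hss)) =
        opcomp (D i) (?c f) (map2 (opcomp (D i)) (map ?c gs) (map (map ?c) hss))"
      by (simp add: perm_operad_def)
    moreover have "map2 (opcomp (D i)) (map ?c gs) (map (map ?c) hss) = map ?c (map2 (opcomp ?J) gs hss)"
      using l i by (auto intro!: nth_equalityI)
    ultimately show "?c (opcomp ?J (opcomp ?J f gs) (concat hss)) = ?c (opcomp ?J f (map2 (opcomp ?J) gs hss))"
      using i by (simp add: map_concat del: map_map)
  qed auto
  show "\<sigma> permutes {..<n}" if "\<sigma> \<in> G n" for \<sigma> n using that by (rule G_perm)
  show "joint_act I a \<sigma> f \<in> ophom ?J (permute_list \<sigma> (ins ?J f)) (out ?J f)"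
    if m: "f \<in> mor ?J" and s: "\<sigma> \<in> G (arity ?J f)" for f \<sigma>
  proof -
    have p: "\<sigma> permutes {..<length (fst f)}" using G_perm[OF s] by simp
    have "a i \<sigma> (snd (snd f) i) \<in> ophom (D i) (map (\<lambda>y. ev y i) (permute_list \<sigma> (fst f))) (ev (fst (snd f)) i)"
      if i: "i \<in> I" for i
      using perm_operad.pact_hom[OF comps[OF i], of "snd (snd f) i" \<sigma>] m s i p arity_component[OF m i]
      by (auto simp: joint_mor_iff permute_list_map)
    then show ?thesis using m p by (auto simp: joint_mor_iff ophom_iff)
  qed
  show "joint_act I a id f = f" if m: "f \<in> mor ?J" for f
    by (rule triple_eqI[where I = I]) (use m in \<open>auto simp: joint_mor_iff perm_operad.pact_id[OF comps]\<close>)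
  show "joint_act I a (\<sigma> \<circ> \<tau>) f = joint_act I a \<tau> (joint_act I a \<sigma> f)"
    if m: "f \<in> mor ?J" and s: "\<sigma> \<in> G (arity ?J f)" "\<tau> \<in> G (arity ?J f)" for f \<sigma> \<tau>
  proof (rule triple_eqI[where I = I])
    show "fst (joint_act I a (\<sigma> \<circ> \<tau>) f) = fst (joint_act I a \<tau> (joint_act I a \<sigma> f))"
      using G_perm[OF s(2)] by (simp add: permute_list_compose)
    fix i assume i: "i \<in> I"
    then show "snd (snd (joint_act I a (\<sigma> \<circ> \<tau>) f)) i = snd (snd (joint_act I a \<tau> (joint_act I a \<sigma> f))) i"
      using perm_operad.pact_comp[OF comps[OF i]] s m arity_component[OF m i]
      by (simp add: joint_mor_iff)
  qed auto
  show "opcomp ?J (joint_act I a \<sigma> f) (permute_list \<sigma> gs) =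
      joint_act I a (block_perm \<sigma> (map (arity ?J) gs)) (opcomp ?J f gs)"
    if c: "composable ?J f gs" and s: "\<sigma> \<in> G (arity ?J f)" for f gs \<sigma>
  proof (rule triple_eqI[where I = I])
    have m: "f \<in> mor ?J" "\<And>g. g \<in> set gs \<Longrightarrow> g \<in> mor ?J" using c by (auto simp: composable_def)
    have "length gs = length (fst f)" using c by (metis composable_def joint_simps(2) length_map)
    then have p: "\<sigma> permutes {..<length gs}" using G_perm[OF s] by simp
    have ar: "map (arity ?J) gs = map length (map fst gs)" by simp
    show "fst (opcomp ?J (joint_act I a \<sigma> f) (permute_list \<sigma> gs)) =
        fst (joint_act I a (block_perm \<sigma> (map (arity ?J) gs)) (opcomp ?J f gs))"
      unfolding ar using p by (simp add: permute_list_block_perm permute_list_map[symmetric] del: map_map)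
    fix i assume i: "i \<in> I"
    have "map (arity (D i)) (map (\<lambda>g. snd (snd g) i) gs) = map (arity ?J) gs"
      using arity_component[OF m(2) i] by auto
    then show "snd (snd (opcomp ?J (joint_act I a \<sigma> f) (permute_list \<sigma> gs))) i =
        snd (snd (joint_act I a (block_perm \<sigma> (map (arity ?J) gs)) (opcomp ?J f gs))) i"
      using perm_operad.pequivariance_outer[OF comps[OF i] joint_composable_component[OF c i], of \<sigma>]
        s arity_component[OF m(1) i] i p
      by (simp add: permute_list_map[symmetric] del: map_map)
  qed auto
  show "opcomp ?J f (map2 (joint_act I a) \<sigma>s gs) =
      joint_act I a (sum_perm \<sigma>s (map (arity ?J) gs)) (opcomp ?J f gs)"
    if c: "composable ?J f gs" and s: "list_all2 (\<lambda>\<sigma> g. \<sigma> \<in> G (arity ?J g)) \<sigma>s gs" for f gs \<sigma>s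
  proof (rule triple_eqI[where I = I])
    have m: "f \<in> mor ?J" "\<And>g. g \<in> set gs \<Longrightarrow> g \<in> mor ?J" using c by (auto simp: composable_def)
    have l: "length \<sigma>s = length gs" using s by (rule list_all2_lengthD)
    have ar: "map (arity ?J) gs = map length (map fst gs)" by simp
    have "list_all2 (\<lambda>\<sigma> xs. \<sigma> permutes {..<length xs}) \<sigma>s (map fst gs)"
      using s G_perm by (auto simp: list_all2_conv_all_nth)
    then have "permute_list (sum_perm \<sigma>s (map (arity ?J) gs)) (concat (map fst gs)) =
        concat (map2 permute_list \<sigma>s (map fst gs))"
      unfolding ar by (rule permute_list_sum_perm)
    moreover have "map fst (map2 (joint_act I a) \<sigma>s gs) = map2 permute_list \<sigma>s (map fst gs)"
      using l by (auto intro!: nth_equalityI)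
    ultimately show "fst (opcomp ?J f (map2 (joint_act I a) \<sigma>s gs)) =
        fst (joint_act I a (sum_perm \<sigma>s (map (arity ?J) gs)) (opcomp ?J f gs))"
      by simp
    fix i assume i: "i \<in> I"
    let ?c = "\<lambda>g. snd (snd g) i"
    have 1: "map (arity (D i)) (map ?c gs) = map (arity ?J) gs"
      using arity_component[OF m(2) i] by auto
    have 2: "list_all2 (\<lambda>\<sigma> g. \<sigma> \<in> G (arity (D i) g)) \<sigma>s (map ?c gs)"
      using s arity_component[OF m(2) i] by (auto simp: list_all2_conv_all_nth)
    have 3: "map ?c (map2 (joint_act I a) \<sigma>s gs) = map2 (a i) \<sigma>s (map ?c gs)"
      using l i by (auto intro!: nth_equalityI)
    show "?c (opcomp ?J f (map2 (joint_act I a) \<sigma>s gs)) =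
        ?c (joint_act I a (sum_perm \<sigma>s (map (arity ?J) gs)) (opcomp ?J f gs))"
      using perm_operad.pequivariance_inner[OF comps[OF i] joint_composable_component[OF c i] 2] i
      by (simp add: 1 3 del: map_map)
  qed auto
qed

lemma joint_projection:
  assumes "i \<in> I" "M \<subseteq> mor (joint_pullback X ev I D)"
  shows "perm_functor G ((joint_pullback X ev I D)\<lparr>mor := M\<rparr>) (joint_act I a) (D i) (a i)
    (\<lambda>x. ev x i) (\<lambda>f. snd (snd f) i)"
  by (rule perm_functorI) (use assms ev_ob in \<open>auto simp: joint_mor_iff ophom_iff\<close>)

text \<open>
  A functor into the joint pullback amounts to a map to \<open>X\<close> on objects together with functors to
  all \<open>D i\<close> lying over it. Allowing a suboperad with morphisms \<open>M\<close> covers limits and colimits.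
\<close>

lemma joint_universal:
  fixes T :: "('t, 'n, 'w) operad_scheme"
  assumes T: "perm_operad G T t"
    and h: "\<And>p. p \<in> ob T \<Longrightarrow> h p \<in> X"
    and F: "\<And>i. i \<in> I \<Longrightarrow> perm_functor G T t (D i) (a i) (\<lambda>p. ev (h p) i) (fm i)"
    and M: "\<And>f. f \<in> mor T \<Longrightarrow> (map h (ins T f), h (out T f), \<lambda>i\<in>I. fm i f) \<in> M"
  shows "perm_functor G T t ((joint_pullback X ev I D)\<lparr>mor := M\<rparr>) (joint_act I a)
    h (\<lambda>f. (map h (ins T f), h (out T f), \<lambda>i\<in>I. fm i f))"
proof -
  interpret perm_operad G T t by fact
  show ?thesis
  proof (rule perm_functorI)
    fix f gs assume c: "composable T f gs"
    show "(map h (ins T (opcomp T f gs)), h (out T (opcomp T f gs)), \<lambda>i\<in>I. fm i (opcomp T f gs)) =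
      opcomp ((joint_pullback X ev I D)\<lparr>mor := M\<rparr>) (map h (ins T f), h (out T f), \<lambda>i\<in>I. fm i f)
        (map (\<lambda>f. (map h (ins T f), h (out T f), \<lambda>i\<in>I. fm i f)) gs)"
      using c by (intro triple_eqI[where I = I]) (auto simp: composable_hom map_concat comp_def pf_opcomp[OF F])
  next
    fix p assume "p \<in> ob T"
    then show "(map h (ins T (opid T p)), h (out T (opid T p)), \<lambda>i\<in>I. fm i (opid T p)) =
      opid ((joint_pullback X ev I D)\<lparr>mor := M\<rparr>) (h p)"
      by (intro triple_eqI[where I = I]) (auto simp: opid_hom' pf_opid[OF F])
  next
    fix f \<sigma> assume f: "f \<in> mor T" "\<sigma> \<in> G (arity T f)"
    then show "(map h (ins T (t \<sigma> f)), h (out T (t \<sigma> f)), \<lambda>i\<in>I. fm i (t \<sigma> f)) =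
      joint_act I a \<sigma> (map h (ins T f), h (out T f), \<lambda>i\<in>I. fm i f)"
      using G_permutes[OF f(2)]
      by (intro triple_eqI[where I = I]) (auto simp: pact_hom' pf_act[OF F] permute_list_map arity_def)
  qed (use h M in \<open>auto simp: ophom_iff\<close>)
qed

end


section \<open>Transport along isomorphisms of objects\<close>

definition mutually_inverse :: "('o, 'm, 'z) operad_scheme \<Rightarrow> 'o \<Rightarrow> 'o \<Rightarrow> 'm \<Rightarrow> 'm \<Rightarrow> bool" where
  "mutually_inverse P p q \<alpha> \<beta> \<longleftrightarrow> \<alpha> \<in> ophom P [p] q \<and> \<beta> \<in> ophom P [q] p \<and>
     opcomp P \<beta> [\<alpha>] = opid P p \<and> opcomp P \<alpha> [\<beta>] = opid P q"

text \<open>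
  The morphism \<open>\<alpha> k \<circ> f \<circ> (\<beta> k\<^sub>1, \<dots>, \<beta> k\<^sub>n)\<close>, used when the \<open>\<alpha> j\<close> are isomorphisms with inverses
  \<open>\<beta> j\<close>. The isomorphisms are indexed by a separate set of labels \<open>k\<close>, since for a functor that
  is not injective on objects they depend on the object upstairs and not only on its image.
\<close>

definition conjugate :: "('o, 'm, 'z) operad_scheme \<Rightarrow> ('k \<Rightarrow> 'm) \<Rightarrow> ('k \<Rightarrow> 'm) \<Rightarrow> 'k list \<Rightarrow> 'k \<Rightarrow> 'm \<Rightarrow> 'm" where
  "conjugate P \<alpha> \<beta> ks k f = opcomp P (opcomp P (\<alpha> k) [f]) (map \<beta> ks)"

lemma (in operad) opcomp_assoc1:
  assumes "f \<in> mor P" "ins P f = [out P g]" "composable P g hs"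
  shows "opcomp P (opcomp P f [g]) hs = opcomp P f [opcomp P g hs]"
  using opcomp_assoc[of f "[g]" "[hs]"] assms by (simp add: composable_def)

lemma (in operad) opcomp_assoc_unary:
  assumes "composable P f (map b ks)"
    and "\<And>k. k \<in> set ks \<Longrightarrow> c k \<in> mor P \<and> ins P (b k) = [out P (c k)]"
  shows "opcomp P (opcomp P f (map b ks)) (map c ks) = opcomp P f (map (\<lambda>k. opcomp P (b k) [c k]) ks)"
proof -
  have 1: "list_all2 (composable P) (map b ks) (map (\<lambda>k. [c k]) ks)"
    using assms by (auto simp: list_all2_conv_all_nth composable_def subset_iff)
  have 2: "concat (map (\<lambda>k. [c k]) ks) = map c ks" by (induction ks) auto
  have 3: "map2 (opcomp P) (map b ks) (map (\<lambda>k. [c k]) ks) = map (\<lambda>k. opcomp P (b k) [c k]) ks"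
    by (auto intro!: nth_equalityI)
  show ?thesis using opcomp_assoc[OF assms(1) 1] unfolding 2 3 .
qed

lemma (in operad) mutually_inverse_unique:
  assumes "mutually_inverse P p q \<alpha> \<beta>" "mutually_inverse P p q \<alpha> \<gamma>"
  shows "\<beta> = \<gamma>"
proof -
  have "\<beta> = opcomp P \<beta> [opcomp P \<alpha> [\<gamma>]]"
    using assms opcomp_opid[of \<beta>] by (auto simp: mutually_inverse_def ophom_iff)
  also have "\<dots> = opcomp P (opcomp P \<beta> [\<alpha>]) [\<gamma>]"
    using assms by (intro opcomp_assoc1[symmetric]) (auto simp: mutually_inverse_def ophom_iff composable_def)
  also have "\<dots> = \<gamma>"
    using assms opid_opcomp[of \<gamma>] by (auto simp: mutually_inverse_def ophom_iff)
  finally show ?thesis .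
qed

lemma mutually_inverse_sym: "mutually_inverse P p q \<alpha> \<beta> \<Longrightarrow> mutually_inverse P q p \<beta> \<alpha>"
  by (auto simp: mutually_inverse_def)

lemma (in operad) mutually_inverse_opid:
  "p \<in> ob P \<Longrightarrow> mutually_inverse P p p (opid P p) (opid P p)"
  using opid_opcomp[of "opid P p"] by (simp add: mutually_inverse_def opid_hom opid_hom')

lemma (in operad) unary_opcomp:
  assumes "\<alpha> \<in> ophom P [p] q" "\<beta> \<in> ophom P [q] r"
  shows "opcomp P \<beta> [\<alpha>] \<in> ophom P [p] r"
  using opcomp_hom[of \<beta> "[\<alpha>]"] assms by (simp add: ophom_iff composable_def)

lemma (in operad) mutually_inverse_trans:
  assumes 1: "mutually_inverse P p q \<alpha> \<beta>" and 2: "mutually_inverse P q r \<gamma> \<delta>"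
  shows "mutually_inverse P p r (opcomp P \<gamma> [\<alpha>]) (opcomp P \<beta> [\<delta>])"
proof -
  have key: "opcomp P (opcomp P \<beta> [\<delta>]) [opcomp P \<gamma> [\<alpha>]] = opid P p"
    if "mutually_inverse P p q \<alpha> \<beta>" "mutually_inverse P q r \<gamma> \<delta>" for \<alpha> \<beta> \<gamma> \<delta> p q r
  proof -
    have m: "\<alpha> \<in> mor P" "\<beta> \<in> mor P" "\<gamma> \<in> mor P" "\<delta> \<in> mor P" "ins P \<alpha> = [p]" "out P \<alpha> = q"
      "ins P \<beta> = [q]" "out P \<beta> = p" "ins P \<gamma> = [q]" "out P \<gamma> = r" "ins P \<delta> = [r]" "out P \<delta> = q"
      "opcomp P \<beta> [\<alpha>] = opid P p" "opcomp P \<delta> [\<gamma>] = opid P q"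
      using that by (auto simp: mutually_inverse_def ophom_iff)
    have "opcomp P (opcomp P \<beta> [\<delta>]) [opcomp P \<gamma> [\<alpha>]] = opcomp P \<beta> [opcomp P \<delta> [opcomp P \<gamma> [\<alpha>]]]"
      using m by (intro opcomp_assoc1) (auto simp: composable_def composable_hom)
    also have "opcomp P \<delta> [opcomp P \<gamma> [\<alpha>]] = opcomp P (opcomp P \<delta> [\<gamma>]) [\<alpha>]"
      using m by (intro opcomp_assoc1[symmetric]) (auto simp: composable_def)
    also have "\<dots> = \<alpha>" using m opid_opcomp[of \<alpha>] by simp
    finally show ?thesis using m by simp
  qed
  show ?thesis
    using key[OF 1 2] key[OF mutually_inverse_sym[OF 2] mutually_inverse_sym[OF 1]] 1 2
    by (auto simp: mutually_inverse_def intro: unary_opcomp)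
qed

lemma operad_iso_iff:
  assumes "operad P"
  shows "operad_iso P \<alpha> p q \<longleftrightarrow> (\<exists>\<beta>. mutually_inverse P p q \<alpha> \<beta>)"
  by (auto simp: underlying_category_def Hom_def iso_in_def mutually_inverse_def ophom_iff
      arity_def length_Suc_conv)

lemma perm_functor_inverse:
  assumes "perm_functor G P a Q b fo fm" "mutually_inverse P p q \<alpha> \<beta>" "operad P"
  shows "mutually_inverse Q (fo p) (fo q) (fm \<alpha>) (fm \<beta>)"
proof -
  have m: "\<alpha> \<in> mor P" "\<beta> \<in> mor P" "ins P \<alpha> = [p]" "out P \<alpha> = q" "ins P \<beta> = [q]" "out P \<beta> = p"
    "opcomp P \<beta> [\<alpha>] = opid P p" "opcomp P \<alpha> [\<beta>] = opid P q"
    using assms by (auto simp: mutually_inverse_def ophom_iff)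
  have "p \<in> ob P" "q \<in> ob P" using m operad.out_ob[OF assms(3)] by blast+
  then show ?thesis
    using m pf_hom[OF assms(1), of \<alpha>] pf_hom[OF assms(1), of \<beta>] pf_opid[OF assms(1)]
      pf_opcomp[OF assms(1), of \<alpha> "[\<beta>]"] pf_opcomp[OF assms(1), of \<beta> "[\<alpha>]"]
    by (simp add: mutually_inverse_def composable_def)
qed

locale iso_family = perm_operad G Q b
  for G and Q :: "('o, 'm, 'z) operad_scheme" and b +
  fixes K :: "'k set" and s t :: "'k \<Rightarrow> 'o" and \<alpha> \<beta> :: "'k \<Rightarrow> 'm"
  assumes inv: "k \<in> K \<Longrightarrow> mutually_inverse Q (s k) (t k) (\<alpha> k) (\<beta> k)"
begin

lemma family_hom:
  assumes "k \<in> K"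
  shows "\<alpha> k \<in> mor Q" "ins Q (\<alpha> k) = [s k]" "out Q (\<alpha> k) = t k"
    "\<beta> k \<in> mor Q" "ins Q (\<beta> k) = [t k]" "out Q (\<beta> k) = s k"
    "opcomp Q (\<beta> k) [\<alpha> k] = opid Q (s k)" "opcomp Q (\<alpha> k) [\<beta> k] = opid Q (t k)"
    "s k \<in> ob Q" "t k \<in> ob Q"
  using inv[OF assms] out_ob[of "\<alpha> k"] out_ob[of "\<beta> k"]
  by (auto simp: mutually_inverse_def ophom_iff)

lemma half_hom:
  assumes "f \<in> ophom Q (map s ks) (s k)" "k \<in> K"
  shows "opcomp Q (\<alpha> k) [f] \<in> ophom Q (map s ks) (t k)"
  using opcomp_hom[of "\<alpha> k" "[f]"] assms family_hom[OF assms(2)] by (simp add: ophom_iff composable_def)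

lemma composable_half:
  assumes "f \<in> ophom Q (map s ks) (s k)" "k \<in> K" "set ks \<subseteq> K"
  shows "composable Q (opcomp Q (\<alpha> k) [f]) (map \<beta> ks)"
  using half_hom[OF assms(1,2)] assms(3) family_hom by (auto simp: ophom_iff composable_def subset_iff)

lemma composable_inverses:
  assumes "f \<in> ophom Q (map s ks) (s k)" "set ks \<subseteq> K"
  shows "composable Q f (map \<beta> ks)"
  using assms family_hom by (auto simp: ophom_iff composable_def subset_iff)

lemma concat_ins_inverses:
  "set ks \<subseteq> K \<Longrightarrow> concat (map (ins Q) (map \<beta> ks)) = map t ks"
  using family_hom by (induction ks) auto

lemma conjugate_hom:
  assumes "f \<in> ophom Q (map s ks) (s k)" "k \<in> K" "set ks \<subseteq> K"
  shows "conjugate Q \<alpha> \<beta> ks k f \<in> ophom Q (map t ks) (t k)"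
proof -
  show ?thesis
    using concat_ins_inverses[OF assms(3)] opcomp_hom[OF composable_half[OF assms]] half_hom[OF assms(1,2)]
    by (simp add: conjugate_def ophom_iff)
qed

lemma conjugate_alt:
  assumes "f \<in> ophom Q (map s ks) (s k)" "k \<in> K" "set ks \<subseteq> K"
  shows "conjugate Q \<alpha> \<beta> ks k f = opcomp Q (\<alpha> k) [opcomp Q f (map \<beta> ks)]"
  unfolding conjugate_def
  by (rule opcomp_assoc1) (use assms family_hom in \<open>auto simp: ophom_iff composable_def subset_iff\<close>)

lemma conjugate_opid:
  assumes "k \<in> K"
  shows "conjugate Q \<alpha> \<beta> [k] k (opid Q (s k)) = opid Q (t k)"
  using family_hom[OF assms] opcomp_opid[of "\<alpha> k"] by (simp add: conjugate_def)

text \<open>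
  The inverse isomorphisms at the inputs of \<open>f\<close> cancel against the isomorphisms at the outputs of
  the \<open>m g\<close>.
\<close>

lemma conjugate_opcomp:
  assumes f: "f \<in> ophom Q (map s (map ou gs)) (s k)" and k: "k \<in> K"
    and gs: "\<And>g. g \<in> set gs \<Longrightarrow> m g \<in> ophom Q (map s (is g)) (s (ou g)) \<and> set (is g) \<subseteq> K \<and> ou g \<in> K"
  shows "conjugate Q \<alpha> \<beta> (concat (map is gs)) k (opcomp Q f (map m gs)) =
    opcomp Q (conjugate Q \<alpha> \<beta> (map ou gs) k f) (map (\<lambda>g. conjugate Q \<alpha> \<beta> (is g) (ou g) (m g)) gs)"
proof -
  let ?h = "opcomp Q (\<alpha> k) [f]"
  note fh = family_hom
  have cf: "composable Q f (map m gs)" using f gs by (auto simp: composable_def ophom_iff subset_iff)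
  have h: "?h \<in> mor Q" "ins Q ?h = map s (map ou gs)" "out Q ?h = t k"
    using half_hom[OF f k] by (auto simp: ophom_iff)
  have ch: "composable Q ?h (map m gs)" using h gs by (auto simp: composable_def ophom_iff subset_iff)
  have K: "set (map ou gs) \<subseteq> K" using gs by auto
  have g1: "opcomp Q (m g) (map \<beta> (is g)) \<in> ophom Q (map t (is g)) (s (ou g))" if "g \<in> set gs" for g
  proof -
    show ?thesis
      using concat_ins_inverses[of "is g"] opcomp_hom[OF composable_inverses[of "m g" "is g" "ou g"]] gs[OF that] by (simp add: ophom_iff)
  qed
  have g2: "opcomp Q (\<beta> (ou g)) [conjugate Q \<alpha> \<beta> (is g) (ou g) (m g)] = opcomp Q (m g) (map \<beta> (is g))"
    if g: "g \<in> set gs" for g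
  proof -
    have "conjugate Q \<alpha> \<beta> (is g) (ou g) (m g) = opcomp Q (\<alpha> (ou g)) [opcomp Q (m g) (map \<beta> (is g))]"
      using gs[OF g] by (intro conjugate_alt) auto
    also have "opcomp Q (\<beta> (ou g)) [\<dots>] =
        opcomp Q (opcomp Q (\<beta> (ou g)) [\<alpha> (ou g)]) [opcomp Q (m g) (map \<beta> (is g))]"
      using g1[OF g] gs[OF g] fh[of "ou g"]
      by (intro opcomp_assoc1[symmetric]) (auto simp: composable_def ophom_iff)
    also have "\<dots> = opcomp Q (m g) (map \<beta> (is g))"
      using opid_opcomp[of "opcomp Q (m g) (map \<beta> (is g))"] g1[OF g] gs[OF g] fh[of "ou g"]
      by (simp add: ophom_iff)
    finally show ?thesis .
  qed
  have "opcomp Q (conjugate Q \<alpha> \<beta> (map ou gs) k f) (map (\<lambda>g. conjugate Q \<alpha> \<beta> (is g) (ou g) (m g)) gs)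
      = opcomp Q (opcomp Q ?h (map (\<lambda>g. \<beta> (ou g)) gs)) (map (\<lambda>g. conjugate Q \<alpha> \<beta> (is g) (ou g) (m g)) gs)"
    by (simp add: conjugate_def comp_def)
  also have "\<dots> = opcomp Q ?h (map (\<lambda>g. opcomp Q (\<beta> (ou g)) [conjugate Q \<alpha> \<beta> (is g) (ou g) (m g)]) gs)"
  proof (rule opcomp_assoc_unary)
    show "composable Q ?h (map (\<lambda>g. \<beta> (ou g)) gs)"
      using composable_half[OF f k K] by (simp add: comp_def)
    show "conjugate Q \<alpha> \<beta> (is g) (ou g) (m g) \<in> mor Q \<and>
        ins Q (\<beta> (ou g)) = [out Q (conjugate Q \<alpha> \<beta> (is g) (ou g) (m g))]" if "g \<in> set gs" for g
      using conjugate_hom[of "m g" "is g" "ou g"] gs[OF that] fh[of "ou g"] by (simp add: ophom_iff)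
  qed
  also have "\<dots> = opcomp Q ?h (map (\<lambda>g. opcomp Q (m g) (map \<beta> (is g))) gs)"
    using g2 by (auto intro!: arg_cong[where f = "opcomp Q ?h"])
  also have "\<dots> = opcomp Q (opcomp Q ?h (map m gs)) (concat (map (\<lambda>g. map \<beta> (is g)) gs))"
  proof -
    have "list_all2 (composable Q) (map m gs) (map (\<lambda>g. map \<beta> (is g)) gs)"
      using gs composable_inverses by (simp add: list_all2_conv_all_nth) (meson nth_mem)
    moreover have "map2 (opcomp Q) (map m gs) (map (\<lambda>g. map \<beta> (is g)) gs) =
        map (\<lambda>g. opcomp Q (m g) (map \<beta> (is g))) gs"
      by (auto intro!: nth_equalityI)
    ultimately show ?thesis using opcomp_assoc[OF ch] by metis
  qed
  also have "opcomp Q ?h (map m gs) = opcomp Q (\<alpha> k) [opcomp Q f (map m gs)]"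
    using cf f fh[OF k] by (intro opcomp_assoc1) (auto simp: ophom_iff)
  finally show ?thesis by (simp add: conjugate_def map_concat comp_def)
qed

text \<open>
  Conjugation composes with unary morphisms only, and the permutations in the two equivariance
  axioms then reduce to \<open>\<sigma>\<close> itself.
\<close>

lemma conjugate_act:
  assumes f: "f \<in> ophom Q (map s ks) (s k)" and k: "k \<in> K" and ks: "set ks \<subseteq> K"
    and \<sigma>: "\<sigma> \<in> G (length ks)"
  shows "conjugate Q \<alpha> \<beta> (permute_list \<sigma> ks) k (b \<sigma> f) = b \<sigma> (conjugate Q \<alpha> \<beta> ks k f)"
proof -
  have p: "\<sigma> permutes {..<length ks}" using \<sigma> by (rule G_permutes)
  have ar: "arity Q f = length ks" using f by (simp add: ophom_iff arity_def)
  have c: "composable Q (\<alpha> k) [f]" using f family_hom[OF k] by (simp add: composable_def ophom_iff)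
  have "opcomp Q (\<alpha> k) [b \<sigma> f] = b (sum_perm [\<sigma>] [arity Q f]) (opcomp Q (\<alpha> k) [f])"
    using pequivariance_inner[OF c, of "[\<sigma>]"] \<sigma> ar by simp
  also have "sum_perm [\<sigma>] [arity Q f] = \<sigma>" using p ar by (simp add: sum_perm_singleton)
  finally have 1: "opcomp Q (\<alpha> k) [b \<sigma> f] = b \<sigma> (opcomp Q (\<alpha> k) [f])" .
  have "map (arity Q) (map \<beta> ks) = replicate (length ks) 1"
    using ks family_hom by (intro nth_equalityI) (auto simp: arity_def subset_iff)
  then have "block_perm \<sigma> (map (arity Q) (map \<beta> ks)) = \<sigma>"
    using block_perm_unary[OF p] by simp
  moreover have "arity Q (opcomp Q (\<alpha> k) [f]) = length ks"
    using half_hom[OF f k] by (simp add: ophom_iff arity_def)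
  ultimately have "opcomp Q (b \<sigma> (opcomp Q (\<alpha> k) [f])) (permute_list \<sigma> (map \<beta> ks)) =
      b \<sigma> (conjugate Q \<alpha> \<beta> ks k f)"
    using pequivariance_outer[OF composable_half[OF f k ks], of \<sigma>] \<sigma> by (simp add: conjugate_def)
  then show ?thesis using p by (simp add: conjugate_def 1 permute_list_map)
qed

lemma conjugate_identities:
  assumes "f \<in> ophom Q (map s ks) (s k)" "k \<in> K" "set ks \<subseteq> K"
    and "\<And>j. j \<in> set ks \<Longrightarrow> \<alpha> j = opid Q (s j)" "\<alpha> k = opid Q (s k)"
  shows "conjugate Q \<alpha> \<beta> ks k f = f"
proof -
  have "\<beta> j = opid Q (s j)" if "j \<in> set ks" for j
  proof -
    have j: "j \<in> K" using that assms by auto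
    have "t j = s j" using family_hom[OF j] assms(4)[OF that] opid_hom'(3)[of "s j"] by simp
    then show ?thesis
      using family_hom[OF j] assms(4)[OF that] opcomp_opid[of "\<beta> j"] opid_opcomp[of "\<beta> j"] by simp
  qed
  then have e: "map \<beta> ks = map (opid Q) (ins Q f)" using assms(1) by (simp add: ophom_iff)
  have "opcomp Q (\<alpha> k) [f] = f" using assms opid_opcomp[of f] by (simp add: ophom_iff)
  then show ?thesis unfolding conjugate_def e using assms(1) opcomp_opid[of f] by (simp add: ophom_iff)
qed

lemma conjugate_conjugate:
  assumes "iso_family G Q b K t u \<gamma> \<delta>"
    and f: "f \<in> ophom Q (map s ks) (s k)" "k \<in> K" "set ks \<subseteq> K"
  shows "conjugate Q \<gamma> \<delta> ks k (conjugate Q \<alpha> \<beta> ks k f) =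
    conjugate Q (\<lambda>k. opcomp Q (\<gamma> k) [\<alpha> k]) (\<lambda>k. opcomp Q (\<beta> k) [\<delta> k]) ks k f"
proof -
  interpret g: iso_family G Q b K t u \<gamma> \<delta> by fact
  let ?h = "opcomp Q (opcomp Q (\<gamma> k) [\<alpha> k]) [f]"
  have h: "?h \<in> ophom Q (map s ks) (u k)"
    using f family_hom[OF f(2)] g.family_hom[OF f(2)]
      composable_hom[of "\<gamma> k" "[\<alpha> k]"] composable_hom[of "opcomp Q (\<gamma> k) [\<alpha> k]" "[f]"]
    by (simp add: ophom_iff composable_def)
  have "opcomp Q (\<gamma> k) [conjugate Q \<alpha> \<beta> ks k f] =
      opcomp Q (opcomp Q (\<gamma> k) [opcomp Q (\<alpha> k) [f]]) (map \<beta> ks)"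
    unfolding conjugate_def using half_hom[OF f(1,2)] composable_half[OF f] g.family_hom[OF f(2)]
    by (intro opcomp_assoc1[symmetric]) (auto simp: ophom_iff)
  also have "opcomp Q (\<gamma> k) [opcomp Q (\<alpha> k) [f]] = ?h"
    using f family_hom[OF f(2)] g.family_hom[OF f(2)]
    by (intro opcomp_assoc1[symmetric]) (auto simp: composable_def ophom_iff)
  finally have "conjugate Q \<gamma> \<delta> ks k (conjugate Q \<alpha> \<beta> ks k f) =
      opcomp Q (opcomp Q ?h (map \<beta> ks)) (map \<delta> ks)" by (simp add: conjugate_def)
  also have "\<dots> = opcomp Q ?h (map (\<lambda>k. opcomp Q (\<beta> k) [\<delta> k]) ks)"
    using h f(3) family_hom g.family_hom
    by (intro opcomp_assoc_unary) (auto simp: composable_def ophom_iff subset_iff)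
  finally show ?thesis by (simp add: conjugate_def)
qed

lemma iso_family_inverse: "iso_family G Q b K t s \<beta> \<alpha>"
  by unfold_locales (rule mutually_inverse_sym[OF inv])

lemma conjugate_inverse:
  assumes f: "f \<in> ophom Q (map s ks) (s k)" "k \<in> K" "set ks \<subseteq> K"
  shows "conjugate Q \<beta> \<alpha> ks k (conjugate Q \<alpha> \<beta> ks k f) = f"
proof -
  interpret i: iso_family G Q b K s s "\<lambda>k. opcomp Q (\<beta> k) [\<alpha> k]" "\<lambda>k. opcomp Q (\<beta> k) [\<alpha> k]"
    by unfold_locales (simp add: family_hom mutually_inverse_opid)
  show ?thesis
    unfolding conjugate_conjugate[OF iso_family_inverse f]
    using f by (intro i.conjugate_identities) (auto simp: family_hom subset_iff)
qed

end

text \<open>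
  Changing the values of a functor on objects along isomorphisms extends to morphisms by
  conjugation. This is the mechanism behind the second factorisation and behind lifts of trivial
  cofibrations.
\<close>

lemma perm_functor_transport:
  assumes P: "perm_operad G P a" and F: "perm_functor G P a Q b fo fm"
    and iso: "iso_family G Q b (ob P) fo go \<alpha> \<beta>"
  shows "perm_functor G P a Q b go (\<lambda>f. conjugate Q \<alpha> \<beta> (ins P f) (out P f) (fm f))"
proof -
  interpret perm_operad G P a by fact
  interpret i: iso_family G Q b "ob P" fo go \<alpha> \<beta> by fact
  show ?thesis
  proof (rule perm_functorI)
    fix f gs assume c: "composable P f gs"
    then have m: "f \<in> mor P" "\<And>g. g \<in> set gs \<Longrightarrow> g \<in> mor P" "map (out P) gs = ins P f"
      by (auto simp: composable_def)
    show "conjugate Q \<alpha> \<beta> (ins P (opcomp P f gs)) (out P (opcomp P f gs)) (fm (opcomp P f gs)) =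
      opcomp Q (conjugate Q \<alpha> \<beta> (ins P f) (out P f) (fm f))
        (map (\<lambda>f. conjugate Q \<alpha> \<beta> (ins P f) (out P f) (fm f)) gs)"
      using i.conjugate_opcomp[of "fm f" "out P" gs "out P f" fm "ins P"] m c pf_hom[OF F] ins_ob out_ob
      by (simp add: composable_hom pf_opcomp[OF F])
  next
    fix f \<sigma> assume "f \<in> mor P" "\<sigma> \<in> G (arity P f)"
    then show "conjugate Q \<alpha> \<beta> (ins P (a \<sigma> f)) (out P (a \<sigma> f)) (fm (a \<sigma> f)) =
      b \<sigma> (conjugate Q \<alpha> \<beta> (ins P f) (out P f) (fm f))"
      using i.conjugate_act[of "fm f" "ins P f" "out P f" \<sigma>] pf_hom[OF F] ins_ob out_ob
      by (simp add: pact_hom' pf_act[OF F] arity_def)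
  qed (use pf_hom[OF F] pf_opid[OF F] ins_ob out_ob in
      \<open>auto intro!: i.conjugate_hom simp: i.family_hom i.conjugate_opid opid_hom'\<close>)
qed

lemma perm_functor_conjugate:
  assumes F: "perm_functor G P a Q b fo fm" and iso: "iso_family G P a K s t \<alpha> \<beta>"
    and f: "f \<in> ophom P (map s ks) (s k)" "k \<in> K" "set ks \<subseteq> K"
  shows "fm (conjugate P \<alpha> \<beta> ks k f) = conjugate Q (\<lambda>k. fm (\<alpha> k)) (\<lambda>k. fm (\<beta> k)) ks k (fm f)"
proof -
  interpret iso_family G P a K s t \<alpha> \<beta> by fact
  have "composable P (\<alpha> k) [f]" using f family_hom[OF f(2)] by (simp add: composable_def ophom_iff)
  then show ?thesis
    using pf_opcomp[OF F composable_half[OF f]] pf_opcomp[OF F, of "\<alpha> k" "[f]"]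
    by (simp add: conjugate_def comp_def)
qed

lemma iso_family_image:
  assumes F: "perm_functor G P a Q b fo fm" and iso: "iso_family G P a K s t \<alpha> \<beta>"
    and Q: "perm_operad G Q b"
  shows "iso_family G Q b K (\<lambda>k. fo (s k)) (\<lambda>k. fo (t k)) (\<lambda>k. fm (\<alpha> k)) (\<lambda>k. fm (\<beta> k))"
proof -
  interpret iso_family G P a K s t \<alpha> \<beta> by fact
  show ?thesis
    using Q perm_functor_inverse[OF F inv operad_axioms]
    by (simp add: iso_family_def iso_family_axioms_def)
qed


section \<open>Fully faithful and essentially surjective functors\<close>

text \<open>
  These three definitions restate the conditions on weak equivalences and fibrations for pairs of
  maps between operads of arbitrary types. Isomorphisms come with an inverse, which
  \<open>operad_iso_iff\<close> relates to the formulation in the underlying category.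
\<close>

definition hom_bijective :: "('o1, 'm1, 'z) operad_scheme \<Rightarrow> ('o2, 'm2, 'w) operad_scheme \<Rightarrow>
    ('o1 \<Rightarrow> 'o2) \<Rightarrow> ('m1 \<Rightarrow> 'm2) \<Rightarrow> bool" where
  "hom_bijective P Q fo fm \<longleftrightarrow> (\<forall>ps p. set ps \<subseteq> ob P \<and> p \<in> ob P \<longrightarrow>
     bij_betw fm (ophom P ps p) (ophom Q (map fo ps) (fo p)))"

definition iso_surjective :: "('o1, 'm1, 'z) operad_scheme \<Rightarrow> ('o2, 'm2, 'w) operad_scheme \<Rightarrow>
    ('o1 \<Rightarrow> 'o2) \<Rightarrow> bool" where
  "iso_surjective P Q fo \<longleftrightarrow> (\<forall>y \<in> ob Q. \<exists>x \<in> ob P. \<exists>\<alpha> \<beta>. mutually_inverse Q (fo x) y \<alpha> \<beta>)"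

definition isofibration :: "('o1, 'm1, 'z) operad_scheme \<Rightarrow> ('o2, 'm2, 'w) operad_scheme \<Rightarrow>
    ('o1 \<Rightarrow> 'o2) \<Rightarrow> ('m1 \<Rightarrow> 'm2) \<Rightarrow> bool" where
  "isofibration P Q fo fm \<longleftrightarrow> (\<forall>p \<in> ob P. \<forall>q \<alpha> \<beta>. mutually_inverse Q (fo p) q \<alpha> \<beta> \<longrightarrow>
     (\<exists>p' \<alpha>' \<beta>'. mutually_inverse P p p' \<alpha>' \<beta>' \<and> fm \<alpha>' = \<alpha>))"

lemma (in operad) mutually_inverse_ob:
  assumes "mutually_inverse P p q \<alpha> \<beta>"
  shows "p \<in> ob P" "q \<in> ob P" "\<alpha> \<in> mor P" "\<beta> \<in> mor P" "ins P \<alpha> = [p]" "out P \<alpha> = q"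
    "ins P \<beta> = [q]" "out P \<beta> = p"
  using assms out_ob[of \<alpha>] out_ob[of \<beta>] by (auto simp: mutually_inverse_def ophom_iff)

lemma hom_bijective_surj:
  assumes "hom_bijective P Q fo fm" "set ps \<subseteq> ob P" "p \<in> ob P" "f \<in> ophom Q (map fo ps) (fo p)"
  obtains g where "g \<in> ophom P ps p" "fm g = f"
proof -
  have "fm ` ophom P ps p = ophom Q (map fo ps) (fo p)"
    using assms(1-3) by (simp add: hom_bijective_def bij_betw_def)
  then show thesis using assms(4) that by (metis imageE)
qed

lemma hom_bijective_inj:
  assumes "hom_bijective P Q fo fm" "operad P" "f \<in> mor P" "g \<in> mor P" "ins P f = ins P g" "out P f = out P g"
    "fm f = fm g"
  shows "f = g"
proof -
  interpret operad P by fact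
  have "inj_on fm (ophom P (ins P f) (out P f))"
    using assms ins_ob[of f] out_ob[of f] by (auto simp: hom_bijective_def bij_betw_def)
  then show ?thesis using assms by (auto simp: ophom_iff dest!: inj_onD)
qed

lemma hom_bijectiveI:
  assumes F: "perm_functor G P a Q b fo fm"
    and "\<And>f g. f \<in> mor P \<Longrightarrow> g \<in> mor P \<Longrightarrow> ins P f = ins P g \<Longrightarrow> out P f = out P g \<Longrightarrow> fm f = fm g \<Longrightarrow> f = g"
    and "\<And>f ps p. set ps \<subseteq> ob P \<Longrightarrow> p \<in> ob P \<Longrightarrow> f \<in> ophom Q (map fo ps) (fo p) \<Longrightarrow>
       \<exists>g \<in> ophom P ps p. fm g = f"
  shows "hom_bijective P Q fo fm"
  unfolding hom_bijective_def bij_betw_def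
proof (intro allI impI conjI)
  fix ps p assume p: "set ps \<subseteq> ob P \<and> p \<in> ob P"
  show "inj_on fm (ophom P ps p)" using assms(2) by (auto simp: inj_on_def ophom_iff)
  show "fm ` ophom P ps p = ophom Q (map fo ps) (fo p)"
    using assms(3) p pf_hom[OF F] by (fastforce simp: ophom_iff image_iff)
qed

lemma hom_bijective_id: "hom_bijective P P (\<lambda>p. p) (\<lambda>f. f)"
  by (simp add: hom_bijective_def bij_betw_def)

lemma hom_bijective_compose:
  assumes "hom_bijective P Q fo fm" "hom_bijective Q R go gm" "perm_functor G P a Q b fo fm"
  shows "hom_bijective P R (go \<circ> fo) (gm \<circ> fm)"
  unfolding hom_bijective_def
proof (intro allI impI)
  fix ps p assume p: "set ps \<subseteq> ob P \<and> p \<in> ob P"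
  then have "set (map fo ps) \<subseteq> ob Q" "fo p \<in> ob Q" using pf_ob[OF assms(3)] by auto
  then show "bij_betw (gm \<circ> fm) (ophom P ps p) (ophom R (map (go \<circ> fo) ps) ((go \<circ> fo) p))"
    using assms(1,2) p unfolding hom_bijective_def by (metis bij_betw_trans comp_apply map_map)
qed

lemma hom_bijective_cancel_left:
  assumes F: "perm_functor G P a Q b fo fm" and P: "operad P"
    and g: "hom_bijective Q R go gm" and Q: "operad Q" and gf: "hom_bijective P R (go \<circ> fo) (gm \<circ> fm)"
  shows "hom_bijective P Q fo fm"
proof (rule hom_bijectiveI[OF F])
  fix f g assume "f \<in> mor P" "g \<in> mor P" "ins P f = ins P g" "out P f = out P g" "fm f = fm g"
  then show "f = g" using hom_bijective_inj[OF gf P] by simp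
next
  fix f ps p assume p: "set ps \<subseteq> ob P" "p \<in> ob P" and f: "f \<in> ophom Q (map fo ps) (fo p)"
  have "gm f \<in> ophom R (map (go \<circ> fo) ps) ((go \<circ> fo) p)"
  proof -
    have "set (map fo ps) \<subseteq> ob Q" "fo p \<in> ob Q" using p pf_ob[OF F] by auto
    then have "bij_betw gm (ophom Q (map fo ps) (fo p)) (ophom R (map go (map fo ps)) (go (fo p)))"
      using g unfolding hom_bijective_def by blast
    then show ?thesis using f by (auto simp: bij_betw_def)
  qed
  then obtain h where h: "h \<in> ophom P ps p" "gm (fm h) = gm f"
    using hom_bijective_surj[OF gf p] by (metis comp_apply)
  moreover have "fm h = f"
    using hom_bijective_inj[OF g Q, of "fm h" f] h f pf_hom[OF F, of h] by (auto simp: ophom_iff)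
  ultimately show "\<exists>g \<in> ophom P ps p. fm g = f" by blast
qed

text \<open>
  Along a fully faithful functor, lifting a functor is the same as lifting its map on objects: each
  morphism has exactly one preimage between the prescribed objects, and faithfulness shows that
  these preimages respect all operations.
\<close>

lemma hom_bijective_lift:
  assumes A: "perm_operad G A a" and B: "perm_operad G B b" and C: "perm_operad G C c"
    and F: "perm_functor G A a B b fo fm" and ff: "hom_bijective A B fo fm"
    and V: "perm_functor G C c B b vo vm"
    and ho: "\<And>p. p \<in> ob C \<Longrightarrow> ho p \<in> ob A" "\<And>p. p \<in> ob C \<Longrightarrow> fo (ho p) = vo p"
  obtains hm where "perm_functor G C c A a ho hm" "\<forall>f\<in>mor C. fm (hm f) = vm f"
proof -
  interpret A: perm_operad G A a by fact
  interpret C: perm_operad G C c by fact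
  have "\<exists>h. h \<in> ophom A (map ho (ins C f)) (ho (out C f)) \<and> fm h = vm f" if f: "f \<in> mor C" for f
  proof -
    have "map fo (map ho (ins C f)) = map vo (ins C f)" using ho C.ins_ob[OF f] by auto
    then have "vm f \<in> ophom B (map fo (map ho (ins C f))) (fo (ho (out C f)))"
      using pf_hom[OF V f] ho(2)[OF C.out_ob[OF f]] by (simp only:)
    moreover have "set (map ho (ins C f)) \<subseteq> ob A" "ho (out C f) \<in> ob A"
      using ho(1) C.ins_ob[OF f] C.out_ob[OF f] by auto
    ultimately show ?thesis using hom_bijective_surj[OF ff] by metis
  qed
  then obtain hm where hm: "\<And>f. f \<in> mor C \<Longrightarrow> hm f \<in> ophom A (map ho (ins C f)) (ho (out C f)) \<and> fm (hm f) = vm f"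
    by metis
  then have hm': "\<And>f. f \<in> mor C \<Longrightarrow> hm f \<in> mor A \<and> ins A (hm f) = map ho (ins C f) \<and> out A (hm f) = ho (out C f)"
    by (simp add: ophom_iff)
  have faithful: "g = h" if "g \<in> ophom A ps p" "h \<in> ophom A ps p" "fm g = fm h" for g h ps p
    using hom_bijective_inj[OF ff A.operad_axioms] that by (auto simp: ophom_iff)
  have "perm_functor G C c A a ho hm"
  proof (rule perm_functorI)
    fix p assume p: "p \<in> ob C"
    show "hm (opid C p) = opid A (ho p)"
    proof (rule faithful)
      show "hm (opid C p) \<in> ophom A [ho p] (ho p)" using hm C.opid_hom'[OF p] by (metis list.map)
      show "opid A (ho p) \<in> ophom A [ho p] (ho p)" using ho p by (simp add: A.opid_hom)
      show "fm (hm (opid C p)) = fm (opid A (ho p))"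
        using hm C.opid_hom'[OF p] ho p by (simp add: pf_opid[OF F] pf_opid[OF V])
    qed
  next
    fix f gs assume c: "composable C f gs"
    then have m: "f \<in> mor C" "\<And>g. g \<in> set gs \<Longrightarrow> g \<in> mor C" "map (out C) gs = ins C f"
      by (auto simp: composable_def)
    have e: "map (out A) (map hm gs) = map ho (map (out C) gs)" using m(2) hm' by auto
    have c': "composable A (hm f) (map hm gs)"
      unfolding composable_def e m(3) using m(1,2) hm' by auto
    have i: "map (ins A) (map hm gs) = map (map ho) (map (ins C) gs)" using m(2) hm' by auto
    show "hm (opcomp C f gs) = opcomp A (hm f) (map hm gs)"
    proof (rule faithful)
      show "hm (opcomp C f gs) \<in> ophom A (map ho (concat (map (ins C) gs))) (ho (out C f))"
        using hm[of "opcomp C f gs"] C.composable_hom[OF c] by simp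
      show "opcomp A (hm f) (map hm gs) \<in> ophom A (map ho (concat (map (ins C) gs))) (ho (out C f))"
        using A.opcomp_hom[OF c'] m(1) hm' unfolding i by (simp add: map_concat)
      have "map fm (map hm gs) = map vm gs" using m(2) hm by auto
      then show "fm (hm (opcomp C f gs)) = fm (opcomp A (hm f) (map hm gs))"
        using hm[of "opcomp C f gs"] hm[of f] m C.composable_hom[OF c]
        by (simp add: pf_opcomp[OF F c'] pf_opcomp[OF V c] del: map_map)
    qed
  next
    fix f \<sigma> assume f: "f \<in> mor C" "\<sigma> \<in> G (arity C f)"
    have ar: "arity A (hm f) = arity C f" using hm'[OF f(1)] by (simp add: arity_def)
    show "hm (c \<sigma> f) = a \<sigma> (hm f)"
    proof (rule faithful)
      show "hm (c \<sigma> f) \<in> ophom A (map ho (permute_list \<sigma> (ins C f))) (ho (out C f))"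
        using hm[of "c \<sigma> f"] C.pact_hom'[OF f] by simp
      show "a \<sigma> (hm f) \<in> ophom A (map ho (permute_list \<sigma> (ins C f))) (ho (out C f))"
        using A.pact_hom[of "hm f" \<sigma>] hm'[OF f(1)] f ar C.G_permutes[OF f(2)]
        by (simp add: permute_list_map arity_def)
      show "fm (hm (c \<sigma> f)) = fm (a \<sigma> (hm f))"
        using hm f C.pact_hom'[OF f] hm'[OF f(1)] ar by (simp add: pf_act[OF F] pf_act[OF V])
    qed
  qed (use ho hm in auto)
  then show thesis using that hm by blast
qed

lemma hom_bijective_reflect_inverse:
  assumes F: "perm_functor G P a Q b fo fm" and P: "operad P" and ff: "hom_bijective P Q fo fm"
    and p: "p \<in> ob P" "q \<in> ob P" and i: "mutually_inverse Q (fo p) (fo q) \<alpha> \<beta>"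
  obtains \<alpha>' \<beta>' where "mutually_inverse P p q \<alpha>' \<beta>'" "fm \<alpha>' = \<alpha>" "fm \<beta>' = \<beta>"
proof -
  interpret operad P by fact
  obtain \<alpha>' where \<alpha>: "\<alpha>' \<in> ophom P [p] q" "fm \<alpha>' = \<alpha>"
    using hom_bijective_surj[OF ff, of "[p]" q \<alpha>] p i by (auto simp: mutually_inverse_def)
  obtain \<beta>' where \<beta>: "\<beta>' \<in> ophom P [q] p" "fm \<beta>' = \<beta>"
    using hom_bijective_surj[OF ff, of "[q]" p \<beta>] p i by (auto simp: mutually_inverse_def)
  have c: "composable P \<alpha>' [\<beta>']" "composable P \<beta>' [\<alpha>']"
    using \<alpha> \<beta> by (auto simp: composable_def ophom_iff)
  have "opcomp P \<beta>' [\<alpha>'] = opid P p"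
    using c p \<alpha> \<beta> i unary_opcomp[OF \<alpha>(1) \<beta>(1)]
    by (intro hom_bijective_inj[OF ff P])
      (auto simp: ophom_iff opid_hom' pf_opcomp[OF F] pf_opid[OF F] mutually_inverse_def)
  moreover have "opcomp P \<alpha>' [\<beta>'] = opid P q"
    using c p \<alpha> \<beta> i unary_opcomp[OF \<beta>(1) \<alpha>(1)]
    by (intro hom_bijective_inj[OF ff P])
      (auto simp: ophom_iff opid_hom' pf_opcomp[OF F] pf_opid[OF F] mutually_inverse_def)
  ultimately show thesis using \<alpha> \<beta> that by (auto simp: mutually_inverse_def)
qed

text \<open>
  Every object of \<open>Q\<close> is isomorphic to one in the image of \<open>fo\<close>. Conjugation identifies a set of
  morphisms of \<open>Q\<close> with one between objects in the image, where the claim follows from \<open>f\<close> and \<open>gf\<close>,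
  and \<open>gm\<close> commutes with conjugation.
\<close>

lemma hom_bijective_cancel_right:
  assumes P: "perm_operad G P a" and Q: "perm_operad G Q b" and R: "perm_operad G R c"
    and F: "perm_functor G P a Q b fo fm" and H: "perm_functor G Q b R c go gm"
    and f: "hom_bijective P Q fo fm" and es: "iso_surjective P Q fo" and gf: "hom_bijective P R (go \<circ> fo) (gm \<circ> fm)"
  shows "hom_bijective Q R go gm"
proof -
  interpret P: perm_operad G P a by fact
  interpret Q: perm_operad G Q b by fact
  \<comment> \<open>Replacement of the objects of \<open>Q\<close> by isomorphic ones in the image of \<open>fo\<close>.\<close>
  obtain x \<alpha> \<beta> where x: "\<And>y. y \<in> ob Q \<Longrightarrow> x y \<in> ob P \<and> mutually_inverse Q (fo (x y)) y (\<alpha> y) (\<beta> y)"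
    using es unfolding iso_surjective_def by metis
  interpret i: iso_family G Q b "ob Q" "\<lambda>y. fo (x y)" "\<lambda>y. y" \<alpha> \<beta>
    by unfold_locales (use x in blast)
  note j_ax = i.iso_family_inverse
  interpret j: iso_family G Q b "ob Q" "\<lambda>y. y" "\<lambda>y. fo (x y)" \<beta> \<alpha> by (rule j_ax)
  note gi_ax = iso_family_image[OF H i.iso_family_axioms R]
  interpret gi: iso_family G R c "ob Q" "\<lambda>y. go (fo (x y))" go "\<lambda>y. gm (\<alpha> y)" "\<lambda>y. gm (\<beta> y)"
    using gi_ax .
  note gj_ax = gi.iso_family_inverse
  interpret gj: iso_family G R c "ob Q" go "\<lambda>y. go (fo (x y))" "\<lambda>y. gm (\<beta> y)" "\<lambda>y. gm (\<alpha> y)"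
    by (rule gj_ax)
  show ?thesis
  proof (rule hom_bijectiveI[OF H])
    fix f1 f2 assume m: "f1 \<in> mor Q" "f2 \<in> mor Q" and io: "ins Q f1 = ins Q f2" "out Q f1 = out Q f2"
      and e: "gm f1 = gm f2"
    let ?ys = "ins Q f2" and ?y = "out Q f2"
    have y: "set ?ys \<subseteq> ob Q" "?y \<in> ob Q" using Q.ins_ob Q.out_ob m by auto
    have xs: "set (map x ?ys) \<subseteq> ob P" "x ?y \<in> ob P" using x y by auto
    have h: "f1 \<in> ophom Q (map (\<lambda>y. y) ?ys) ?y" "f2 \<in> ophom Q (map (\<lambda>y. y) ?ys) ?y"
      using m io by (auto simp: ophom_iff)
    have c: "conjugate Q \<beta> \<alpha> ?ys ?y f1 \<in> ophom Q (map fo (map x ?ys)) (fo (x ?y))"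
      "conjugate Q \<beta> \<alpha> ?ys ?y f2 \<in> ophom Q (map fo (map x ?ys)) (fo (x ?y))"
      using j.conjugate_hom[OF h(1) y(2,1)] j.conjugate_hom[OF h(2) y(2,1)] by (simp_all add: comp_def)
    obtain a1 where a1: "a1 \<in> ophom P (map x ?ys) (x ?y)" "fm a1 = conjugate Q \<beta> \<alpha> ?ys ?y f1"
      using hom_bijective_surj[OF f xs c(1)] by metis
    obtain a2 where a2: "a2 \<in> ophom P (map x ?ys) (x ?y)" "fm a2 = conjugate Q \<beta> \<alpha> ?ys ?y f2"
      using hom_bijective_surj[OF f xs c(2)] by metis
    have "gm (fm a1) = gm (fm a2)"
      unfolding a1 a2 using perm_functor_conjugate[OF H j_ax h(1) y(2,1)]
        perm_functor_conjugate[OF H j_ax h(2) y(2,1)] e by simp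
    then have "a1 = a2" using hom_bijective_inj[OF gf P.operad_axioms, of a1 a2] a1 a2 by (simp add: ophom_iff)
    then have "conjugate Q \<beta> \<alpha> ?ys ?y f1 = conjugate Q \<beta> \<alpha> ?ys ?y f2" using a1 a2 by simp
    then show "f1 = f2"
      using j.conjugate_inverse[OF h(1) y(2,1)] j.conjugate_inverse[OF h(2) y(2,1)] by simp
  next
    fix r ys y assume y: "set ys \<subseteq> ob Q" "y \<in> ob Q" and r: "r \<in> ophom R (map go ys) (go y)"
    have xs: "set (map x ys) \<subseteq> ob P" "x y \<in> ob P" using x y by auto
    let ?r = "conjugate R (\<lambda>y. gm (\<beta> y)) (\<lambda>y. gm (\<alpha> y)) ys y r"
    have "?r \<in> ophom R (map (go \<circ> fo) (map x ys)) ((go \<circ> fo) (x y))"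
      using gj.conjugate_hom[OF r y(2,1)] by (simp add: comp_def)
    then obtain a1 where a1: "a1 \<in> ophom P (map x ys) (x y)" "gm (fm a1) = ?r"
      using hom_bijective_surj[OF gf xs] by (metis comp_apply)
    have fa: "fm a1 \<in> ophom Q (map (\<lambda>y. fo (x y)) ys) (fo (x y))"
      using pf_hom[OF F, of a1] a1 by (auto simp: ophom_iff)
    have "conjugate Q \<alpha> \<beta> ys y (fm a1) \<in> ophom Q ys y"
      using i.conjugate_hom[OF fa y(2,1)] by simp
    moreover have "gm (conjugate Q \<alpha> \<beta> ys y (fm a1)) = r"
      using perm_functor_conjugate[OF H i.iso_family_axioms fa y(2,1)]
        gj.conjugate_inverse[OF r y(2,1)] a1 by simp
    ultimately show "\<exists>g \<in> ophom Q ys y. gm g = r" by blast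
  qed
qed

lemma conjugate_cong:
  assumes "\<alpha> k = \<alpha>' k" "\<And>j. j \<in> set ks \<Longrightarrow> \<beta> j = \<beta>' j"
  shows "conjugate P \<alpha> \<beta> ks k f = conjugate P \<alpha>' \<beta>' ks k f"
  using assms unfolding conjugate_def by (metis map_eq_conv)


section \<open>A common framework for plain and symmetric operads\<close>

lemma perm_functor_cong:
  assumes "perm_operad G P a"
    and "\<And>p. p \<in> ob P \<Longrightarrow> fo p = fo' p" "\<And>f. f \<in> mor P \<Longrightarrow> fm f = fm' f"
    and F: "perm_functor G P a Q b fo fm"
  shows "perm_functor G P a Q b fo' fm'"
proof -
  interpret perm_operad G P a by fact
  show ?thesis
  proof (rule perm_functorI)
    fix f assume f: "f \<in> mor P"
    have "map fo' (ins P f) = map fo (ins P f)" using ins_ob[OF f] assms(2) by auto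
    then show "fm' f \<in> ophom Q (map fo' (ins P f)) (fo' (out P f))"
      using pf_hom[OF F f] assms(2)[OF out_ob[OF f]] assms(3)[OF f] by (simp only:)
  next
    fix f gs assume c: "composable P f gs"
    then have m: "f \<in> mor P" "set gs \<subseteq> mor P" by (auto simp: composable_def)
    have "map fm' gs = map fm gs" using m assms(3) by auto
    then show "fm' (opcomp P f gs) = opcomp Q (fm' f) (map fm' gs)"
      using pf_opcomp[OF F c] assms(3) m composable_hom[OF c] by metis
  next
    fix f \<sigma> assume "f \<in> mor P" "\<sigma> \<in> G (arity P f)"
    then show "fm' (a \<sigma> f) = b \<sigma> (fm' f)"
      using pf_act[OF F] assms(3) pact_hom' by metis
  qed (use assms(2,3) pf_ob[OF F] pf_opid[OF F] opid_hom' in metis)+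
qed

lemma perm_functor_id: "perm_functor G P a P a (\<lambda>p. p) (\<lambda>f. f)"
  by (rule perm_functorI) (auto simp: ophom_iff)

text \<open>
  A kind of operads is given by the permutations that act, the action \<open>act_of\<close> contained in a
  record, and a way to \<open>make\<close> a record from an operad and an action. For plain operads \<open>make\<close> drops
  the action, which is why \<open>act_make\<close> compares actions only on morphisms and for the permutations
  in \<open>G\<close>.
\<close>

locale operad_kind = universe U
  for U :: "'u itself" +
  fixes G :: "nat \<Rightarrow> (nat \<Rightarrow> nat) set"
    and act_of :: "('u, 'u, 'z) operad_scheme \<Rightarrow> (nat \<Rightarrow> nat) \<Rightarrow> 'u \<Rightarrow> 'u"
    and make :: "('u, 'u) operad \<Rightarrow> ((nat \<Rightarrow> nat) \<Rightarrow> 'u \<Rightarrow> 'u) \<Rightarrow> ('u, 'u, 'z) operad_scheme"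
  assumes make_fields: "ob (make P a) = ob P" "mor (make P a) = mor P"
      "ins (make P a) = ins P" "out (make P a) = out P" "opid (make P a) = opid P"
      "opcomp (make P a) = opcomp P"
    and admissible_permutes: "\<sigma> \<in> G n \<Longrightarrow> \<sigma> permutes {..<n}"
    and make_operad: "perm_operad G P a \<Longrightarrow> perm_operad G (make P a) (act_of (make P a))"
    and act_make: "perm_operad G P a \<Longrightarrow> f \<in> mor P \<Longrightarrow> \<sigma> \<in> G (arity P f) \<Longrightarrow>
      act_of (make P a) \<sigma> f = a \<sigma> f"
begin

abbreviation is_operad :: "('u, 'u, 'z) operad_scheme \<Rightarrow> bool" where
  "is_operad P \<equiv> perm_operad G P (act_of P)"

abbreviation is_functor where
  "is_functor P Q fo fm \<equiv> perm_functor G P (act_of P) Q (act_of Q) fo fm"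

definition small_operads :: "('u, 'u, 'z) operad_scheme set" where
  "small_operads = {P. is_operad P \<and> is_small (ob P) \<and> is_small (mor P)}"

definition functors :: "(('u, 'u, 'z) operad_scheme, 'u) umap set" where
  "functors = {F. is_operad (source F) \<and> is_operad (target F) \<and> on_ob F \<in> extensional (ob (source F)) \<and>
     on_mor F \<in> extensional (mor (source F)) \<and> is_functor (source F) (target F) (on_ob F) (on_mor F)}"

definition cat :: "(('u, 'u, 'z) operad_scheme, (('u, 'u, 'z) operad_scheme, 'u) umap) category" where
  "cat = operad_map_category small_operads functors"

definition arrow :: "('u, 'u, 'z) operad_scheme \<Rightarrow> ('u, 'u, 'z) operad_scheme \<Rightarrow>
    ('u \<Rightarrow> 'u) \<Rightarrow> ('u \<Rightarrow> 'u) \<Rightarrow> (('u, 'u, 'z) operad_scheme, 'u) umap" where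
  "arrow P Q fo fm = \<lparr>source = P, target = Q, on_ob = restrict fo (ob P), on_mor = restrict fm (mor P)\<rparr>"

lemma small_operadsD: "P \<in> small_operads \<Longrightarrow> is_operad P" "P \<in> small_operads \<Longrightarrow> is_small (ob P)" "P \<in> small_operads \<Longrightarrow> is_small (mor P)"
    "P \<in> small_operads \<Longrightarrow> operad P"
  by (auto simp: small_operads_def perm_operad_def)

lemma cat_simps [simp]: "Ob cat = small_operads" "Dom cat = source" "Cod cat = target"
  by (simp_all add: cat_def operad_map_category_def)

lemma Hom_iff: "F \<in> Hom cat P Q \<longleftrightarrow> source F = P \<and> target F = Q \<and> P \<in> small_operads \<and> Q \<in> small_operads \<and>
    on_ob F \<in> extensional (ob P) \<and> on_mor F \<in> extensional (mor P) \<and> is_functor P Q (on_ob F) (on_mor F)"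
  by (auto simp: Hom_def cat_def operad_map_category_def functors_def small_operadsD)

lemma Arr_iff: "F \<in> Arr cat \<longleftrightarrow> F \<in> Hom cat (source F) (target F)"
  by (simp add: Hom_def)

lemma HomD:
  assumes "F \<in> Hom cat P Q"
  shows "source F = P" "target F = Q" "P \<in> small_operads" "Q \<in> small_operads" "is_functor P Q (on_ob F) (on_mor F)"
    "F \<in> Arr cat"
  using assms by (auto simp: Hom_iff Arr_iff)

lemma arrow_simps [simp]:
  "source (arrow P Q fo fm) = P" "target (arrow P Q fo fm) = Q"
  "p \<in> ob P \<Longrightarrow> on_ob (arrow P Q fo fm) p = fo p"
  "f \<in> mor P \<Longrightarrow> on_mor (arrow P Q fo fm) f = fm f"
  by (simp_all add: arrow_def)

lemma arrow_Hom:
  assumes "P \<in> small_operads" "Q \<in> small_operads" "is_functor P Q fo fm"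
  shows "arrow P Q fo fm \<in> Hom cat P Q"
proof -
  have "is_functor P Q (on_ob (arrow P Q fo fm)) (on_mor (arrow P Q fo fm))"
    by (rule perm_functor_cong[OF small_operadsD(1)[OF assms(1)] _ _ assms(3)]) auto
  then show ?thesis using assms by (simp add: Hom_iff) (simp add: arrow_def)
qed

lemma Hom_eqI:
  assumes "F \<in> Hom cat P Q" "F' \<in> Hom cat P Q"
    and "\<And>p. p \<in> ob P \<Longrightarrow> on_ob F p = on_ob F' p" "\<And>f. f \<in> mor P \<Longrightarrow> on_mor F f = on_mor F' f"
  shows "F = F'"
proof -
  have "on_ob F = on_ob F'" "on_mor F = on_mor F'"
    using assms by (auto simp: Hom_iff intro: extensionalityI)
  then show ?thesis using assms by (cases F; cases F') (auto simp: Hom_iff)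
qed

lemma Comp_on [simp]:
  "p \<in> ob (source F) \<Longrightarrow> on_ob (Comp cat H F) p = on_ob H (on_ob F p)"
  "f \<in> mor (source F) \<Longrightarrow> on_mor (Comp cat H F) f = on_mor H (on_mor F f)"
  by (simp_all add: cat_def operad_map_category_def compose_def)

lemma Id_on [simp]:
  "p \<in> ob P \<Longrightarrow> on_ob (Id cat P) p = p" "f \<in> mor P \<Longrightarrow> on_mor (Id cat P) f = f"
  by (simp_all add: cat_def operad_map_category_def)

lemma Comp_in_Hom:
  assumes F: "F \<in> Hom cat P Q" and H: "H \<in> Hom cat Q R"
  shows "Comp cat H F \<in> Hom cat P R"
proof -
  have "Comp cat H F = arrow P R (on_ob H \<circ> on_ob F) (on_mor H \<circ> on_mor F)"
    using F H by (simp add: cat_def operad_map_category_def arrow_def Hom_iff compose_def fun_eq_iff)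
      (simp add: Hom_def)
  then show ?thesis
    using arrow_Hom[OF HomD(3)[OF F] HomD(4)[OF H] perm_functor_compose[OF HomD(5)[OF F] HomD(5)[OF H]]]
    by simp
qed

lemma Id_in_Hom: "P \<in> small_operads \<Longrightarrow> Id cat P \<in> Hom cat P P"
proof -
  assume "P \<in> small_operads"
  moreover have "Id cat P = arrow P P (\<lambda>p. p) (\<lambda>f. f)"
    by (simp add: cat_def operad_map_category_def arrow_def)
  ultimately show ?thesis using perm_functor_id by (auto intro!: arrow_Hom)
qed

lemma pf_mems:
  assumes "F \<in> Hom cat P Q"
  shows "p \<in> ob P \<Longrightarrow> on_ob F p \<in> ob Q" "f \<in> mor P \<Longrightarrow> on_mor F f \<in> mor Q"
  using HomD(5)[OF assms] by (auto simp: pf_ob pf_mor)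

lemma category_cat: "category cat"
proof
  fix F assume "F \<in> Arr cat"
  then show "Dom cat F \<in> Ob cat" "Cod cat F \<in> Ob cat" by (auto simp: Arr_iff Hom_iff)
next
  fix P assume "P \<in> Ob cat" then show "Id cat P \<in> Hom cat P P" by (simp add: Id_in_Hom)
next
  fix F H P Q R assume "F \<in> Hom cat P Q" "H \<in> Hom cat Q R"
  then show "Comp cat H F \<in> Hom cat P R" by (rule Comp_in_Hom)
next
  fix F P Q assume F: "F \<in> Hom cat P Q"
  have s: "source F = P" "source (Id cat P) = P"
    using HomD(1)[OF F] HomD(1)[OF Id_in_Hom[OF HomD(3)[OF F]]] by auto
  show "Comp cat F (Id cat P) = F"
    using s by (intro Hom_eqI[OF Comp_in_Hom[OF Id_in_Hom[OF HomD(3)[OF F]] F] F]) auto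
  show "Comp cat (Id cat Q) F = F"
    using s pf_mems[OF F] by (intro Hom_eqI[OF Comp_in_Hom[OF F Id_in_Hom[OF HomD(4)[OF F]]] F]) auto
next
  fix F H K P Q R S assume h: "F \<in> Hom cat P Q" "H \<in> Hom cat Q R" "K \<in> Hom cat R S"
  show "Comp cat K (Comp cat H F) = Comp cat (Comp cat K H) F"
    using h HomD(1)[OF h(1)] HomD(1)[OF h(2)] HomD(1)[OF Comp_in_Hom[OF h(1,2)]] pf_mems[OF h(1)]
    by (intro Hom_eqI[OF Comp_in_Hom[OF Comp_in_Hom[OF h(1,2)] h(3)]
        Comp_in_Hom[OF h(1) Comp_in_Hom[OF h(2,3)]]]) auto
qed

text \<open>
  Any small operad, on whatever types, is isomorphic to an object of the category. The isomorphism
  and its inverse are returned as two functors.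
\<close>

lemma encode_exists:
  fixes P :: "('o, 'm, 'w) operad_scheme"
  assumes P: "perm_operad G P a" and small: "is_small (ob P)" "is_small (mor P)"
  obtains R eo em "do" dm where "R \<in> small_operads" "ob R = eo ` ob P" "mor R = em ` mor P"
    "\<forall>p\<in>ob P. do (eo p) = p" "\<forall>f\<in>mor P. dm (em f) = f"
    "perm_functor G P a R (act_of R) eo em" "perm_functor G R (act_of R) P a do dm"
proof -
  obtain eo :: "'o \<Rightarrow> 'u" where eo: "inj_on eo (ob P)" using small_inj[OF small(1)] by blast
  obtain em :: "'m \<Rightarrow> 'u" where em: "inj_on em (mor P)" using small_inj[OF small(2)] by blast
  let ?E = "encode eo em P" and ?a = "encode_act em P a"
  have E: "perm_operad G ?E ?a" by (rule perm_operad_encode[OF P eo em])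
  define R where "R = make ?E ?a"
  have fields: "ob R = eo ` ob P" "mor R = em ` mor P"
    by (simp_all add: R_def make_fields encode_simps[OF P eo em])
  have gR: "is_operad R" unfolding R_def by (rule make_operad[OF E])
  have 1: "perm_functor G ?E ?a R (act_of R) (\<lambda>p. p) (\<lambda>f. f)"
    by (rule perm_functorI) (auto simp: R_def make_fields ophom_iff act_make[OF E])
  have 2: "perm_functor G R (act_of R) ?E ?a (\<lambda>p. p) (\<lambda>f. f)"
    by (rule perm_functorI)
      (auto simp: R_def make_fields ophom_iff act_make[OF E] composable_def arity_def)
  have 3: "perm_functor G P a R (act_of R) eo em"
    using perm_functor_compose[OF perm_functor_encode[OF P eo em] 1] by (simp add: comp_def)
  have 4: "perm_functor G R (act_of R) P a (inv_into (ob P) eo) (inv_into (mor P) em)"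
    using perm_functor_compose[OF 2 perm_functor_decode[OF P eo em]] by (simp add: comp_def)
  have "R \<in> small_operads" using gR small by (auto simp: small_operads_def fields intro: small_image)
  then show thesis
    using that[of R eo em "inv_into (ob P) eo" "inv_into (mor P) em"] fields 3 4 eo em by simp
qed

lemma small_joint_mor:
  fixes D :: "'i \<Rightarrow> ('u, 'u, 'z) operad_scheme"
  assumes "is_small X" "is_small I" "\<And>i. i \<in> I \<Longrightarrow> is_small (mor (D i))"
  shows "is_small (mor (joint_pullback X ev I D))"
proof (rule small_subset)
  show "is_small (lists X \<times> X \<times> (\<Pi>\<^sub>E i\<in>I. mor (D i)))"
    using assms by (intro small_Times small_lists small_PiE) auto
  show "mor (joint_pullback X ev I D) \<subseteq> lists X \<times> X \<times> (\<Pi>\<^sub>E i\<in>I. mor (D i))"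
  proof -
    have "(\<Pi>\<^sub>E i\<in>I. ophom (D i) (map (\<lambda>y. ev y i) xs) (ev x i)) \<subseteq> (\<Pi>\<^sub>E i\<in>I. mor (D i))" for xs x
      by (rule PiE_mono) (simp add: ophom_def)
    then show ?thesis by (fastforce simp: joint_pullback_def)
  qed
qed

text \<open>
  Any map from a small set \<open>X\<close> to the objects of \<open>Q\<close> is, up to renaming \<open>X\<close> by \<open>eo\<close>, the object
  map of a fully faithful functor to \<open>Q\<close>. It is the joint pullback with one index.
\<close>

lemma pullback_along_objects:
  fixes X :: "'x set"
  assumes Q: "Q \<in> small_operads" and X: "is_small X" and ev: "\<And>x. x \<in> X \<Longrightarrow> ev x \<in> ob Q"
  obtains R eo "do" \<pi>o \<pi>m where "R \<in> small_operads" "ob R = eo ` X" "\<And>x. x \<in> X \<Longrightarrow> do (eo x) = x"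
    "is_functor R Q \<pi>o \<pi>m" "hom_bijective R Q \<pi>o \<pi>m" "\<And>x. x \<in> X \<Longrightarrow> \<pi>o (eo x) = ev x"
proof -
  let ?e = "\<lambda>x (i :: unit). ev x" and ?I = "UNIV :: unit set" and ?D = "\<lambda>i :: unit. Q"
    and ?a = "\<lambda>i :: unit. act_of Q"
  let ?J = "joint_pullback X ?e ?I ?D"
  note Q' = small_operadsD[OF Q]
  interpret Q: perm_operad G Q "act_of Q" by (rule Q')
  have c: "\<And>i. i \<in> ?I \<Longrightarrow> perm_operad G (?D i) (?a i)" "\<And>\<sigma> n. \<sigma> \<in> G n \<Longrightarrow> \<sigma> permutes {..<n}"
    "\<And>i x. i \<in> ?I \<Longrightarrow> x \<in> X \<Longrightarrow> ?e x i \<in> ob (?D i)"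
    using Q' ev admissible_permutes by auto
  note J = perm_operad_joint[where G = G and X = X and ev = ?e and I = ?I and D = ?D and a = ?a, OF c]
  have obJ: "ob ?J = X" by (simp add: joint_pullback_def)
  have iffJ: "f \<in> mor ?J \<longleftrightarrow> set (fst f) \<subseteq> X \<and> fst (snd f) \<in> X \<and>
     snd (snd f) () \<in> ophom Q (map ev (fst f)) (ev (fst (snd f)))" for f
    by (auto simp: joint_pullback_def PiE_iff split: prod.splits)
  have sm: "is_small (ob ?J)" "is_small (mor ?J)" using X Q'
    by (simp add: obJ) (intro small_joint_mor small_finite[OF finite] X Q')
  obtain R eo em "do" dm where R: "R \<in> small_operads" "ob R = eo ` X" "mor R = em ` mor ?J"
    and d': "\<forall>p\<in>X. do (eo p) = p" "\<forall>f\<in>mor ?J. dm (em f) = f"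
    and e: "perm_functor G ?J (joint_act ?I ?a) R (act_of R) eo em"
    and de: "perm_functor G R (act_of R) ?J (joint_act ?I ?a) do dm"
    by (rule encode_exists[OF J sm, unfolded obJ])
  note d = bspec[OF d'(1)] bspec[OF d'(2)]
  have pr: "perm_functor G ?J (joint_act ?I ?a) Q (act_of Q) ev (\<lambda>f. snd (snd f) ())"
    using joint_projection[where G = G and X = X and ev = ?e and I = ?I and D = ?D and a = ?a
      and i = "()" and M = "mor ?J", OF c] by simp
  note pi = perm_functor_compose[OF de pr]
  have "hom_bijective R Q (ev \<circ> do) ((\<lambda>f. snd (snd f) ()) \<circ> dm)"
  proof (rule hom_bijectiveI[OF pi])
    fix f g assume fg: "f \<in> mor R" "g \<in> mor R" and io: "ins R f = ins R g" "out R f = out R g"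
      and s: "((\<lambda>f. snd (snd f) ()) \<circ> dm) f = ((\<lambda>f. snd (snd f) ()) \<circ> dm) g"
    have "dm f = dm g"
      using pf_ins[OF de fg(1)] pf_ins[OF de fg(2)] pf_out[OF de fg(1)] pf_out[OF de fg(2)] io s
      by (auto simp: joint_pullback_def prod_eq_iff fun_eq_iff)
    then show "f = g" using fg R(3) d(2) by auto
  next
    fix f ps p assume p: "set ps \<subseteq> ob R" "p \<in> ob R" and f: "f \<in> ophom Q (map (ev \<circ> do) ps) ((ev \<circ> do) p)"
    let ?t = "(map do ps, do p, \<lambda>i :: unit. f)"
    have t: "?t \<in> mor ?J" using p f R(2) d(1) by (auto simp: iffJ comp_def)
    have "map eo (map do ps) = ps" using p R(2) d(1) by (auto intro!: map_idI)
    then have "em ?t \<in> ophom R ps p"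
      using pf_hom[OF e t] p R(2) d(1) by (auto simp: joint_pullback_def)
    moreover have "((\<lambda>f. snd (snd f) ()) \<circ> dm) (em ?t) = f" using d(2)[OF t] by simp
    ultimately show "\<exists>g\<in>ophom R ps p. ((\<lambda>f. snd (snd f) ()) \<circ> dm) g = f" by blast
  qed
  then show thesis using that[OF R(1,2) d(1) pi] d(1) by simp
qed

end


section \<open>Limits and colimits\<close>

text \<open>
  The source of uniqueness for maps out of a colimit.
\<close>

lemma functors_agree_on_generated:
  assumes K: "perm_operad G K a" and B: "B \<subseteq> mor K"
    and F: "perm_functor G (K\<lparr>mor := generated G K a B\<rparr>) a Q b fo fm"
    and F': "perm_functor G (K\<lparr>mor := generated G K a B\<rparr>) a Q b fo' fm'"
    and eo: "\<And>p. p \<in> ob K \<Longrightarrow> fo p = fo' p" and em: "\<And>f. f \<in> B \<Longrightarrow> fm f = fm' f"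
    and f: "f \<in> generated G K a B"
  shows "fm f = fm' f"
  using f
proof induction
  case (generated_opid p)
  then show ?case using pf_opid[OF F, of p] pf_opid[OF F', of p] eo by simp
next
  case (generated_opcomp f gs)
  then have "composable (K\<lparr>mor := generated G K a B\<rparr>) f gs" by (auto simp: composable_def)
  moreover have e: "map fm gs = map fm' gs" using generated_opcomp by auto
  ultimately show ?case
    using pf_opcomp[OF F, of f gs] pf_opcomp[OF F', of f gs] generated_opcomp(4) by (simp add: e)
next
  case (generated_act f \<sigma>)
  then show ?case using pf_act[OF F, of f \<sigma>] pf_act[OF F', of f \<sigma>] by (simp add: arity_def)
qed (rule em)

context operad_kind
begin

context
  fixes J :: "('u, 'u) category" and Do Da
  assumes J: "category J" and small_Ob: "is_small (Ob J)" and diagram: "cat_functor J cat Do Da"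
begin

lemma diagram_ob: "j \<in> Ob J \<Longrightarrow> Do j \<in> small_operads"
  using diagram by (simp add: cat_functor_def)

lemma diagram_arr: "u \<in> Arr J \<Longrightarrow> Da u \<in> Hom cat (Do (Dom J u)) (Do (Cod J u))"
  using diagram by (simp add: cat_functor_def)

lemma diagram_ends: "u \<in> Arr J \<Longrightarrow> Dom J u \<in> Ob J" "u \<in> Arr J \<Longrightarrow> Cod J u \<in> Ob J"
  using J by (auto simp: category_def)

text \<open>
  Objects of the limit are compatible families of objects; morphisms are compatible families of
  morphisms between them, which form a suboperad of the joint pullback.
\<close>

lemma limit_exists: "\<exists>x p. limit_cone J cat Do Da x p"
proof -
  define ev where "ev = (\<lambda>(x :: 'u \<Rightarrow> 'u) j. x j)"
  define X where "X = {x \<in> (\<Pi>\<^sub>E j\<in>Ob J. ob (Do j)). \<forall>u\<in>Arr J. on_ob (Da u) (x (Dom J u)) = x (Cod J u)}"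
  define K where "K = joint_pullback X ev (Ob J) Do"
  define act :: "_ \<Rightarrow> ('u \<Rightarrow> 'u) list \<times> ('u \<Rightarrow> 'u) \<times> _ \<Rightarrow> _"
    where "act = joint_act (Ob J) (\<lambda>j. act_of (Do j))"
  define M where "M = {f \<in> mor K. \<forall>u\<in>Arr J. on_mor (Da u) (snd (snd f) (Dom J u)) = snd (snd f) (Cod J u)}"
  have c: "\<And>j. j \<in> Ob J \<Longrightarrow> perm_operad G (Do j) (act_of (Do j))" "\<And>\<sigma> n. \<sigma> \<in> G n \<Longrightarrow> \<sigma> permutes {..<n}"
    "\<And>j x. j \<in> Ob J \<Longrightarrow> x \<in> X \<Longrightarrow> ev x j \<in> ob (Do j)"
    using diagram_ob small_operadsD(1) admissible_permutes by (auto simp: X_def ev_def)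
  note K = perm_operad_joint[where G = G and X = X and ev = ev and I = "Ob J" and D = Do
      and a = "\<lambda>j. act_of (Do j)", OF c, folded K_def act_def]
  have MK: "M \<subseteq> mor K" by (auto simp: M_def)
  have DaF: "is_functor (Do (Dom J u)) (Do (Cod J u)) (on_ob (Da u)) (on_mor (Da u))" if "u \<in> Arr J" for u
    using HomD(5)[OF diagram_arr[OF that]] .
  interpret K: perm_operad G K act by (rule K)
  have mK: "snd (snd f) j \<in> mor (Do j)" "arity (Do j) (snd (snd f) j) = arity K f"
    if "f \<in> mor K" "j \<in> Ob J" for f j
    using that by (auto simp: K_def joint_mor_iff arity_def)
  have KM: "perm_operad G (K\<lparr>mor := M\<rparr>) act"
  proof (rule perm_operad_sub[OF K MK])
    fix x assume x: "x \<in> ob K"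
    then have "opid K x \<in> mor K" by (rule K.opid_hom')
    moreover have "on_mor (Da u) (opid (Do (Dom J u)) (ev x (Dom J u))) = opid (Do (Cod J u)) (ev x (Cod J u))"
      if u: "u \<in> Arr J" for u
      using pf_opid[OF DaF[OF u], of "ev x (Dom J u)"] x u c(3)[of "Dom J u" x] diagram_ends
      by (simp add: K_def X_def ev_def)
    ultimately show "opid K x \<in> M" using diagram_ends by (simp add: M_def K_def)
  next
    fix f gs assume k: "composable K f gs" and fg: "f \<in> M" "set gs \<subseteq> M"
    have "on_mor (Da u) (snd (snd (opcomp K f gs)) (Dom J u)) = snd (snd (opcomp K f gs)) (Cod J u)"
      if u: "u \<in> Arr J" for u
    proof -
      have "composable (Do (Dom J u)) (snd (snd f) (Dom J u)) (map (\<lambda>g. snd (snd g) (Dom J u)) gs)"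
        using joint_composable_component[where a = "\<lambda>j. act_of (Do j)", OF c k[unfolded K_def]]
          diagram_ends[OF u] by blast
      moreover have "map (on_mor (Da u)) (map (\<lambda>g. snd (snd g) (Dom J u)) gs) = map (\<lambda>g. snd (snd g) (Cod J u)) gs"
        using fg u by (auto simp: M_def)
      ultimately show ?thesis
        using diagram_ends[OF u] fg u pf_opcomp[OF DaF[OF u]] by (simp add: K_def M_def del: map_map)
    qed
    then show "opcomp K f gs \<in> M" using K.composable_hom[OF k] by (simp add: M_def)
  next
    fix f \<sigma> assume f: "f \<in> M" "\<sigma> \<in> G (arity K f)"
    then have "on_mor (Da u) (snd (snd (act \<sigma> f)) (Dom J u)) = snd (snd (act \<sigma> f)) (Cod J u)"
      if u: "u \<in> Arr J" for u
      using diagram_ends[OF u] pf_act[OF DaF[OF u], of "snd (snd f) (Dom J u)" \<sigma>] mK[of f "Dom J u"] u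
      by (simp add: act_def M_def)
    then show "act \<sigma> f \<in> M" using f K.pact_hom'[of f \<sigma>] by (simp add: M_def)
  qed
  have sX: "is_small X"
    by (rule small_subset[OF small_PiE[OF small_Ob, of "\<lambda>j. ob (Do j)"]])
      (use diagram_ob small_operadsD in \<open>auto simp: X_def\<close>)
  have "is_small (mor K)"
    unfolding K_def using sX small_Ob diagram_ob small_operadsD by (intro small_joint_mor) auto
  then have sM: "is_small M" using MK by (rule small_subset)
  have obK: "ob K = X" by (simp add: K_def)
  obtain R eo em "do" dm where R: "R \<in> small_operads" "ob R = eo ` X" "mor R = em ` M"
    and d': "\<forall>p\<in>X. do (eo p) = p" "\<forall>f\<in>M. dm (em f) = f"
    and e: "perm_functor G (K\<lparr>mor := M\<rparr>) act R (act_of R) eo em"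
    and de: "perm_functor G R (act_of R) (K\<lparr>mor := M\<rparr>) act do dm"
    by (rule encode_exists[OF KM, simplified, unfolded obK, OF sX sM])
  note d = bspec[OF d'(1)] bspec[OF d'(2)]
  define p where "p j = arrow R (Do j) ((\<lambda>x. ev x j) \<circ> do) ((\<lambda>f. snd (snd f) j) \<circ> dm)" for j
  have p: "p j \<in> Hom cat R (Do j)" if j: "j \<in> Ob J" for j
    unfolding p_def
    using joint_projection[where G = G and X = X and ev = ev and I = "Ob J" and D = Do
        and a = "\<lambda>j. act_of (Do j)" and M = M, OF c j] MK
    by (intro arrow_Hom R diagram_ob j perm_functor_compose[OF de]) (simp add: K_def act_def)
  have do_X: "do r \<in> X" "eo (do r) = r" if "r \<in> ob R" for r using that R(2) d(1) by auto
  have dm_M: "dm f \<in> M" "em (dm f) = f" if "f \<in> mor R" for f using that R(3) d(2) by auto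
  have "cone J cat Do Da R p"
    unfolding cone_def
  proof (intro conjI ballI)
    fix u assume u: "u \<in> Arr J"
    note pd = p[OF diagram_ends(1)[OF u]]
    show "Comp cat (Da u) (p (Dom J u)) = p (Cod J u)"
    proof (rule Hom_eqI[OF Comp_in_Hom[OF pd diagram_arr[OF u]] p[OF diagram_ends(2)[OF u]]])
      show "on_ob (Comp cat (Da u) (p (Dom J u))) r = on_ob (p (Cod J u)) r" if "r \<in> ob R" for r
        using that u do_X[OF that] by (simp add: p_def X_def ev_def)
      show "on_mor (Comp cat (Da u) (p (Dom J u))) f = on_mor (p (Cod J u)) f" if "f \<in> mor R" for f
        using that u dm_M[OF that] by (simp add: p_def M_def)
    qed
  qed (use R p in auto)
  moreover have "\<exists>!h. h \<in> Hom cat y R \<and> (\<forall>j\<in>Ob J. Comp cat (p j) h = q j)"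
    if cone: "cone J cat Do Da y q" for y q
  proof -
    have y: "y \<in> small_operads" and q: "\<And>j. j \<in> Ob J \<Longrightarrow> q j \<in> Hom cat y (Do j)"
      and qq: "\<And>u. u \<in> Arr J \<Longrightarrow> Comp cat (Da u) (q (Dom J u)) = q (Cod J u)"
      using cone by (auto simp: cone_def)
    have sq: "source (q j) = y" if "j \<in> Ob J" for j using HomD(1)[OF q[OF that]] .
    interpret y: perm_operad G y "act_of y" by (rule small_operadsD(1)[OF y])
    define h where "h t = (\<lambda>j\<in>Ob J. on_ob (q j) t)" for t
    define hm where "hm f = (map h (ins y f), h (out y f), \<lambda>j\<in>Ob J. on_mor (q j) f)" for f
    have hX: "h t \<in> X" if t: "t \<in> ob y" for t
    proof -
      have "on_ob (Da u) (on_ob (q (Dom J u)) t) = on_ob (q (Cod J u)) t" if u: "u \<in> Arr J" for u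
        using arg_cong[OF qq[OF u], of "\<lambda>F. on_ob F t"] t sq[OF diagram_ends(1)[OF u]] by simp
      then show ?thesis
        using pf_mems(1)[OF q t] diagram_ends by (auto simp: X_def h_def)
    qed
    have hmM: "hm f \<in> M" if f: "f \<in> mor y" for f
    proof -
      have "on_mor (Da u) (on_mor (q (Dom J u)) f) = on_mor (q (Cod J u)) f" if u: "u \<in> Arr J" for u
        using arg_cong[OF qq[OF u], of "\<lambda>F. on_mor F f"] f sq[OF diagram_ends(1)[OF u]] by simp
      moreover have "hm f \<in> mor K"
        unfolding K_def joint_mor_iff
        using hX y.ins_ob[OF f] y.out_ob[OF f] pf_mor[OF HomD(5)[OF q] f] pf_ins[OF HomD(5)[OF q] f]
          pf_out[OF HomD(5)[OF q] f]
        by (auto simp: hm_def h_def ev_def)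
      ultimately show ?thesis using diagram_ends by (simp add: M_def hm_def)
    qed
    have qj: "perm_functor G y (act_of y) (Do j) (act_of (Do j)) (\<lambda>t. ev (h t) j) (on_mor (q j))"
      if "j \<in> Ob J" for j
      by (rule perm_functor_cong[OF y.perm_operad_axioms _ _ HomD(5)[OF q[OF that]]])
        (use that in \<open>auto simp: ev_def h_def\<close>)
    have "perm_functor G y (act_of y) (K\<lparr>mor := M\<rparr>) act h hm"
      using joint_universal[where G = G and X = X and ev = ev and I = "Ob J" and D = Do
        and a = "\<lambda>j. act_of (Do j)" and M = M and fm = "\<lambda>j. on_mor (q j)" and h = h, OF c y.perm_operad_axioms hX qj]
        hmM by (simp add: hm_def[abs_def] K_def act_def)
    note H_pf = perm_functor_compose[OF this e]
    let ?H = "arrow y R (eo \<circ> h) (em \<circ> hm)"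
    have H: "?H \<in> Hom cat y R" by (rule arrow_Hom[OF y R(1) H_pf])
    show ?thesis
    proof (intro ex1I[of _ ?H] conjI ballI H)
      fix j assume j: "j \<in> Ob J"
      show "Comp cat (p j) ?H = q j"
      proof (rule Hom_eqI[OF Comp_in_Hom[OF H p[OF j]] q[OF j]])
        show "on_ob (Comp cat (p j) ?H) t = on_ob (q j) t" if "t \<in> ob y" for t
          using that j hX[OF that] R(2) d(1) by (simp add: p_def ev_def h_def)
        show "on_mor (Comp cat (p j) ?H) f = on_mor (q j) f" if "f \<in> mor y" for f
          using that j hmM[OF that] R(3) d(2) by (simp add: p_def) (simp add: hm_def)
      qed
    next
      fix H' assume H': "H' \<in> Hom cat y R \<and> (\<forall>j\<in>Ob J. Comp cat (p j) H' = q j)"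
      then have H'h: "H' \<in> Hom cat y R" and sH': "source H' = y" by (auto simp: Hom_iff)
      note H'm = pf_mems[OF H'h]
      have ob_eq: "do (on_ob H' t) = h t" if t: "t \<in> ob y" for t
      proof (rule extensionalityI)
        show "do (on_ob H' t) \<in> extensional (Ob J)" using do_X(1)[OF H'm(1)[OF t]] by (simp add: X_def PiE_def)
        show "h t \<in> extensional (Ob J)" by (simp add: h_def)
        fix j assume j: "j \<in> Ob J"
        then have "on_ob (Comp cat (p j) H') t = on_ob (q j) t" using H' by simp
        then show "do (on_ob H' t) j = h t j" using j t sH' H'm(1)[OF t] by (simp add: p_def ev_def h_def)
      qed
      have mor_eq: "dm (on_mor H' f) = hm f" if f: "f \<in> mor y" for f
      proof -
        have m: "dm (on_mor H' f) \<in> mor K" "hm f \<in> mor K"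
          using dm_M(1)[OF H'm(2)[OF f]] hmM[OF f] MK by auto
        show ?thesis
        proof (rule triple_eqI[where I = "Ob J"])
          have "map do (map (on_ob H') (ins y f)) = map h (ins y f)"
            using ob_eq y.ins_ob[OF f] by auto
          then show "fst (dm (on_mor H' f)) = fst (hm f)"
            using pf_ins[OF de H'm(2)[OF f]] pf_ins[OF HomD(5)[OF H'h] f]
            by (simp add: K_def hm_def del: map_map)
          show "fst (snd (dm (on_mor H' f))) = fst (snd (hm f))"
            using pf_out[OF de H'm(2)[OF f]] pf_out[OF HomD(5)[OF H'h] f] ob_eq[OF y.out_ob[OF f]]
            by (simp add: K_def hm_def)
          show "snd (snd (dm (on_mor H' f))) \<in> extensional (Ob J)" "snd (snd (hm f)) \<in> extensional (Ob J)"
            using m by (auto simp: K_def joint_mor_iff)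
          fix j assume j: "j \<in> Ob J"
          then have "on_mor (Comp cat (p j) H') f = on_mor (q j) f" using H' by simp
          then show "snd (snd (dm (on_mor H' f))) j = snd (snd (hm f)) j"
            using j f sH' H'm(2)[OF f] by (simp add: p_def hm_def)
        qed
      qed
      show "H' = ?H"
      proof (rule Hom_eqI[OF H'h H])
        show "on_ob H' t = on_ob ?H t" if t: "t \<in> ob y" for t
          using do_X(2)[OF H'm(1)[OF t]] ob_eq[OF t] t by simp
        show "on_mor H' f = on_mor ?H f" if f: "f \<in> mor y" for f
          using dm_M(2)[OF H'm(2)[OF f]] mor_eq[OF f] f by simp
      qed
    qed
  qed
  ultimately show ?thesis unfolding limit_cone_def by blast
qed

text \<open>
  The index set \<open>I\<close> consists of all cocones, and \<open>\<kappa>\<close> and \<open>km\<close> send an object or a morphism of the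
  diagram to the family of its images in all of them. The colimit has the values of \<open>\<kappa>\<close> as objects
  and is generated by the values of \<open>km\<close>. Although \<open>I\<close> is large, these values form small sets.
\<close>

lemma colimit_exists: "\<exists>x p. colimit_cocone J cat Do Da x p"
proof -
  define I where "I = {i. cocone J cat Do Da (fst i) (snd i)}"
  define ev where "ev = (\<lambda>(x :: ('u, 'u, 'z) operad_scheme \<times> ('u \<Rightarrow> (('u, 'u, 'z) operad_scheme, 'u) umap) \<Rightarrow> 'u) i. x i)"
  define \<kappa> where "\<kappa> j t = (\<lambda>i\<in>I. on_ob (snd i j) t)" for j t
  define km where "km j f = (map (\<kappa> j) (ins (Do j) f), \<kappa> j (out (Do j) f), \<lambda>i\<in>I. on_mor (snd i j) f)" for j f
  define X where "X = (\<Union>j\<in>Ob J. \<kappa> j ` ob (Do j))"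
  define B where "B = (\<Union>j\<in>Ob J. km j ` mor (Do j))"
  define K where "K = joint_pullback X ev I fst"
  define act :: "_ \<Rightarrow> _ \<times> (('u, 'u, 'z) operad_scheme \<times> ('u \<Rightarrow> (('u, 'u, 'z) operad_scheme, 'u) umap) \<Rightarrow> 'u) \<times> _ \<Rightarrow> _"
    where "act = joint_act I (\<lambda>i. act_of (fst i))"
  define M where "M = generated G K act B"
  have iq: "fst i \<in> small_operads" "j \<in> Ob J \<Longrightarrow> snd i j \<in> Hom cat (Do j) (fst i)"
    "u \<in> Arr J \<Longrightarrow> Comp cat (snd i (Cod J u)) (Da u) = snd i (Dom J u)" if "i \<in> I" for i j u
    using that by (auto simp: I_def cocone_def)
  have c: "\<And>i. i \<in> I \<Longrightarrow> perm_operad G (fst i) (act_of (fst i))" "\<And>\<sigma> n. \<sigma> \<in> G n \<Longrightarrow> \<sigma> permutes {..<n}"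
    "\<And>i x. i \<in> I \<Longrightarrow> x \<in> X \<Longrightarrow> ev x i \<in> ob (fst i)"
    using iq small_operadsD(1) admissible_permutes pf_mems(1)[OF iq(2)] by (auto simp: X_def ev_def \<kappa>_def)
  note K = perm_operad_joint[where G = G and X = X and ev = ev and I = I and D = fst
      and a = "\<lambda>i. act_of (fst i)", OF c, folded K_def act_def]
  interpret K: perm_operad G K act by (rule K)
  have obK: "ob K = X" by (simp add: K_def)
  have \<kappa>X: "\<kappa> j t \<in> X" if "j \<in> Ob J" "t \<in> ob (Do j)" for j t using that by (auto simp: X_def)
  have kmK: "km j f \<in> mor K" if j: "j \<in> Ob J" and f: "f \<in> mor (Do j)" for j f
  proof -
    interpret D: perm_operad G "Do j" "act_of (Do j)" by (rule small_operadsD(1)[OF diagram_ob[OF j]])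
    show ?thesis
      unfolding K_def joint_mor_iff
      using \<kappa>X[OF j] D.ins_ob[OF f] D.out_ob[OF f] pf_mor[OF HomD(5)[OF iq(2)[OF _ j]] f]
        pf_ins[OF HomD(5)[OF iq(2)[OF _ j]] f] pf_out[OF HomD(5)[OF iq(2)[OF _ j]] f]
      by (auto simp: km_def ev_def \<kappa>_def)
  qed
  have BK: "B \<subseteq> mor K" using kmK by (auto simp: B_def)
  have MK: "M \<subseteq> mor K" unfolding M_def by (rule K.generated_subset[OF BK])
  have KM: "perm_operad G (K\<lparr>mor := M\<rparr>) act" unfolding M_def by (rule K.perm_operad_generated[OF BK])
  have sX: "is_small X" unfolding X_def using small_Ob diagram_ob small_operadsD by (intro small_UN small_image) auto
  have sB: "is_small B" unfolding B_def using small_Ob diagram_ob small_operadsD by (intro small_UN small_image) auto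
  have sM: "is_small M" unfolding M_def by (rule small_generated) (simp_all add: obK sX sB)
  obtain R eo em "do" dm where R: "R \<in> small_operads" "ob R = eo ` X" "mor R = em ` M"
    and d': "\<forall>p\<in>X. do (eo p) = p" "\<forall>f\<in>M. dm (em f) = f"
    and e: "perm_functor G (K\<lparr>mor := M\<rparr>) act R (act_of R) eo em"
    and de: "perm_functor G R (act_of R) (K\<lparr>mor := M\<rparr>) act do dm"
    by (rule encode_exists[OF KM, simplified, unfolded obK, OF sX sM])
  note d = bspec[OF d'(1)] bspec[OF d'(2)]
  define p where "p j = arrow (Do j) R (eo \<circ> \<kappa> j) (em \<circ> km j)" for j
  have kmM: "km j f \<in> M" if "j \<in> Ob J" "f \<in> mor (Do j)" for j f
    using that by (auto simp: M_def B_def intro: generated_base)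
  have p: "p j \<in> Hom cat (Do j) R" if j: "j \<in> Ob J" for j
  proof -
    have g: "is_operad (Do j)" by (rule small_operadsD(1)[OF diagram_ob[OF j]])
    have "perm_functor G (Do j) (act_of (Do j)) (fst i) (act_of (fst i)) (\<lambda>t. ev (\<kappa> j t) i) (on_mor (snd i j))"
      if "i \<in> I" for i
      by (rule perm_functor_cong[OF g _ _ HomD(5)[OF iq(2)[OF that j]]])
        (use that in \<open>auto simp: ev_def \<kappa>_def\<close>)
    then have "perm_functor G (Do j) (act_of (Do j)) (K\<lparr>mor := M\<rparr>) act (\<kappa> j) (km j)"
      using joint_universal[where G = G and X = X and ev = ev and I = I and D = fst
        and a = "\<lambda>i. act_of (fst i)" and M = M and fm = "\<lambda>i. on_mor (snd i j)" and h = "\<kappa> j", OF c g \<kappa>X[OF j]]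
        kmM[OF j] by (simp add: km_def[abs_def] K_def act_def)
    then show ?thesis
      unfolding p_def by (intro arrow_Hom R diagram_ob j perm_functor_compose[OF _ e])
  qed
  have "cocone J cat Do Da R p"
    unfolding cocone_def
  proof (intro conjI ballI)
    fix u assume u: "u \<in> Arr J"
    note ends = diagram_ends[OF u]
    note Du = diagram_arr[OF u]
    have s: "source (Da u) = Do (Dom J u)" using HomD(1)[OF Du] .
    interpret D: perm_operad G "Do (Dom J u)" "act_of (Do (Dom J u))" by (rule small_operadsD(1)[OF diagram_ob[OF ends(1)]])
    have k: "\<kappa> (Cod J u) (on_ob (Da u) t) = \<kappa> (Dom J u) t" if t: "t \<in> ob (Do (Dom J u))" for t
    proof -
      have "on_ob (snd i (Cod J u)) (on_ob (Da u) t) = on_ob (snd i (Dom J u)) t" if "i \<in> I" for i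
        using arg_cong[OF iq(3)[OF that u], of "\<lambda>F. on_ob F t"] s t by simp
      then show ?thesis by (auto simp: \<kappa>_def)
    qed
    have k': "km (Cod J u) (on_mor (Da u) f) = km (Dom J u) f" if f: "f \<in> mor (Do (Dom J u))" for f
    proof -
      have "on_mor (snd i (Cod J u)) (on_mor (Da u) f) = on_mor (snd i (Dom J u)) f" if "i \<in> I" for i
        using arg_cong[OF iq(3)[OF that u], of "\<lambda>F. on_mor F f"] s f by simp
      moreover have "map (\<kappa> (Cod J u)) (map (on_ob (Da u)) (ins (Do (Dom J u)) f)) =
          map (\<kappa> (Dom J u)) (ins (Do (Dom J u)) f)"
        using k D.ins_ob[OF f] by auto
      ultimately show ?thesis
        using pf_ins[OF HomD(5)[OF Du] f] pf_out[OF HomD(5)[OF Du] f] k[OF D.out_ob[OF f]]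
        by (auto simp: km_def simp del: map_map)
    qed
    show "Comp cat (p (Cod J u)) (Da u) = p (Dom J u)"
    proof (rule Hom_eqI[OF Comp_in_Hom[OF Du p[OF ends(2)]] p[OF ends(1)]])
      show "on_ob (Comp cat (p (Cod J u)) (Da u)) t = on_ob (p (Dom J u)) t" if "t \<in> ob (Do (Dom J u))" for t
        using that s k pf_mems(1)[OF Du that] by (simp add: p_def)
      show "on_mor (Comp cat (p (Cod J u)) (Da u)) f = on_mor (p (Dom J u)) f" if "f \<in> mor (Do (Dom J u))" for f
        using that s k' pf_mems(2)[OF Du that] by (simp add: p_def)
    qed
  qed (use R p in auto)
  moreover have "\<exists>!h. h \<in> Hom cat R y \<and> (\<forall>j\<in>Ob J. Comp cat h (p j) = q j)"
    if cocone: "cocone J cat Do Da y q" for y q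
  proof -
    define i where "i = (y, q)"
    have i: "i \<in> I" and fi: "fst i = y" "snd i = q" using cocone by (auto simp: i_def I_def)
    have y: "y \<in> small_operads" and q: "\<And>j. j \<in> Ob J \<Longrightarrow> q j \<in> Hom cat (Do j) y" using iq(1,2)[OF i] fi by auto
    let ?H = "arrow R y ((\<lambda>x. ev x i) \<circ> do) ((\<lambda>f. snd (snd f) i) \<circ> dm)"
    have "perm_functor G (K\<lparr>mor := M\<rparr>) act y (act_of y) (\<lambda>x. ev x i) (\<lambda>f. snd (snd f) i)"
      using joint_projection[where G = G and X = X and ev = ev and I = I and D = fst
        and a = "\<lambda>i. act_of (fst i)" and M = M, OF c i] MK by (simp add: K_def act_def fi)
    then have H: "?H \<in> Hom cat R y" by (intro arrow_Hom R y perm_functor_compose[OF de])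
    have sp: "source (p j) = Do j" for j by (simp add: p_def)
    have pp: "t \<in> ob (Do j) \<Longrightarrow> on_ob (p j) t = eo (\<kappa> j t)" "f \<in> mor (Do j) \<Longrightarrow> on_mor (p j) f = em (km j f)"
      for j t f by (simp_all add: p_def)
    show ?thesis
    proof (intro ex1I[of _ ?H] conjI ballI H)
      fix j assume j: "j \<in> Ob J"
      show "Comp cat ?H (p j) = q j"
      proof (rule Hom_eqI[OF Comp_in_Hom[OF p[OF j] H] q[OF j]])
        show "on_ob (Comp cat ?H (p j)) t = on_ob (q j) t" if "t \<in> ob (Do j)" for t
          using that sp pp \<kappa>X[OF j that] R(2) d(1) i fi by (simp add: ev_def \<kappa>_def)
        show "on_mor (Comp cat ?H (p j)) f = on_mor (q j) f" if "f \<in> mor (Do j)" for f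
          using that sp pp kmM[OF j that] R(3) d(2) i fi by simp (simp add: km_def)
      qed
    next
      fix H' assume H': "H' \<in> Hom cat R y \<and> (\<forall>j\<in>Ob J. Comp cat H' (p j) = q j)"
      then have H'h: "H' \<in> Hom cat R y" by simp
      have ob_eq: "on_ob H' (eo x) = on_ob ?H (eo x)" if x: "x \<in> X" for x
      proof -
        obtain j t where jt: "j \<in> Ob J" "t \<in> ob (Do j)" "x = \<kappa> j t" using x by (auto simp: X_def)
        have "on_ob (Comp cat H' (p j)) t = on_ob (q j) t" using H' jt by simp
        then show ?thesis using jt sp pp x R(2) d(1) i fi by (simp add: ev_def \<kappa>_def)
      qed
      have base_eq: "on_mor H' (em f) = on_mor ?H (em f)" if f: "f \<in> B" for f
      proof -
        obtain j g where jg: "j \<in> Ob J" "g \<in> mor (Do j)" "f = km j g" using f by (auto simp: B_def)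
        have "on_mor (Comp cat H' (p j)) g = on_mor (q j) g" using H' jg by simp
        then show ?thesis using jg sp pp kmM[OF jg(1,2)] R(3) d(2) i fi by simp (simp add: km_def)
      qed
      have mor_eq: "(on_mor H' \<circ> em) f = (on_mor ?H \<circ> em) f" if f: "f \<in> M" for f
        by (rule functors_agree_on_generated[OF K BK
            perm_functor_compose[OF e HomD(5)[OF H'h], unfolded M_def]
            perm_functor_compose[OF e HomD(5)[OF H], unfolded M_def]])
          (use ob_eq base_eq f in \<open>auto simp: obK M_def\<close>)
      show "H' = ?H"
        using ob_eq mor_eq R(2,3) by (intro Hom_eqI[OF H'h H]) auto
    qed
  qed
  ultimately show ?thesis unfolding colimit_cocone_def by blast
qed

end

lemma has_small_limits_cat: "has_small_limits U cat"
  unfolding has_small_limits_def using limit_exists by (auto simp: small_in_def)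

lemma has_small_colimits_cat: "has_small_colimits U cat"
  unfolding has_small_colimits_def using colimit_exists by (auto simp: small_in_def)

end


section \<open>The model structure\<close>

lemma hom_bijective_cong:
  assumes P: "operad P" and "\<And>p. p \<in> ob P \<Longrightarrow> fo p = fo' p" "\<And>f. f \<in> mor P \<Longrightarrow> fm f = fm' f"
  shows "hom_bijective P Q fo fm \<longleftrightarrow> hom_bijective P Q fo' fm'"
proof -
  have "bij_betw fm (ophom P ps p) (ophom Q (map fo ps) (fo p)) \<longleftrightarrow>
      bij_betw fm' (ophom P ps p) (ophom Q (map fo' ps) (fo' p))" if "set ps \<subseteq> ob P" "p \<in> ob P" for ps p
  proof -
    have e: "map fo ps = map fo' ps" "fo p = fo' p" using that assms(2) by auto
    show ?thesis unfolding e by (rule bij_betw_cong) (simp add: ophom_def assms(3))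
  qed
  then show ?thesis unfolding hom_bijective_def by blast
qed

lemma iso_surjective_cong: "(\<And>p. p \<in> ob P \<Longrightarrow> fo p = fo' p) \<Longrightarrow> iso_surjective P Q fo \<longleftrightarrow> iso_surjective P Q fo'"
  by (auto simp: iso_surjective_def)

lemma isofibration_cong:
  assumes "\<And>p. p \<in> ob P \<Longrightarrow> fo p = fo' p" "\<And>f. f \<in> mor P \<Longrightarrow> fm f = fm' f"
  shows "isofibration P Q fo fm \<longleftrightarrow> isofibration P Q fo' fm'"
  using assms unfolding isofibration_def by (metis mutually_inverse_def ophom_iff)

lemma iso_surjective_compose:
  assumes "iso_surjective P Q fo" "iso_surjective Q R go" "perm_functor G Q b R c go gm" "operad Q" "operad R"
  shows "iso_surjective P R (go \<circ> fo)"
  unfolding iso_surjective_def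
proof
  fix z assume "z \<in> ob R"
  then obtain y \<gamma> \<delta> where y: "y \<in> ob Q" "mutually_inverse R (go y) z \<gamma> \<delta>"
    using assms(2) unfolding iso_surjective_def by blast
  then obtain x \<alpha> \<beta> where x: "x \<in> ob P" "mutually_inverse Q (fo x) y \<alpha> \<beta>"
    using assms(1) unfolding iso_surjective_def by blast
  have "mutually_inverse R (go (fo x)) (go y) (gm \<alpha>) (gm \<beta>)"
    by (rule perm_functor_inverse[OF assms(3) x(2) assms(4)])
  then show "\<exists>x\<in>ob P. \<exists>\<alpha> \<beta>. mutually_inverse R ((go \<circ> fo) x) z \<alpha> \<beta>"
    using operad.mutually_inverse_trans[OF assms(5) _ y(2)] x(1) unfolding comp_apply by blast
qed

lemma iso_surjective_cancel_right:
  assumes "iso_surjective P R (go \<circ> fo)" "perm_functor G P a Q b fo fm"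
  shows "iso_surjective Q R go"
  using assms(1) pf_ob[OF assms(2)] unfolding iso_surjective_def by fastforce

lemma iso_surjective_cancel_left:
  assumes "iso_surjective P R (go \<circ> fo)" "perm_functor G P a Q b fo fm" "perm_functor G Q b R c go gm" "hom_bijective Q R go gm" "operad Q"
  shows "iso_surjective P Q fo"
  unfolding iso_surjective_def
proof
  fix y assume y: "y \<in> ob Q"
  then obtain x \<alpha> \<beta> where x: "x \<in> ob P" "mutually_inverse R (go (fo x)) (go y) \<alpha> \<beta>"
    using assms(1) pf_ob[OF assms(3)] unfolding iso_surjective_def by (metis comp_apply)
  then show "\<exists>x\<in>ob P. \<exists>\<alpha> \<beta>. mutually_inverse Q (fo x) y \<alpha> \<beta>"
    using hom_bijective_reflect_inverse[OF assms(3,5,4) pf_ob[OF assms(2)] y] by metis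
qed

text \<open>
  An object \<open>y\<close> is isomorphic to some \<open>fo p\<close>, and the target of a lift of the isomorphism lies over
  \<open>y\<close> itself.
\<close>

lemma isofibration_surj:
  assumes "isofibration P Q fo fm" "iso_surjective P Q fo" "perm_functor G P a Q b fo fm" "operad P" "operad Q" "y \<in> ob Q"
  obtains x where "x \<in> ob P" "fo x = y"
proof -
  obtain p \<alpha> \<beta> where p: "p \<in> ob P" "mutually_inverse Q (fo p) y \<alpha> \<beta>"
    using assms(2,6) unfolding iso_surjective_def by blast
  then obtain p' \<alpha>' \<beta>' where p': "mutually_inverse P p p' \<alpha>' \<beta>'" "fm \<alpha>' = \<alpha>"
    using assms(1) unfolding isofibration_def by metis
  have "fo p' = y"
    using operad.mutually_inverse_ob[OF assms(5) p(2)] operad.mutually_inverse_ob[OF assms(4) p'(1)]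
      pf_out[OF assms(3), of \<alpha>'] p'(2) by simp
  then show thesis using that operad.mutually_inverse_ob[OF assms(4) p'(1)] by blast
qed

context operad_kind
begin

definition W where "W = {F \<in> Arr cat. operadic_equivalence F}"
definition Fib where "Fib = {F \<in> Arr cat. lifts_isomorphisms F}"
definition Cof where "Cof = {F \<in> Arr cat. injective_on_objects F}"

lemma W_iff:
  assumes F: "F \<in> Hom cat P Q"
  shows "F \<in> W \<longleftrightarrow> iso_surjective P Q (on_ob F) \<and> hom_bijective P Q (on_ob F) (on_mor F)"
proof -
  have Q: "operad Q" using HomD(4)[OF F] by (rule small_operadsD)
  have [simp]: "Ob (underlying_category R) = ob R" for R :: "('u, 'u, 'z) operad_scheme"
    by (simp add: underlying_category_def)
  have "essentially_surjective (underlying_category P) (underlying_category Q) (on_ob F) \<longleftrightarrow>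
      (\<forall>y\<in>ob Q. \<exists>x\<in>ob P. \<exists>\<alpha>. operad_iso Q \<alpha> (on_ob F x) y)"
    unfolding essentially_surjective_def by (simp add: Bex_def)
  also have "\<dots> \<longleftrightarrow> iso_surjective P Q (on_ob F)" unfolding operad_iso_iff[OF Q] iso_surjective_def ..
  finally show ?thesis
    using F by (auto simp: W_def operadic_equivalence_def fully_faithful_def hom_bijective_def Hom_iff Arr_iff)
qed

lemma Fib_iff:
  assumes F: "F \<in> Hom cat P Q"
  shows "F \<in> Fib \<longleftrightarrow> isofibration P Q (on_ob F) (on_mor F)"
proof -
  have o: "operad P" "operad Q" using HomD(3,4)[OF F] by (auto intro: small_operadsD)
  have "lifts_isomorphisms F \<longleftrightarrow> isofibration P Q (on_ob F) (on_mor F)"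
    unfolding lifts_isomorphisms_def isofibration_def HomD(1)[OF F] HomD(2)[OF F]
      operad_iso_iff[OF o(1)] operad_iso_iff[OF o(2)] by blast
  then show ?thesis using HomD(6)[OF F] by (simp add: Fib_def)
qed

lemma Cof_iff: "F \<in> Hom cat P Q \<Longrightarrow> F \<in> Cof \<longleftrightarrow> inj_on (on_ob F) (ob P)"
  using HomD(1,6) by (auto simp: Cof_def injective_on_objects_def)

lemma two_out_of_three_W: "two_out_of_three cat W"
  unfolding two_out_of_three_def
proof (intro ballI impI)
  fix F H assume FH: "F \<in> Arr cat" "H \<in> Arr cat" "Cod cat F = Dom cat H"
  define P Q R where "P = source F" and "Q = target F" and "R = target H"
  have F: "F \<in> Hom cat P Q" and H: "H \<in> Hom cat Q R"
    using FH by (auto simp: Hom_def P_def Q_def R_def)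
  note K = Comp_in_Hom[OF F H]
  have g: "is_operad P" "is_operad Q" "is_operad R" and o: "operad P" "operad Q" "operad R"
    using F H by (auto simp: Hom_iff intro: small_operadsD)
  note pF = HomD(5)[OF F] and pH = HomD(5)[OF H]
  let ?o = "on_ob H \<circ> on_ob F" and ?m = "on_mor H \<circ> on_mor F"
  have W: "F \<in> W \<longleftrightarrow> iso_surjective P Q (on_ob F) \<and> hom_bijective P Q (on_ob F) (on_mor F)"
    "H \<in> W \<longleftrightarrow> iso_surjective Q R (on_ob H) \<and> hom_bijective Q R (on_ob H) (on_mor H)"
    by (rule W_iff[OF F], rule W_iff[OF H])
  have "iso_surjective P R (on_ob (Comp cat H F)) \<longleftrightarrow> iso_surjective P R ?o"
    by (rule iso_surjective_cong) (simp add: P_def)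
  moreover have "hom_bijective P R (on_ob (Comp cat H F)) (on_mor (Comp cat H F)) \<longleftrightarrow> hom_bijective P R ?o ?m"
    by (rule hom_bijective_cong[OF o(1)]) (simp_all add: P_def)
  ultimately have WK: "Comp cat H F \<in> W \<longleftrightarrow> iso_surjective P R ?o \<and> hom_bijective P R ?o ?m" by (simp add: W_iff[OF K])
  show "(F \<in> W \<and> H \<in> W \<longrightarrow> Comp cat H F \<in> W) \<and>
      (F \<in> W \<and> Comp cat H F \<in> W \<longrightarrow> H \<in> W) \<and> (H \<in> W \<and> Comp cat H F \<in> W \<longrightarrow> F \<in> W)"
    unfolding W WK
    using iso_surjective_compose[OF _ _ pH o(2,3)] hom_bijective_compose[OF _ _ pF] iso_surjective_cancel_right[OF _ pF]
      hom_bijective_cancel_right[OF g pF pH] iso_surjective_cancel_left[OF _ pF pH _ o(2)] hom_bijective_cancel_left[OF pF o(1) _ o(2)]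
    by blast
qed

text \<open>
  The diagram of a retract, evaluated on objects and morphisms.
\<close>

lemma retract_elements:
  assumes "retract_of cat F H"
  obtains A B X Y i r j s where "F \<in> Hom cat A B" "H \<in> Hom cat X Y"
    "i \<in> Hom cat A X" "r \<in> Hom cat X A" "j \<in> Hom cat B Y" "s \<in> Hom cat Y B"
    "\<forall>a\<in>ob A. on_ob r (on_ob i a) = a" "\<forall>f\<in>mor A. on_mor r (on_mor i f) = f"
    "\<forall>b\<in>ob B. on_ob s (on_ob j b) = b" "\<forall>f\<in>mor B. on_mor s (on_mor j f) = f"
    "\<forall>a\<in>ob A. on_ob H (on_ob i a) = on_ob j (on_ob F a)"
    "\<forall>f\<in>mor A. on_mor H (on_mor i f) = on_mor j (on_mor F f)"
    "\<forall>x\<in>ob X. on_ob F (on_ob r x) = on_ob s (on_ob H x)"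
    "\<forall>f\<in>mor X. on_mor F (on_mor r f) = on_mor s (on_mor H f)"
proof -
  define A B X Y where "A = source F" and "B = target F" and "X = source H" and "Y = target H"
  obtain i r j s where i: "i \<in> Hom cat A X" and r: "r \<in> Hom cat X A" and j: "j \<in> Hom cat B Y"
    and s: "s \<in> Hom cat Y B" and e: "Comp cat r i = Id cat A" "Comp cat s j = Id cat B"
      "Comp cat H i = Comp cat j F" "Comp cat F r = Comp cat s H"
    and F: "F \<in> Hom cat A B" and H: "H \<in> Hom cat X Y"
    using assms by (auto simp: retract_of_def A_def B_def X_def Y_def Arr_iff)
  have src: "source i = A" "source r = X" "source j = B" "source s = Y" "source F = A" "source H = X"
    using HomD(1) i r j s F H by auto
  have eo: "on_ob (Comp cat r i) = on_ob (Id cat A)" "on_ob (Comp cat s j) = on_ob (Id cat B)"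
      "on_ob (Comp cat H i) = on_ob (Comp cat j F)" "on_ob (Comp cat F r) = on_ob (Comp cat s H)"
    and em: "on_mor (Comp cat r i) = on_mor (Id cat A)" "on_mor (Comp cat s j) = on_mor (Id cat B)"
      "on_mor (Comp cat H i) = on_mor (Comp cat j F)" "on_mor (Comp cat F r) = on_mor (Comp cat s H)"
    using e by simp_all
  have "\<forall>a\<in>ob A. on_ob r (on_ob i a) = a" "\<forall>f\<in>mor A. on_mor r (on_mor i f) = f"
    using fun_cong[OF eo(1)] fun_cong[OF em(1)] src by (metis Comp_on Id_on)+
  moreover have "\<forall>b\<in>ob B. on_ob s (on_ob j b) = b" "\<forall>f\<in>mor B. on_mor s (on_mor j f) = f"
    using fun_cong[OF eo(2)] fun_cong[OF em(2)] src by (metis Comp_on Id_on)+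
  moreover have "\<forall>a\<in>ob A. on_ob H (on_ob i a) = on_ob j (on_ob F a)"
    "\<forall>f\<in>mor A. on_mor H (on_mor i f) = on_mor j (on_mor F f)"
    using fun_cong[OF eo(3)] fun_cong[OF em(3)] src by (metis Comp_on)+
  moreover have "\<forall>x\<in>ob X. on_ob F (on_ob r x) = on_ob s (on_ob H x)"
    "\<forall>f\<in>mor X. on_mor F (on_mor r f) = on_mor s (on_mor H f)"
    using fun_cong[OF eo(4)] fun_cong[OF em(4)] src by (metis Comp_on)+
  ultimately show thesis by (rule that[OF F H i r j s])
qed

lemma retracts_W: "closed_under_retracts cat W"
  unfolding closed_under_retracts_def
proof (intro allI impI)
  fix F H assume "H \<in> W \<and> retract_of cat F H"
  then have HW: "H \<in> W" and retract: "retract_of cat F H" by auto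
  obtain A B X Y i r j s where F: "F \<in> Hom cat A B" and H: "H \<in> Hom cat X Y"
    and i: "i \<in> Hom cat A X" and r: "r \<in> Hom cat X A" and j: "j \<in> Hom cat B Y" and s: "s \<in> Hom cat Y B"
    and eo: "\<forall>a\<in>ob A. on_ob r (on_ob i a) = a" and em: "\<forall>f\<in>mor A. on_mor r (on_mor i f) = f"
    and eo': "\<forall>b\<in>ob B. on_ob s (on_ob j b) = b" and em': "\<forall>f\<in>mor B. on_mor s (on_mor j f) = f"
    and so: "\<forall>a\<in>ob A. on_ob H (on_ob i a) = on_ob j (on_ob F a)"
    and sm: "\<forall>f\<in>mor A. on_mor H (on_mor i f) = on_mor j (on_mor F f)"
    and to: "\<forall>x\<in>ob X. on_ob F (on_ob r x) = on_ob s (on_ob H x)"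
    and tm: "\<forall>f\<in>mor X. on_mor F (on_mor r f) = on_mor s (on_mor H f)"
    by (rule retract_elements[OF retract])
  have o: "operad A" "operad B" "operad X" "operad Y" using F H by (auto simp: Hom_iff intro: small_operadsD)
  have es: "iso_surjective X Y (on_ob H)" and ff: "hom_bijective X Y (on_ob H) (on_mor H)" using HW W_iff[OF H] by auto
  have "iso_surjective A B (on_ob F)"
    unfolding iso_surjective_def
  proof
    fix y assume y: "y \<in> ob B"
    then have "on_ob j y \<in> ob Y" by (rule pf_mems[OF j])
    then obtain x \<alpha> \<beta> where x: "x \<in> ob X" "mutually_inverse Y (on_ob H x) (on_ob j y) \<alpha> \<beta>"
      using es unfolding iso_surjective_def by blast
    from perm_functor_inverse[OF HomD(5)[OF s] x(2) o(4)]
    have "mutually_inverse B (on_ob F (on_ob r x)) y (on_mor s \<alpha>) (on_mor s \<beta>)"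
      using to x(1) eo' y by simp
    then show "\<exists>x\<in>ob A. \<exists>\<alpha> \<beta>. mutually_inverse B (on_ob F x) y \<alpha> \<beta>"
      using pf_mems(1)[OF r x(1)] by blast
  qed
  moreover have "hom_bijective A B (on_ob F) (on_mor F)"
  proof (rule hom_bijectiveI[OF HomD(5)[OF F]])
    fix f g assume fg: "f \<in> mor A" "g \<in> mor A" "ins A f = ins A g" "out A f = out A g" "on_mor F f = on_mor F g"
    have "on_mor i f = on_mor i g"
      by (rule hom_bijective_inj[OF ff o(3)])
        (use fg sm pf_mor[OF HomD(5)[OF i]] pf_ins[OF HomD(5)[OF i]] pf_out[OF HomD(5)[OF i]]
          in \<open>auto\<close>)
    then show "f = g" using em fg by metis
  next
    fix b ps p assume p: "set ps \<subseteq> ob A" "p \<in> ob A" and b: "b \<in> ophom B (map (on_ob F) ps) (on_ob F p)"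
    have b': "b \<in> mor B" using b by (simp add: ophom_iff)
    have ip: "set (map (on_ob i) ps) \<subseteq> ob X" "on_ob i p \<in> ob X" using p pf_mems(1)[OF i] by auto
    have "map (on_ob j) (map (on_ob F) ps) = map (on_ob H) (map (on_ob i) ps)" using so p by auto
    then have "on_mor j b \<in> ophom Y (map (on_ob H) (map (on_ob i) ps)) (on_ob H (on_ob i p))"
      using pf_hom[OF HomD(5)[OF j] b'] b so p(2) by (simp add: ophom_iff)
    then obtain c where c: "c \<in> ophom X (map (on_ob i) ps) (on_ob i p)" "on_mor H c = on_mor j b"
      using hom_bijective_surj[OF ff ip] by blast
    have "map (on_ob r) (map (on_ob i) ps) = ps" using eo p(1) by (auto intro!: map_idI)
    then have "on_mor r c \<in> ophom A ps p"
      using pf_hom[OF HomD(5)[OF r], of c] c eo p(2) by (simp add: ophom_iff del: map_map)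
    moreover have "on_mor F (on_mor r c) = b" using tm c em' b' by (simp add: ophom_iff)
    ultimately show "\<exists>g\<in>ophom A ps p. on_mor F g = b" by blast
  qed
  ultimately show "F \<in> W" by (simp add: W_iff[OF F])
qed

lemma retracts_Fib: "closed_under_retracts cat Fib"
  unfolding closed_under_retracts_def
proof (intro allI impI)
  fix F H assume "H \<in> Fib \<and> retract_of cat F H"
  then have HW: "H \<in> Fib" and retract: "retract_of cat F H" by auto
  obtain A B X Y i r j s where F: "F \<in> Hom cat A B" and H: "H \<in> Hom cat X Y"
    and i: "i \<in> Hom cat A X" and r: "r \<in> Hom cat X A" and j: "j \<in> Hom cat B Y" and s: "s \<in> Hom cat Y B"
    and eo: "\<forall>a\<in>ob A. on_ob r (on_ob i a) = a" and em: "\<forall>f\<in>mor A. on_mor r (on_mor i f) = f"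
    and eo': "\<forall>b\<in>ob B. on_ob s (on_ob j b) = b" and em': "\<forall>f\<in>mor B. on_mor s (on_mor j f) = f"
    and so: "\<forall>a\<in>ob A. on_ob H (on_ob i a) = on_ob j (on_ob F a)"
    and sm: "\<forall>f\<in>mor A. on_mor H (on_mor i f) = on_mor j (on_mor F f)"
    and to: "\<forall>x\<in>ob X. on_ob F (on_ob r x) = on_ob s (on_ob H x)"
    and tm: "\<forall>f\<in>mor X. on_mor F (on_mor r f) = on_mor s (on_mor H f)"
    by (rule retract_elements[OF retract])
  have o: "operad A" "operad B" "operad X" "operad Y" using F H by (auto simp: Hom_iff intro: small_operadsD)
  have fib: "isofibration X Y (on_ob H) (on_mor H)" using HW Fib_iff[OF H] by simp
  have "isofibration A B (on_ob F) (on_mor F)"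
    unfolding isofibration_def
  proof (intro ballI allI impI)
    fix p q \<alpha> \<beta> assume p: "p \<in> ob A" and m: "mutually_inverse B (on_ob F p) q \<alpha> \<beta>"
    have "mutually_inverse Y (on_ob H (on_ob i p)) (on_ob j q) (on_mor j \<alpha>) (on_mor j \<beta>)"
      using perm_functor_inverse[OF HomD(5)[OF j] m o(2)] so p by simp
    then obtain p' \<alpha>' \<beta>' where m': "mutually_inverse X (on_ob i p) p' \<alpha>' \<beta>'" "on_mor H \<alpha>' = on_mor j \<alpha>"
      using fib pf_mems(1)[OF i p] unfolding isofibration_def by blast
    have "mutually_inverse A p (on_ob r p') (on_mor r \<alpha>') (on_mor r \<beta>')"
      using perm_functor_inverse[OF HomD(5)[OF r] m'(1) o(3)] eo p by simp
    moreover have "on_mor F (on_mor r \<alpha>') = \<alpha>"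
      using tm m' em' operad.mutually_inverse_ob[OF o(3) m'(1)] operad.mutually_inverse_ob[OF o(2) m] by simp
    ultimately show "\<exists>p' \<alpha>' \<beta>'. mutually_inverse A p p' \<alpha>' \<beta>' \<and> on_mor F \<alpha>' = \<alpha>" by blast
  qed
  then show "F \<in> Fib" by (simp add: Fib_iff[OF F])
qed

lemma retracts_Cof: "closed_under_retracts cat Cof"
  unfolding closed_under_retracts_def
proof (intro allI impI)
  fix F H assume "H \<in> Cof \<and> retract_of cat F H"
  then have HW: "H \<in> Cof" and retract: "retract_of cat F H" by auto
  obtain A B X Y i r j s where F: "F \<in> Hom cat A B" and H: "H \<in> Hom cat X Y"
    and i: "i \<in> Hom cat A X" and r: "r \<in> Hom cat X A" and j: "j \<in> Hom cat B Y" and s: "s \<in> Hom cat Y B"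
    and eo: "\<forall>a\<in>ob A. on_ob r (on_ob i a) = a" and em: "\<forall>f\<in>mor A. on_mor r (on_mor i f) = f"
    and eo': "\<forall>b\<in>ob B. on_ob s (on_ob j b) = b" and em': "\<forall>f\<in>mor B. on_mor s (on_mor j f) = f"
    and so: "\<forall>a\<in>ob A. on_ob H (on_ob i a) = on_ob j (on_ob F a)"
    and sm: "\<forall>f\<in>mor A. on_mor H (on_mor i f) = on_mor j (on_mor F f)"
    and to: "\<forall>x\<in>ob X. on_ob F (on_ob r x) = on_ob s (on_ob H x)"
    and tm: "\<forall>f\<in>mor X. on_mor F (on_mor r f) = on_mor s (on_mor H f)"
    by (rule retract_elements[OF retract])
  have "inj_on (on_ob H) (ob X)" using HW Cof_iff[OF H] by simp
  then have "inj_on (on_ob F) (ob A)"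
    using pf_mems(1)[OF i] eo so by (intro inj_onI) (metis inj_onD)
  then show "F \<in> Cof" by (simp add: Cof_iff[OF F])
qed

text \<open>
  The object map of the lift is forced on the image of \<open>i\<close>, consistently since \<open>i\<close> is injective on
  objects, and arbitrary in the fibres of \<open>p\<close> elsewhere.
\<close>

lemma lift_against_trivial_fibration:
  assumes i: "i \<in> Hom cat A B" and p: "p \<in> Hom cat X Y" and iC: "i \<in> Cof" and pF: "p \<in> Fib" "p \<in> W"
    and u: "u \<in> Hom cat A X" and v: "v \<in> Hom cat B Y" and sq: "Comp cat p u = Comp cat v i"
  shows "\<exists>h\<in>Hom cat B X. Comp cat h i = u \<and> Comp cat p h = v"
proof -
  have o: "operad A" "operad B" "operad X" "operad Y" and g: "is_operad A" "is_operad B" "is_operad X" "is_operad Y"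
    and ob: "A \<in> small_operads" "B \<in> small_operads" "X \<in> small_operads" "Y \<in> small_operads"
    using i p by (auto simp: Hom_iff intro: small_operadsD)
  have src: "source i = A" "source p = X" "source u = A" "source v = B" using HomD(1) i p u v by auto
  have inj: "inj_on (on_ob i) (ob A)" using iC Cof_iff[OF i] by simp
  have fib: "isofibration X Y (on_ob p) (on_mor p)" and es: "iso_surjective X Y (on_ob p)" and ff: "hom_bijective X Y (on_ob p) (on_mor p)"
    using pF Fib_iff[OF p] W_iff[OF p] by auto
  have sqo: "on_ob p (on_ob u a) = on_ob v (on_ob i a)" if "a \<in> ob A" for a
    using arg_cong[OF sq, of "\<lambda>F. on_ob F a"] that src by simp
  have sqm: "on_mor p (on_mor u f) = on_mor v (on_mor i f)" if "f \<in> mor A" for f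
    using arg_cong[OF sq, of "\<lambda>F. on_mor F f"] that src by simp
  have "\<exists>x\<in>ob X. on_ob p x = on_ob v b \<and> (\<forall>a\<in>ob A. b = on_ob i a \<longrightarrow> x = on_ob u a)" if b: "b \<in> ob B" for b
  proof (cases "b \<in> on_ob i ` ob A")
    case True
    then obtain a where a: "a \<in> ob A" "b = on_ob i a" by blast
    then show ?thesis using inj sqo[OF a(1)] pf_mems(1)[OF u a(1)]
      by (intro bexI[of _ "on_ob u a"]) (auto dest: inj_onD)
  next
    case False
    obtain x where "x \<in> ob X" "on_ob p x = on_ob v b"
      using isofibration_surj[OF fib es HomD(5)[OF p] o(3,4) pf_mems(1)[OF v b]] by blast
    then show ?thesis using False by blast
  qed
  then obtain ho where ho: "\<And>b. b \<in> ob B \<Longrightarrow> ho b \<in> ob X" "\<And>b. b \<in> ob B \<Longrightarrow> on_ob p (ho b) = on_ob v b"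
    and hoi: "\<And>a. a \<in> ob A \<Longrightarrow> ho (on_ob i a) = on_ob u a"
    using pf_mems(1)[OF i] by metis
  obtain hm where hm: "is_functor B X ho hm" "\<forall>f\<in>mor B. on_mor p (hm f) = on_mor v f"
    by (rule hom_bijective_lift[OF g(3,4,2) HomD(5)[OF p] ff HomD(5)[OF v] ho])
  let ?h = "arrow B X ho hm"
  have h: "?h \<in> Hom cat B X" by (rule arrow_Hom[OF ob(2,3) hm(1)])
  have "Comp cat ?h i = u"
  proof (rule Hom_eqI[OF Comp_in_Hom[OF i h] u])
    show "on_ob (Comp cat ?h i) a = on_ob u a" if "a \<in> ob A" for a
      using that src hoi pf_mems(1)[OF i that] by simp
    show "on_mor (Comp cat ?h i) f = on_mor u f" if f: "f \<in> mor A" for f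
    proof -
      note fi = pf_hom[OF HomD(5)[OF i] f] pf_hom[OF HomD(5)[OF u] f]
      have fi': "on_mor i f \<in> mor B" using fi by (simp add: ophom_iff)
      have e: "map ho (map (on_ob i) (ins A f)) = map (on_ob u) (ins A f)"
        using hoi operad.ins_ob[OF o(1) f] by auto
      have "hm (on_mor i f) = on_mor u f"
        by (rule hom_bijective_inj[OF ff o(3)])
          (use e fi pf_hom[OF hm(1) fi'] bspec[OF hm(2) fi'] sqm[OF f] hoi[OF operad.out_ob[OF o(1) f]]
            in \<open>auto simp: ophom_iff\<close>)
      then show ?thesis using f fi' src by simp
    qed
  qed
  moreover have "Comp cat p ?h = v"
    using ho hm(2) by (intro Hom_eqI[OF Comp_in_Hom[OF h p] v]) auto
  ultimately show ?thesis using h by blast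
qed

text \<open>
  The isomorphisms \<open>\<theta> b : i (a b) \<rightarrow> b\<close> are identities for \<open>b\<close> in the image of \<open>i\<close>; conjugation with
  their inverses yields a functor \<open>B \<rightarrow> B\<close> landing in the image of \<open>i\<close>, hence a retraction \<open>r\<close> of \<open>i\<close>.
  The functor \<open>u r : B \<rightarrow> X\<close> extends \<open>u\<close>, but lies over \<open>v\<close> only up to the isomorphisms \<open>v \<theta>\<close>. Since
  \<open>p\<close> is a fibration, these lift to isomorphisms \<open>\<phi>\<close> starting at \<open>u (a b)\<close>, and conjugating \<open>u r\<close>
  with \<open>\<phi>\<close> produces a functor that lies over \<open>v\<close> strictly. Taking \<open>\<phi>\<close> to be the identity on the image
  of \<open>i\<close> keeps the extension property.
\<close>

lemma lift_trivial_cofibration: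
  assumes i: "i \<in> Hom cat A B" and p: "p \<in> Hom cat X Y" and iC: "i \<in> Cof" "i \<in> W" and pF: "p \<in> Fib"
    and u: "u \<in> Hom cat A X" and v: "v \<in> Hom cat B Y" and sq: "Comp cat p u = Comp cat v i"
  shows "\<exists>h\<in>Hom cat B X. Comp cat h i = u \<and> Comp cat p h = v"
proof -
  have o: "operad A" "operad B" "operad X" "operad Y" and g: "is_operad A" "is_operad B" "is_operad X" "is_operad Y"
    and ob: "A \<in> small_operads" "B \<in> small_operads" "X \<in> small_operads" "Y \<in> small_operads"
    using i p by (auto simp: Hom_iff intro: small_operadsD)
  interpret A: perm_operad G A "act_of A" by (rule g)
  interpret B: perm_operad G B "act_of B" by (rule g)
  interpret X: perm_operad G X "act_of X" by (rule g)
  interpret Y: perm_operad G Y "act_of Y" by (rule g)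
  have src: "source i = A" "source p = X" "source u = A" "source v = B" using HomD(1) i p u v by auto
  note pi = HomD(5)[OF i] and pp = HomD(5)[OF p] and pu = HomD(5)[OF u] and pv = HomD(5)[OF v]
  have inj: "inj_on (on_ob i) (ob A)" using iC Cof_iff[OF i] by simp
  have fib: "isofibration X Y (on_ob p) (on_mor p)" using pF Fib_iff[OF p] by auto
  have es: "iso_surjective A B (on_ob i)" and ff: "hom_bijective A B (on_ob i) (on_mor i)" using iC W_iff[OF i] by auto
  have sqo: "on_ob p (on_ob u a) = on_ob v (on_ob i a)" if "a \<in> ob A" for a
    using arg_cong[OF sq, of "\<lambda>F. on_ob F a"] that src by simp
  have sqm: "on_mor p (on_mor u f) = on_mor v (on_mor i f)" if "f \<in> mor A" for f
    using arg_cong[OF sq, of "\<lambda>F. on_mor F f"] that src by simp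
  \<comment> \<open>On the image of \<open>i\<close>, where \<open>a\<close> is forced, identities are chosen.\<close>
  have "\<exists>a \<theta> \<theta>'. a \<in> ob A \<and> mutually_inverse B (on_ob i a) b \<theta> \<theta>' \<and>
      (\<forall>a'\<in>ob A. b = on_ob i a' \<longrightarrow> a = a' \<and> \<theta> = opid B b \<and> \<theta>' = opid B b)" if b: "b \<in> ob B" for b
  proof (cases "b \<in> on_ob i ` ob A")
    case True
    then obtain a where a: "a \<in> ob A" "b = on_ob i a" by blast
    have "\<forall>a'\<in>ob A. b = on_ob i a' \<longrightarrow> a = a'" using inj_onD[OF inj, of a] a by metis
    moreover have "mutually_inverse B (on_ob i a) b (opid B b) (opid B b)"
      using a(2) B.mutually_inverse_opid[OF b] by simp
    ultimately show ?thesis using a(1) by (intro exI[of _ a] exI[of _ "opid B b"]) simp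
  next
    case False
    then show ?thesis using es b unfolding iso_surjective_def by blast
  qed
  then obtain a \<theta> \<theta>' where choice: "\<And>b. b \<in> ob B \<Longrightarrow> a b \<in> ob A \<and>
      mutually_inverse B (on_ob i (a b)) b (\<theta> b) (\<theta>' b) \<and>
      (\<forall>a'\<in>ob A. b = on_ob i a' \<longrightarrow> a b = a' \<and> \<theta> b = opid B b \<and> \<theta>' b = opid B b)"
    by metis
  then have a: "\<And>b. b \<in> ob B \<Longrightarrow> a b \<in> ob A"
    and \<theta>: "\<And>b. b \<in> ob B \<Longrightarrow> mutually_inverse B (on_ob i (a b)) b (\<theta> b) (\<theta>' b)"
    by blast+
  have ai: "a (on_ob i x) = x" and \<theta>i: "\<theta> (on_ob i x) = opid B (on_ob i x)" "\<theta>' (on_ob i x) = opid B (on_ob i x)"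
    if "x \<in> ob A" for x
    using choice[OF pf_mems(1)[OF i that]] that by blast+
  have Th: "iso_family G B (act_of B) (ob B) (\<lambda>b. on_ob i (a b)) (\<lambda>b. b) \<theta> \<theta>'"
    by unfold_locales (rule \<theta>)
  interpret Th: iso_family G B "act_of B" "ob B" "\<lambda>b. on_ob i (a b)" "\<lambda>b. b" \<theta> \<theta>' by (rule Th)
  note Th' = Th.iso_family_inverse
  interpret Th': iso_family G B "act_of B" "ob B" "\<lambda>b. b" "\<lambda>b. on_ob i (a b)" \<theta>' \<theta> by (rule Th')
  define rB where "rB f = conjugate B \<theta>' \<theta> (ins B f) (out B f) f" for f
  have rB: "is_functor B B (\<lambda>b. on_ob i (a b)) rB"
    using perm_functor_transport[OF g(2) perm_functor_id Th'] by (simp add: rB_def[abs_def])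
  obtain rm where rm: "is_functor B A a rm" and irm': "\<forall>f\<in>mor B. on_mor i (rm f) = rB f"
    by (rule hom_bijective_lift[OF g(1,2,2) pi ff rB a refl])
  note irm = bspec[OF irm']
  have rmi: "rm (on_mor i f) = f" if f: "f \<in> mor A" for f
  proof -
    have fi: "on_mor i f \<in> ophom B (map (\<lambda>b. b) (map (on_ob i) (ins A f))) (on_ob i (out A f))"
      using pf_hom[OF pi f] by simp
    have fm: "on_mor i f \<in> mor B" using fi by (simp add: ophom_iff)
    have io: "set (map (on_ob i) (ins A f)) \<subseteq> ob B" "on_ob i (out A f) \<in> ob B"
      using pf_mems(1)[OF i] A.ins_ob[OF f] A.out_ob[OF f] by auto
    have e1: "rB (on_mor i f) = on_mor i f"
      unfolding rB_def pf_ins[OF pi f] pf_out[OF pi f]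
      using \<theta>i A.ins_ob[OF f] A.out_ob[OF f] by (intro Th'.conjugate_identities[OF fi io(2,1)]) auto
    have e2: "map a (map (on_ob i) (ins A f)) = ins A f"
      using ai A.ins_ob[OF f] by (auto intro!: map_idI)
    show ?thesis
      by (rule hom_bijective_inj[OF ff o(1)])
        (use e1 e2 pf_hom[OF rm fm] irm[OF fm] f pf_ins[OF pi f] pf_out[OF pi f] ai[OF A.out_ob[OF f]]
          in \<open>auto simp: ophom_iff\<close>)
  qed
  have ua: "on_ob u (a b) \<in> ob X" if "b \<in> ob B" for b using pf_mems(1)[OF u a[OF that]] .
  have vth: "mutually_inverse Y (on_ob p (on_ob u (a b))) (on_ob v b) (on_mor v (\<theta> b)) (on_mor v (\<theta>' b))"
    if b: "b \<in> ob B" for b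
    using perm_functor_inverse[OF pv \<theta>[OF b] o(2)] sqo[OF a[OF b]] by simp
  have "\<exists>x \<phi> \<phi>'. mutually_inverse X (on_ob u (a b)) x \<phi> \<phi>' \<and> on_mor p \<phi> = on_mor v (\<theta> b) \<and>
      (b \<in> on_ob i ` ob A \<longrightarrow> \<phi> = opid X (on_ob u (a b)))" if b: "b \<in> ob B" for b
  proof (cases "b \<in> on_ob i ` ob A")
    case True
    then obtain a0 where a0: "a0 \<in> ob A" "b = on_ob i a0" by blast
    have "on_mor p (opid X (on_ob u (a b))) = on_mor v (\<theta> b)"
      using pf_opid[OF pp ua[OF b]] pf_opid[OF pv b] \<theta>i(1)[OF a0(1)] sqo[OF a[OF b]] ai[OF a0(1)] a0(2) by simp
    then show ?thesis using X.mutually_inverse_opid[OF ua[OF b]] by blast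
  next
    case False
    then show ?thesis using fib ua[OF b] vth[OF b] unfolding isofibration_def by blast
  qed
  then obtain x \<phi> \<phi>' where \<phi>: "\<And>b. b \<in> ob B \<Longrightarrow> mutually_inverse X (on_ob u (a b)) (x b) (\<phi> b) (\<phi>' b)"
    and p\<phi>: "\<And>b. b \<in> ob B \<Longrightarrow> on_mor p (\<phi> b) = on_mor v (\<theta> b)"
    and \<phi>i: "\<And>b. b \<in> ob B \<Longrightarrow> b \<in> on_ob i ` ob A \<Longrightarrow> \<phi> b = opid X (on_ob u (a b))"
    by metis
  have Ph: "iso_family G X (act_of X) (ob B) (\<lambda>b. on_ob u (a b)) x \<phi> \<phi>'"
    by unfold_locales (rule \<phi>)
  interpret Ph: iso_family G X "act_of X" "ob B" "\<lambda>b. on_ob u (a b)" x \<phi> \<phi>' by (rule Ph)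
  have px: "on_ob p (x b) = on_ob v b" if b: "b \<in> ob B" for b
    using pf_out[OF pp Ph.family_hom(1)[OF b]] Ph.family_hom(3)[OF b] p\<phi>[OF b]
      Y.mutually_inverse_ob(6)[OF vth[OF b]] by simp
  \<comment> \<open>Inverses are unique, so the inverse of \<open>\<phi> b\<close> lies over the inverse of \<open>v (\<theta> b)\<close> as well.\<close>
  have p\<phi>': "on_mor p (\<phi>' b) = on_mor v (\<theta>' b)" if b: "b \<in> ob B" for b
    using Y.mutually_inverse_unique[OF _ vth[OF b]] perm_functor_inverse[OF pp \<phi>[OF b] o(3)] p\<phi>[OF b] px[OF b]
    by simp
  define hm where "hm f = conjugate X \<phi> \<phi>' (ins B f) (out B f) (on_mor u (rm f))" for f
  have ur: "is_functor B X (\<lambda>b. on_ob u (a b)) (\<lambda>f. on_mor u (rm f))"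
    using perm_functor_compose[OF rm pu] by (simp add: comp_def)
  have hm: "is_functor B X x hm"
    using perm_functor_transport[OF g(2) ur Ph] by (simp add: hm_def[abs_def])
  let ?h = "arrow B X x hm"
  have h: "?h \<in> Hom cat B X" by (rule arrow_Hom[OF ob(2,3) hm])
  have "Comp cat ?h i = u"
  proof (rule Hom_eqI[OF Comp_in_Hom[OF i h] u])
    show "on_ob (Comp cat ?h i) c = on_ob u c" if c: "c \<in> ob A" for c
    proof -
      have ic: "on_ob i c \<in> ob B" by (rule pf_mems(1)[OF i c])
      have "x (on_ob i c) = on_ob u (a (on_ob i c))"
        using Ph.family_hom(3)[OF ic] \<phi>i[OF ic] X.opid_hom'(3)[OF ua[OF ic]] c by simp
      then show ?thesis using c ic ai src by simp
    qed
    show "on_mor (Comp cat ?h i) f = on_mor u f" if f: "f \<in> mor A" for f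
    proof -
      have io: "set (map (on_ob i) (ins A f)) \<subseteq> ob B" "on_ob i (out A f) \<in> ob B"
        using pf_mems(1)[OF i] A.ins_ob[OF f] A.out_ob[OF f] by auto
      have e: "map (\<lambda>b. on_ob u (a b)) (map (on_ob i) (ins A f)) = map (on_ob u) (ins A f)"
        using ai A.ins_ob[OF f] by auto
      have fi: "on_mor u f \<in> ophom X (map (\<lambda>b. on_ob u (a b)) (map (on_ob i) (ins A f))) (on_ob u (a (on_ob i (out A f))))"
        unfolding e ai[OF A.out_ob[OF f]] by (rule pf_hom[OF pu f])
      have "hm (on_mor i f) = on_mor u f"
        unfolding hm_def pf_ins[OF pi f] pf_out[OF pi f] rmi[OF f]
        using \<phi>i io A.ins_ob[OF f] A.out_ob[OF f] by (intro Ph.conjugate_identities[OF fi io(2,1)]) auto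
      then show ?thesis using f src pf_mems(2)[OF i f] by simp
    qed
  qed
  moreover have "Comp cat p ?h = v"
  proof (rule Hom_eqI[OF Comp_in_Hom[OF h p] v])
    show "on_ob (Comp cat p ?h) b = on_ob v b" if "b \<in> ob B" for b
      using that px by simp
    show "on_mor (Comp cat p ?h) f = on_mor v f" if f: "f \<in> mor B" for f
    proof -
      have io: "out B f \<in> ob B" "set (ins B f) \<subseteq> ob B" using B.ins_ob[OF f] B.out_ob[OF f] by auto
      have f1: "f \<in> ophom B (map (\<lambda>b. b) (ins B f)) (out B f)" using f by (simp add: ophom_iff)
      have f2: "rB f \<in> ophom B (map (\<lambda>b. on_ob i (a b)) (ins B f)) (on_ob i (a (out B f)))"
        by (rule pf_hom[OF rB f])
      have rf: "rm f \<in> mor A" by (rule pf_mor[OF rm f])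
      have "on_mor p (hm f) = conjugate Y (\<lambda>b. on_mor p (\<phi> b)) (\<lambda>b. on_mor p (\<phi>' b)) (ins B f) (out B f)
          (on_mor p (on_mor u (rm f)))"
        unfolding hm_def by (rule perm_functor_conjugate[OF pp Ph pf_hom[OF ur f] io])
      also have "on_mor p (on_mor u (rm f)) = on_mor v (rB f)" using sqm[OF rf] irm[OF f] by simp
      also have "conjugate Y (\<lambda>b. on_mor p (\<phi> b)) (\<lambda>b. on_mor p (\<phi>' b)) (ins B f) (out B f) (on_mor v (rB f)) =
          conjugate Y (\<lambda>b. on_mor v (\<theta> b)) (\<lambda>b. on_mor v (\<theta>' b)) (ins B f) (out B f) (on_mor v (rB f))"
        using p\<phi> p\<phi>' io by (intro conjugate_cong) auto
      also have "\<dots> = on_mor v (conjugate B \<theta> \<theta>' (ins B f) (out B f) (rB f))"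
        by (rule perm_functor_conjugate[OF pv Th f2 io, symmetric])
      also have "conjugate B \<theta> \<theta>' (ins B f) (out B f) (rB f) = f"
        unfolding rB_def by (rule Th'.conjugate_inverse[OF f1 io])
      finally show ?thesis using f by simp
    qed
  qed
  ultimately show ?thesis using h by blast
qed

lemma lifting: "i \<in> Cof \<Longrightarrow> p \<in> Fib \<Longrightarrow> i \<in> W \<or> p \<in> W \<Longrightarrow> has_lift cat i p"
proof -
  assume a: "i \<in> Cof" "p \<in> Fib" "i \<in> W \<or> p \<in> W"
  have i: "i \<in> Hom cat (source i) (target i)" and p: "p \<in> Hom cat (source p) (target p)"
    using a by (auto simp: Cof_def Fib_def Arr_iff)
  show ?thesis
    unfolding has_lift_def
  proof (intro ballI impI)
    fix u v assume "u \<in> Hom cat (Dom cat i) (Dom cat p)" "v \<in> Hom cat (Cod cat i) (Cod cat p)"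
      and sq: "Comp cat p u = Comp cat v i"
    then have uv: "u \<in> Hom cat (source i) (source p)" "v \<in> Hom cat (target i) (target p)" by simp_all
    show "\<exists>h\<in>Hom cat (Cod cat i) (Dom cat p). Comp cat h i = u \<and> Comp cat p h = v"
      unfolding cat_simps
    proof (cases "p \<in> W")
      case True
      then show "\<exists>h\<in>Hom cat (target i) (source p). Comp cat h i = u \<and> Comp cat p h = v"
        by (rule lift_against_trivial_fibration[OF i p a(1,2) _ uv sq])
    next
      case False
      then have "i \<in> W" using a(3) by simp
      then show "\<exists>h\<in>Hom cat (target i) (source p). Comp cat h i = u \<and> Comp cat p h = v"
        by (rule lift_trivial_cofibration[OF i p a(1) _ a(2) uv sq])
    qed
  qed
qed

text \<open>
  The middle object has the objects of \<open>P\<close> and of \<open>Q\<close>, and morphisms as in \<open>Q\<close> after applying \<open>F\<close>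
  to the former. The summand \<open>ob Q\<close> makes the second functor surjective on objects, so every
  isomorphism ending at \<open>q\<close> lifts to one ending at the copy of \<open>q\<close>.
\<close>

lemma factor_cofibration_trivial_fibration: "has_factorizations cat Cof (Fib \<inter> W)"
  unfolding has_factorizations_def
proof
  fix F assume "F \<in> Arr cat"
  then obtain P Q where F: "F \<in> Hom cat P Q" using Arr_iff by blast
  have o: "operad P" "operad Q" and g: "is_operad P" "is_operad Q" and ob: "P \<in> small_operads" "Q \<in> small_operads"
    using F by (auto simp: Hom_iff intro: small_operadsD)
  interpret Q: perm_operad G Q "act_of Q" by (rule g)
  define X where "X = ob P <+> ob Q"
  define ev where "ev = case_sum (on_ob F) (\<lambda>q. q)"
  have "is_small X" unfolding X_def using ob small_operadsD by (intro small_Plus) auto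
  moreover have "ev x \<in> ob Q" if "x \<in> X" for x using that pf_mems(1)[OF F] by (auto simp: X_def ev_def)
  ultimately obtain R eo "do" \<pi>o \<pi>m where R: "R \<in> small_operads" "ob R = eo ` X" "\<And>x. x \<in> X \<Longrightarrow> do (eo x) = x"
    and pi: "is_functor R Q \<pi>o \<pi>m" "hom_bijective R Q \<pi>o \<pi>m" and pie: "\<And>x. x \<in> X \<Longrightarrow> \<pi>o (eo x) = ev x"
    using pullback_along_objects[OF ob(2), of X ev] by metis
  have gR: "is_operad R" and oR: "operad R" using R(1) small_operadsD by auto
  have inX: "p \<in> ob P \<Longrightarrow> Inl p \<in> X" "q \<in> ob Q \<Longrightarrow> Inr q \<in> X" for p q by (auto simp: X_def)
  define ho where "ho p = eo (Inl p)" for p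
  have ho: "\<And>p. p \<in> ob P \<Longrightarrow> ho p \<in> ob R" "\<And>p. p \<in> ob P \<Longrightarrow> \<pi>o (ho p) = on_ob F p"
    using inX R pie by (auto simp: ho_def ev_def)
  obtain hm where hm: "is_functor P R ho hm" "\<forall>f\<in>mor P. \<pi>m (hm f) = on_mor F f"
    by (rule hom_bijective_lift[OF gR g(2,1) pi HomD(5)[OF F] ho])
  let ?l = "arrow P R ho hm" and ?r = "arrow R Q \<pi>o \<pi>m"
  have l: "?l \<in> Hom cat P R" by (rule arrow_Hom[OF ob(1) R(1) hm(1)])
  have r: "?r \<in> Hom cat R Q" by (rule arrow_Hom[OF R(1) ob(2) pi(1)])
  have onto: "eo (Inr q) \<in> ob R" "\<pi>o (eo (Inr q)) = q" if "q \<in> ob Q" for q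
    using that inX R pie by (auto simp: ev_def)
  have "inj_on ho (ob P)"
    using R(3) inX by (intro inj_onI) (metis ho_def sum.inject(1))
  then have "inj_on (on_ob ?l) (ob P)" by (simp add: inj_on_def)
  then have lC: "?l \<in> Cof" by (simp add: Cof_iff[OF l])
  have rff: "hom_bijective R Q (on_ob ?r) (on_mor ?r)"
    by (rule hom_bijective_cong[OF oR, THEN iffD2, OF _ _ pi(2)]) simp_all
  have res: "iso_surjective R Q \<pi>o"
    unfolding iso_surjective_def
  proof
    fix q assume q: "q \<in> ob Q"
    then have "mutually_inverse Q (\<pi>o (eo (Inr q))) q (opid Q q) (opid Q q)"
      using Q.mutually_inverse_opid onto(2) by simp
    then show "\<exists>x\<in>ob R. \<exists>\<alpha> \<beta>. mutually_inverse Q (\<pi>o x) q \<alpha> \<beta>" using onto(1)[OF q] by blast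
  qed
  have res': "iso_surjective R Q (on_ob ?r)" by (rule iso_surjective_cong[THEN iffD2, OF _ res]) simp
  have rfib: "isofibration R Q \<pi>o \<pi>m"
    unfolding isofibration_def
  proof (intro ballI allI impI)
    fix e q \<alpha> \<beta> assume e: "e \<in> ob R" and m: "mutually_inverse Q (\<pi>o e) q \<alpha> \<beta>"
    have q: "q \<in> ob Q" using Q.mutually_inverse_ob[OF m] by simp
    have "mutually_inverse Q (\<pi>o e) (\<pi>o (eo (Inr q))) \<alpha> \<beta>" using m onto[OF q] by simp
    then show "\<exists>e' \<alpha>' \<beta>'. mutually_inverse R e e' \<alpha>' \<beta>' \<and> \<pi>m \<alpha>' = \<alpha>"
      using hom_bijective_reflect_inverse[OF pi(1) oR pi(2) e onto(1)[OF q]] by metis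
  qed
  have rfib': "isofibration R Q (on_ob ?r) (on_mor ?r)"
    by (rule isofibration_cong[THEN iffD2, OF _ _ rfib]) simp_all
  have comp: "Comp cat ?r ?l = F"
    using ho hm pf_mor[OF hm(1)] by (intro Hom_eqI[OF Comp_in_Hom[OF l r] F]) auto
  have "?r \<in> Fib \<inter> W" using rff res' rfib' W_iff[OF r] Fib_iff[OF r] by blast
  moreover have "Dom cat ?l = Dom cat F \<and> Cod cat ?l = Dom cat ?r \<and> Cod cat ?r = Cod cat F \<and>
      Comp cat ?r ?l = F"
    using HomD(1,2)[OF F] comp by simp
  ultimately show "\<exists>l\<in>Cof. \<exists>r\<in>Fib \<inter> W. Dom cat l = Dom cat F \<and> Cod cat l = Dom cat r \<and>
      Cod cat r = Cod cat F \<and> Comp cat r l = F"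
    using lC by blast
qed

text \<open>
  The middle object \<open>R\<close> is the operadic mapping path object: its objects are the isomorphisms
  \<open>\<alpha> : F p \<rightarrow> q\<close> (with their inverse \<open>\<beta>\<close>) and its morphisms are those of \<open>P\<close> between the \<open>p\<close>. The
  functor to \<open>Q\<close> takes \<open>\<alpha>\<close> to \<open>q\<close> and conjugates the values of \<open>F\<close>. It lifts \<open>\<chi> : q \<rightarrow> q'\<close> to the morphism
  \<open>\<alpha> \<rightarrow> \<chi> \<circ> \<alpha>\<close> given by the identity of \<open>p\<close>.
\<close>

lemma factor_trivial_cofibration_fibration: "has_factorizations cat (Cof \<inter> W) Fib"
  unfolding has_factorizations_def
proof
  fix F assume "F \<in> Arr cat"
  then obtain P Q where F: "F \<in> Hom cat P Q" using Arr_iff by blast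
  have o: "operad P" "operad Q" and g: "is_operad P" "is_operad Q" and ob: "P \<in> small_operads" "Q \<in> small_operads"
    using F by (auto simp: Hom_iff intro: small_operadsD)
  note pF = HomD(5)[OF F]
  interpret P: perm_operad G P "act_of P" by (rule g)
  interpret Q: perm_operad G Q "act_of Q" by (rule g)
  define X where "X = {(p, \<alpha>, \<beta>, q). p \<in> ob P \<and> mutually_inverse Q (on_ob F p) q \<alpha> \<beta>}"
  have "X \<subseteq> ob P \<times> mor Q \<times> mor Q \<times> ob Q"
    using Q.mutually_inverse_ob by (auto simp: X_def)
  moreover have "is_small (ob P \<times> mor Q \<times> mor Q \<times> ob Q)"
    using ob small_operadsD by (intro small_Times) auto
  ultimately have "is_small X" using small_subset by blast
  moreover have "fst x \<in> ob P" if "x \<in> X" for x using that by (auto simp: X_def)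
  ultimately obtain R eo "do" \<pi>o \<pi>m where R: "R \<in> small_operads" "ob R = eo ` X" "\<And>x. x \<in> X \<Longrightarrow> do (eo x) = x"
    and pi: "is_functor R P \<pi>o \<pi>m" "hom_bijective R P \<pi>o \<pi>m" and pie: "\<And>x. x \<in> X \<Longrightarrow> \<pi>o (eo x) = fst x"
    using pullback_along_objects[OF ob(1), of X fst] by metis
  have gR: "is_operad R" and oR: "operad R" using R(1) small_operadsD by auto
  interpret R: perm_operad G R "act_of R" by (rule gR)
  define \<alpha> \<beta> t where "\<alpha> r = fst (snd (do r))" and "\<beta> r = fst (snd (snd (do r)))"
    and "t r = snd (snd (snd (do r)))" for r
  have Rfam: "mutually_inverse Q (on_ob F (\<pi>o r)) (t r) (\<alpha> r) (\<beta> r)" if "r \<in> ob R" for r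
  proof -
    obtain x where x: "x \<in> X" "r = eo x" using R(2) \<open>r \<in> ob R\<close> by blast
    then show ?thesis using R(3)[OF x(1)] pie[OF x(1)] by (auto simp: X_def \<alpha>_def \<beta>_def t_def)
  qed
  have fam: "iso_family G Q (act_of Q) (ob R) (\<lambda>r. on_ob F (\<pi>o r)) t \<alpha> \<beta>"
    by unfold_locales (rule Rfam)
  interpret fam: iso_family G Q "act_of Q" "ob R" "\<lambda>r. on_ob F (\<pi>o r)" t \<alpha> \<beta> by (rule fam)
  have Fpi: "is_functor R Q (\<lambda>r. on_ob F (\<pi>o r)) (\<lambda>f. on_mor F (\<pi>m f))"
    using perm_functor_compose[OF pi(1) pF] by (simp add: comp_def)
  define rm where "rm f = conjugate Q \<alpha> \<beta> (ins R f) (out R f) (on_mor F (\<pi>m f))" for f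
  have rm: "is_functor R Q t rm"
    using perm_functor_transport[OF gR Fpi fam] by (simp add: rm_def[abs_def])
  \<comment> \<open>The first functor of the factorisation sends \<open>p\<close> to the identity of \<open>F p\<close>.\<close>
  define c where "c p = (p, opid Q (on_ob F p), opid Q (on_ob F p), on_ob F p)" for p
  have cX: "c p \<in> X" if "p \<in> ob P" for p
    using that pf_mems(1)[OF F that] Q.mutually_inverse_opid by (auto simp: X_def c_def)
  define ho where "ho p = eo (c p)" for p
  have ho: "\<And>p. p \<in> ob P \<Longrightarrow> ho p \<in> ob R" "\<And>p. p \<in> ob P \<Longrightarrow> \<pi>o (ho p) = p"
    using cX R pie by (auto simp: ho_def c_def)
  have ho_data: "\<alpha> (ho p) = opid Q (on_ob F p)" "\<beta> (ho p) = opid Q (on_ob F p)" "t (ho p) = on_ob F p"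
    if "p \<in> ob P" for p
    using R(3)[OF cX[OF that]] by (simp_all add: \<alpha>_def \<beta>_def t_def ho_def) (simp_all add: c_def)
  obtain hm where hm: "is_functor P R ho hm" "\<forall>f\<in>mor P. \<pi>m (hm f) = f"
    by (rule hom_bijective_lift[OF gR g(1,1) pi perm_functor_id ho])
  let ?l = "arrow P R ho hm" and ?r = "arrow R Q t rm"
  have l: "?l \<in> Hom cat P R" by (rule arrow_Hom[OF ob(1) R(1) hm(1)])
  have r: "?r \<in> Hom cat R Q" by (rule arrow_Hom[OF R(1) ob(2) rm])
  have "inj_on ho (ob P)" using ho(2) by (metis inj_on_inverseI)
  then have "inj_on (on_ob ?l) (ob P)" by (simp add: inj_on_def)
  then have lC: "?l \<in> Cof" by (simp add: Cof_iff[OF l])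
  have "hom_bijective P P (\<pi>o \<circ> ho) (\<pi>m \<circ> hm)"
    by (rule hom_bijective_cong[OF o(1), THEN iffD2, OF _ _ hom_bijective_id]) (simp_all add: ho(2) hm(2))
  then have lff: "hom_bijective P R ho hm" by (rule hom_bijective_cancel_left[OF hm(1) o(1) pi(2) oR])
  have lff': "hom_bijective P R (on_ob ?l) (on_mor ?l)"
    by (rule hom_bijective_cong[OF o(1), THEN iffD2, OF _ _ lff]) simp_all
  have les: "iso_surjective P R ho"
    unfolding iso_surjective_def
  proof
    fix y assume y: "y \<in> ob R"
    have py: "\<pi>o y \<in> ob P" by (rule pf_ob[OF pi(1) y])
    have "mutually_inverse P (\<pi>o (ho (\<pi>o y))) (\<pi>o y) (opid P (\<pi>o y)) (opid P (\<pi>o y))"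
      using ho(2)[OF py] P.mutually_inverse_opid[OF py] by simp
    then show "\<exists>x\<in>ob P. \<exists>\<alpha> \<beta>. mutually_inverse R (ho x) y \<alpha> \<beta>"
      using hom_bijective_reflect_inverse[OF pi(1) oR pi(2) ho(1)[OF py] y] py by metis
  qed
  have les': "iso_surjective P R (on_ob ?l)" by (rule iso_surjective_cong[THEN iffD2, OF _ les]) simp
  have rfib: "isofibration R Q t rm"
    unfolding isofibration_def
  proof (intro ballI allI impI)
    fix e q \<chi> \<chi>' assume e: "e \<in> ob R" and m: "mutually_inverse Q (t e) q \<chi> \<chi>'"
    have pe: "\<pi>o e \<in> ob P" by (rule pf_ob[OF pi(1) e])
    \<comment> \<open>The object \<open>\<chi> \<circ> \<alpha>\<close> of \<open>R\<close>, in which \<open>\<chi>\<close> is to be lifted.\<close>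
    let ?x = "(\<pi>o e, opcomp Q \<chi> [\<alpha> e], opcomp Q (\<beta> e) [\<chi>'], q)"
    have xX: "?x \<in> X" using Q.mutually_inverse_trans[OF Rfam[OF e] m] pe by (simp add: X_def)
    have e': "eo ?x \<in> ob R" "\<pi>o (eo ?x) = \<pi>o e" using xX R(2) pie[OF xX] by auto
    have "mutually_inverse P (\<pi>o e) (\<pi>o (eo ?x)) (opid P (\<pi>o e)) (opid P (\<pi>o e))"
      using P.mutually_inverse_opid[OF pe] e'(2) by simp
    then obtain \<mu> \<mu>' where \<mu>: "mutually_inverse R e (eo ?x) \<mu> \<mu>'" "\<pi>m \<mu> = opid P (\<pi>o e)"
      using hom_bijective_reflect_inverse[OF pi(1) oR pi(2) e e'(1)] by metis
    note fe = fam.family_hom[OF e] and mo = R.mutually_inverse_ob[OF \<mu>(1)] and mq = Q.mutually_inverse_ob[OF m]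
    have \<alpha>e': "\<alpha> (eo ?x) = opcomp Q \<chi> [\<alpha> e]" using R(3)[OF xX] by (simp add: \<alpha>_def)
    \<comment> \<open>The value at the lift is \<open>(\<chi> \<circ> \<alpha>) \<circ> id \<circ> \<beta>\<close>.\<close>
    have "rm \<mu> = opcomp Q (opcomp Q (\<alpha> (eo ?x)) [opid Q (on_ob F (\<pi>o e))]) [\<beta> e]"
      using mo \<mu>(2) pf_opid[OF pF pe] by (simp add: rm_def conjugate_def)
    also have "opcomp Q (\<alpha> (eo ?x)) [opid Q (on_ob F (\<pi>o e))] = \<alpha> (eo ?x)"
      using fam.family_hom[OF e'(1)] e'(2) Q.opcomp_opid[of "\<alpha> (eo ?x)"] by simp
    also have "opcomp Q (\<alpha> (eo ?x)) [\<beta> e] = opcomp Q \<chi> [opcomp Q (\<alpha> e) [\<beta> e]]"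
      unfolding \<alpha>e' using fe mq by (intro Q.opcomp_assoc1) (auto simp: composable_def)
    also have "\<dots> = \<chi>" using fe mq Q.opcomp_opid[of \<chi>] by simp
    finally show "\<exists>e' \<mu> \<mu>'. mutually_inverse R e e' \<mu> \<mu>' \<and> rm \<mu> = \<chi>" using \<mu>(1) by blast
  qed
  have rfib': "isofibration R Q (on_ob ?r) (on_mor ?r)"
    by (rule isofibration_cong[THEN iffD2, OF _ _ rfib]) simp_all
  have comp: "Comp cat ?r ?l = F"
  proof (rule Hom_eqI[OF Comp_in_Hom[OF l r] F])
    show "on_ob (Comp cat ?r ?l) p = on_ob F p" if "p \<in> ob P" for p
      using that ho ho_data by simp
    show "on_mor (Comp cat ?r ?l) f = on_mor F f" if f: "f \<in> mor P" for f
    proof -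
      have io: "set (map ho (ins P f)) \<subseteq> ob R" "ho (out P f) \<in> ob R"
        using ho(1) P.ins_ob[OF f] P.out_ob[OF f] by auto
      have e: "map (\<lambda>r. on_ob F (\<pi>o r)) (map ho (ins P f)) = map (on_ob F) (ins P f)"
        using ho(2) P.ins_ob[OF f] by auto
      have fi: "on_mor F f \<in> ophom Q (map (\<lambda>r. on_ob F (\<pi>o r)) (map ho (ins P f))) (on_ob F (\<pi>o (ho (out P f))))"
        unfolding e ho(2)[OF P.out_ob[OF f]] by (rule pf_hom[OF pF f])
      have "rm (hm f) = on_mor F f"
        unfolding rm_def pf_ins[OF hm(1) f] pf_out[OF hm(1) f] bspec[OF hm(2) f]
        using ho ho_data P.ins_ob[OF f] P.out_ob[OF f]
        by (intro fam.conjugate_identities[OF fi io(2,1)]) auto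
      then show ?thesis using f pf_mor[OF hm(1) f] by simp
    qed
  qed
  have "?l \<in> Cof \<inter> W" using lC lff' les' W_iff[OF l] by blast
  moreover have "?r \<in> Fib" using rfib' Fib_iff[OF r] by blast
  moreover have "Dom cat ?l = Dom cat F \<and> Cod cat ?l = Dom cat ?r \<and> Cod cat ?r = Cod cat F \<and>
      Comp cat ?r ?l = F"
    using HomD(1,2)[OF F] comp by simp
  ultimately show "\<exists>l\<in>Cof \<inter> W. \<exists>r\<in>Fib. Dom cat l = Dom cat F \<and> Cod cat l = Dom cat r \<and>
      Cod cat r = Cod cat F \<and> Comp cat r l = F"
    by (intro bexI[of _ ?l] bexI[of _ ?r])
qed

theorem model_structure: "quillen_model_structure U cat W Fib Cof"
  unfolding quillen_model_structure_def
proof (intro conjI ballI impI)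
  show "W \<subseteq> Arr cat" "Fib \<subseteq> Arr cat" "Cof \<subseteq> Arr cat"
    by (simp_all add: W_def Fib_def Cof_def)
qed (fact category_cat has_small_limits_cat has_small_colimits_cat two_out_of_three_W
    retracts_W retracts_Fib retracts_Cof factor_cofibration_trivial_fibration
    factor_trivial_cofibration_fibration | rule lifting, assumption+)+

end


section \<open>Plain and symmetric operads\<close>

text \<open>
  When only identities act, the trivial action satisfies the axioms, including both equivariance
  axioms: neither side of them moves any input.
\<close>

lemma perm_operad_trivial:
  assumes "operad P" shows "perm_operad (\<lambda>_. {id}) P (\<lambda>_ f. f)"
proof -
  interpret operad P by fact
  have "map2 (\<lambda>_ g. g) \<sigma>s gs = gs" if "length \<sigma>s = length gs" for \<sigma>s :: "(nat \<Rightarrow> nat) list" and gs :: "'b list"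
    using that by (intro nth_equalityI) auto
  then show ?thesis
    by unfold_locales (auto simp: permutes_id ophom_iff dest: list_all2_lengthD)
qed

lemma operad_functor_iff:
  "operad_functor F \<longleftrightarrow> operad (source F) \<and> operad (target F) \<and>
     on_ob F \<in> extensional (ob (source F)) \<and> on_mor F \<in> extensional (mor (source F)) \<and>
     perm_functor (\<lambda>_. {id}) (source F) (\<lambda>_ f. f) (target F) (\<lambda>_ f. f) (on_ob F) (on_mor F)"
proof
  assume F: "operad_functor F"
  have "perm_functor (\<lambda>_. {id}) (source F) (\<lambda>_ f. f) (target F) (\<lambda>_ f. f) (on_ob F) (on_mor F)"
    by (rule perm_functorI) (use F in \<open>simp_all add: operad_functor_def Let_def PiE_iff\<close>)
  with F show "operad (source F) \<and> operad (target F) \<and>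
     on_ob F \<in> extensional (ob (source F)) \<and> on_mor F \<in> extensional (mor (source F)) \<and>
     perm_functor (\<lambda>_. {id}) (source F) (\<lambda>_ f. f) (target F) (\<lambda>_ f. f) (on_ob F) (on_mor F)"
    by (simp add: operad_functor_def Let_def PiE_iff)
next
  assume F: "operad (source F) \<and> operad (target F) \<and>
     on_ob F \<in> extensional (ob (source F)) \<and> on_mor F \<in> extensional (mor (source F)) \<and>
     perm_functor (\<lambda>_. {id}) (source F) (\<lambda>_ f. f) (target F) (\<lambda>_ f. f) (on_ob F) (on_mor F)"
  then have pf: "perm_functor (\<lambda>_. {id}) (source F) (\<lambda>_ f. f) (target F) (\<lambda>_ f. f) (on_ob F) (on_mor F)"
    by simp
  show "operad_functor F"
    unfolding operad_functor_def Let_def PiE_iff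
    using F pf_ob[OF pf] pf_mor[OF pf] pf_hom[OF pf] pf_opid[OF pf] pf_opcomp[OF pf] by simp
qed

lemma Ope_kind:
  assumes "inaccessible (UNIV :: 'u set)"
  shows "operad_kind (\<lambda>_. {id}) (\<lambda>(P :: ('u, 'u) operad) _ f. f) (\<lambda>P _. P)"
proof (intro operad_kind.intro universe.intro operad_kind_axioms.intro)
  fix P :: "('u, 'u) operad" and a assume P: "perm_operad (\<lambda>_. {id}) P a"
  show "perm_operad (\<lambda>_. {id}) P (\<lambda>_ f. f)" by (rule perm_operad_trivial) (rule perm_operad.axioms(1)[OF P])
  fix f \<sigma> assume "f \<in> mor P" "\<sigma> \<in> {id :: nat \<Rightarrow> nat}"
  then show "f = a \<sigma> f" using perm_operad.pact_id[OF P] by simp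
qed (use assms in \<open>auto simp: permutes_id\<close>)

lemma sym_operad_iff: "sym_operad P \<longleftrightarrow> perm_operad (\<lambda>n. {\<sigma>. \<sigma> permutes {..<n}}) P (act P)"
  by (simp only: sym_operad_def sym_operad_axioms_def perm_operad_def perm_operad_axioms_def
      mem_Collect_eq simp_thms)

lemma sym_operad_functor_iff:
  "sym_operad_functor F \<longleftrightarrow> sym_operad (source F) \<and> sym_operad (target F) \<and>
     on_ob F \<in> extensional (ob (source F)) \<and> on_mor F \<in> extensional (mor (source F)) \<and>
     perm_functor (\<lambda>n. {\<sigma>. \<sigma> permutes {..<n}}) (source F) (act (source F)) (target F) (act (target F))
       (on_ob F) (on_mor F)"
proof -
  have o: "sym_operad (source F) \<Longrightarrow> operad (source F)" "sym_operad (target F) \<Longrightarrow> operad (target F)"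
    by (simp_all add: sym_operad_def)
  let ?G = "\<lambda>n. {\<sigma>. \<sigma> permutes {..<n}}"
  have "perm_functor ?G (source F) (act (source F)) (target F) (act (target F)) (on_ob F) (on_mor F) \<longleftrightarrow>
      perm_functor (\<lambda>_. {id}) (source F) (\<lambda>_ f. f) (target F) (\<lambda>_ f. f) (on_ob F) (on_mor F) \<and>
      (\<forall>f \<in> mor (source F). \<forall>\<sigma>. \<sigma> permutes {..<arity (source F) f} \<longrightarrow>
        on_mor F (act (source F) \<sigma> f) = act (target F) \<sigma> (on_mor F f))"
    by (simp add: perm_functor_def)
  then show ?thesis
    using o by (simp only: sym_operad_functor_def operad_functor_iff) blast
qed

definition with_act :: "('o, 'm) operad \<Rightarrow> ((nat \<Rightarrow> nat) \<Rightarrow> 'm \<Rightarrow> 'm) \<Rightarrow> ('o, 'm) sym_operad" where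
  "with_act P a = \<lparr>ob = ob P, mor = mor P, ins = ins P, out = out P, opid = opid P, opcomp = opcomp P, act = a\<rparr>"

lemma with_act_simps [simp]:
  "ob (with_act P a) = ob P" "mor (with_act P a) = mor P" "ins (with_act P a) = ins P"
  "out (with_act P a) = out P" "opid (with_act P a) = opid P" "opcomp (with_act P a) = opcomp P"
  "act (with_act P a) = a"
  by (simp_all add: with_act_def)

lemma Ope_Sigma_kind:
  assumes "inaccessible (UNIV :: 'u set)"
  shows "operad_kind (\<lambda>n. {\<sigma>. \<sigma> permutes {..<n}}) (act :: ('u, 'u) sym_operad \<Rightarrow> _) with_act"
proof (intro operad_kind.intro universe.intro operad_kind_axioms.intro)
  fix P :: "('u, 'u) operad" and a assume P: "perm_operad (\<lambda>n. {\<sigma>. \<sigma> permutes {..<n}}) P a"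
  have e: "composable (with_act P a) = composable P" "ophom (with_act P a) = ophom P" "arity (with_act P a) = arity P"
    by (simp_all add: fun_eq_iff composable_def ophom_def arity_def)
  show "perm_operad (\<lambda>n. {\<sigma>. \<sigma> permutes {..<n}}) (with_act P a) (act (with_act P a))"
    using P unfolding perm_operad_def perm_operad_axioms_def operad_def e with_act_simps .
qed (use assms in auto)

theorem theorem2p1:
  assumes "inaccessible (UNIV :: 'u set)"
  shows
    "quillen_model_structure TYPE('u) (Ope :: (('u, 'u) operad, _) category)
       {F \<in> Arr Ope. operadic_equivalence F}
       {F \<in> Arr Ope. lifts_isomorphisms F}
       {F \<in> Arr Ope. injective_on_objects F}
     \<and>
     quillen_model_structure TYPE('u) (Ope_Sigma :: (('u, 'u) sym_operad, _) category)
       {F \<in> Arr Ope_Sigma. operadic_equivalence F}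
       {F \<in> Arr Ope_Sigma. lifts_isomorphisms F}
       {F \<in> Arr Ope_Sigma. injective_on_objects F}"
proof
  interpret o: operad_kind "TYPE('u)" "\<lambda>_. {id}" "\<lambda>(P :: ('u, 'u) operad) _ f. f" "\<lambda>P _. P"
    by (rule Ope_kind[OF assms])
  have gop: "o.is_operad P \<longleftrightarrow> operad P" for P :: "('u, 'u) operad"
    using perm_operad_trivial[of P] perm_operad.axioms(1) by blast
  have "o.small_operads = {P. operad P \<and> small (ob P) \<and> small (mor P)}"
    by (simp only: o.small_operads_def gop small_in_def)
  moreover have "o.functors = {F. operad_functor F}"
    by (simp only: o.functors_def gop operad_functor_iff)
  ultimately have "o.cat = Ope" by (simp add: o.cat_def Ope_def)
  then show "quillen_model_structure TYPE('u) (Ope :: (('u, 'u) operad, _) category)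
       {F \<in> Arr Ope. operadic_equivalence F} {F \<in> Arr Ope. lifts_isomorphisms F}
       {F \<in> Arr Ope. injective_on_objects F}"
    using o.model_structure by (simp add: o.W_def o.Fib_def o.Cof_def)
next
  interpret s: operad_kind "TYPE('u)" "\<lambda>n. {\<sigma>. \<sigma> permutes {..<n}}" "act :: ('u, 'u) sym_operad \<Rightarrow> _" with_act
    by (rule Ope_Sigma_kind[OF assms])
  have "s.small_operads = {P. sym_operad P \<and> small (ob P) \<and> small (mor P)}"
    by (simp only: s.small_operads_def sym_operad_iff small_in_def)
  moreover have "s.functors = {F. sym_operad_functor F}"
    by (simp only: s.functors_def sym_operad_functor_iff sym_operad_iff)
  ultimately have "s.cat = Ope_Sigma" by (simp add: s.cat_def Ope_Sigma_def)
  then show "quillen_model_structure TYPE('u) (Ope_Sigma :: (('u, 'u) sym_operad, _) category)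
       {F \<in> Arr Ope_Sigma. operadic_equivalence F} {F \<in> Arr Ope_Sigma. lifts_isomorphisms F}
       {F \<in> Arr Ope_Sigma. injective_on_objects F}"
    using s.model_structure by (simp add: s.W_def s.Fib_def s.Cof_def)
qed

end
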